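(* Let $E\to M$ and $E'\to M$ be smooth vector bundles over the same base manifold $M$, let $K$ be a linear connection on $E$ and $K'$ a linear connection on $E'$. Regard the curvatures as bilinear morphisms over $M$: $$R[K]:E\times_ME^*\to\Lambda^2T^*M,\quad R[K']:E'\times_ME'^*\to\Lambda^2T^*M,\quad R[K\otimes K']:(E\otimes_ME')\times_M(E\otimes_ME')^*\to\Lambda^2T^*M .$$ Then $R[K\otimes K']$ is the unique bilinear morphism over $M$ from $(E\otimes_ME')\times_M(E^*\otimes_ME'^* )$ to $\Lambda^2T^*M$ such that $$R[K\otimes K'](e\otimes e',\,e^*\otimes e'^* )=\langle e',e'^*\rangle'\,R[K](e,e^* )+\langle e,e^*\rangle\,R[K'](e',e'^* )$$ for all $x\in M$ and all $e\in E_x$, $e'\in E'_x$, $e^*\in E^*_x$, $e'^*\in E'^*_x$. Here $\langle\,,\rangle$ and $\langle\,,\rangle'$ are the evaluation morphisms on $E$ and $E'$, respectively.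
   Context: All manifolds and maps are smooth; the summation convention over repeated indices is used (sums over all values of the indices). $d^\lambda=dx^\lambda$, $\partial_\lambda=\partial/\partial x^\lambda$, $\partial_i=\partial/\partial y^i$; $VE$ is the vertical bundle. The dual $(E\otimes_ME')^*$ is identified with $E^*\otimes_ME'^*$. A linear connection on a vector bundle $E\to M$ is a linear splitting $K:E\to J^1E$ (a vector bundle morphism over $M$ that is a section of $\pi^1_0:J^1E\to E$). Equivalently it is the tangent-valued 1-form $K:E\to T^*M\otimes TE$ projecting onto the identity of $TM$, with coordinate expression $K=d^\lambda\otimes(\partial_\lambda+K_j{}^i{}_\lambda\,y^j\,\partial_i)$ in linear fiber coordinates $(x^\lambda,y^i)$. The curvature of a linear connection $K$ is the vertical-valued 2-form $R[K]=-[K,K]:E\to VE\otimes\Lambda^2T^*M$, with $[\,,]$ the Frölicher–Nijenhuis bracket. In coordinates $R[K]=R[K]_j{}^i{}_{\lambda\mu}\,y^j\,\partial_i\otimes d^\lambda\wedge d^\mu$ with $$R[K]_j{}^i{}_{\lambda\mu}=\partial_\mu K_j{}^i{}_\lambda-\partial_\lambda K_j{}^i{}_\mu+K_j{}^p{}_\mu K_p{}^i{}_\lambda-K_j{}^p{}_\lambda K_p{}^i{}_\mu .$$ Using $VE=E\times_ME$ and linearity, $R[K]$ is a section of $E^*\otimes E\otimes\Lambda^2T^*M$ over $M$, hence a bilinear morphism $E\times_ME^*\to\Lambda^2T^*M$, $R[K](e,e^* )=R[K]_j{}^i{}_{\lambda\mu}e^je_i\,d^\lambda\wedge d^\mu$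 for $e=(e^j)$, $e^*=(e_i)$. The same applies to $K'$ and $K\otimes K'$. The tensor product connection $K\otimes K':E\otimes_ME'\to J^1(E\otimes_ME')$ is the unique linear connection with $(K\otimes K')\circ\otimes=J^1\otimes\circ(K\times K')$ on $E\times_ME'$, where $\otimes:E\times_M E'\to E\otimes_M E'$ is the tensor product map and $J^1\otimes:(j^1\Phi,j^1\Phi')\mapsto j^1(\Phi\otimes\Phi')$. Its coordinate expression, in the coordinates $(x^\lambda,w^{ia})$ induced by linear fiber coordinates $(x^\lambda,y^i)$ on $E$ and $(x^\lambda,z^a)$ on $E'$, is $K\otimes K'=d^\lambda\otimes\big(\partial_\lambda+(K_j{}^i{}_\lambda w^{ja}+K'_b{}^a{}_\lambda w^{ib})\,\partial/\partial w^{ia}\big)$. *)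

theory Defs
  imports "HOL-Analysis.Analysis" "HOL-Library.Function_Algebras"
begin

text \<open>Pointwise real vector space structure on functions; the fibres of dual and tensor product
  bundles are linear subspaces of such function spaces.\<close>

instantiation "fun" :: (type, real_vector) real_vector
begin

definition scaleR_fun :: "real \<Rightarrow> ('a \<Rightarrow> 'b) \<Rightarrow> 'a \<Rightarrow> 'b"
  where "scaleR_fun c f = (\<lambda>x. c *\<^sub>R f x)"

instance
  by standard (simp_all add: scaleR_fun_def plus_fun_def fun_eq_iff scaleR_add_right scaleR_add_left)

end

section \<open>Smooth maps and manifolds\<close>

text \<open>\<open>C\<^sup>k\<close> through iterated directional derivatives. The definition is meant for open subsets of
  finite-dimensional spaces, where it agrees with \<open>C\<^sup>k\<close> in the Frechet sense.\<close>

primrec Ck_on :: "nat \<Rightarrow> 'a::real_normed_vector set \<Rightarrow> ('a \<Rightarrow> 'b::real_normed_vector) \<Rightarrow> bool" where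
  "Ck_on 0 = (\<lambda>S f. continuous_on S f)"
| "Ck_on (Suc k) = (\<lambda>S f. (\<forall>x\<in>S. f differentiable at x) \<and>
     (\<forall>v. Ck_on k S (\<lambda>x. frechet_derivative f (at x) v)))"

definition smooth_on :: "'a::real_normed_vector set \<Rightarrow> ('a \<Rightarrow> 'b::real_normed_vector) \<Rightarrow> bool"
  where "smooth_on S f \<longleftrightarrow> (\<forall>k. Ck_on k S f)"

text \<open>A chart is a pair of a domain and a coordinate map, whose values outside the domain are
  irrelevant.\<close>

type_synonym ('m, 'n) chart = "'m set \<times> ('m \<Rightarrow> real ^ 'n)"

definition dom :: "'m set \<times> 'c \<Rightarrow> 'm set"
  where "dom c = fst c"

definition coord :: "('m, 'n) chart \<Rightarrow> 'm \<Rightarrow> real ^ 'n"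
  where "coord c = snd c"

definition point :: "('m, 'n) chart \<Rightarrow> real ^ 'n \<Rightarrow> 'm"
  where "point c = inv_into (dom c) (coord c)"

definition points :: "('m, 'n) chart set \<Rightarrow> 'm set"
  where "points A = (\<Union>c\<in>A. dom c)"

text \<open>The manifold is the open subset \<open>points A\<close> of a second countable Hausdorff space, with the
  smooth structure generated by the (not necessarily maximal) atlas \<open>A\<close>.\<close>

definition smooth_manifold ::
    "('m::{second_countable_topology, t2_space}, 'n::finite) chart set \<Rightarrow> bool" where
  "smooth_manifold A \<longleftrightarrow>
     (\<forall>c\<in>A. open (dom c) \<and> open (coord c ` dom c) \<and>
        homeomorphism (dom c) (coord c ` dom c) (coord c) (point c)) \<and>
     (\<forall>c\<in>A. \<forall>c'\<in>A. smooth_on (coord c ` (dom c \<inter> dom c')) (coord c' \<circ> point c))"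

definition smooth_map_on ::
    "('m, 'n::finite) chart set \<Rightarrow> 'm set \<Rightarrow> ('m \<Rightarrow> 'b::real_normed_vector) \<Rightarrow> bool" where
  "smooth_map_on A W f \<longleftrightarrow> (\<forall>c\<in>A. smooth_on (coord c ` (dom c \<inter> W)) (f \<circ> point c))"

text \<open>A tangent vector at \<open>x\<close> is a family of coordinate vectors, one for every chart of the atlas
  at \<open>x\<close>, related by the Jacobians of the coordinate changes.\<close>

type_synonym ('m, 'n) tvec = "('m, 'n) chart \<Rightarrow> real ^ 'n"

definition tangent_space :: "('m, 'n::finite) chart set \<Rightarrow> 'm \<Rightarrow> ('m, 'n) tvec set" where
  "tangent_space A x = {X.
     (\<forall>c\<in>A. \<forall>c'\<in>A. x \<in> dom c \<and> x \<in> dom c' \<longrightarrow>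
        X c' = frechet_derivative (coord c' \<circ> point c) (at (coord c x)) (X c)) \<and>
     (\<forall>c. \<not> (c \<in> A \<and> x \<in> dom c) \<longrightarrow> X c = 0)}"

text \<open>The tangent vector at \<open>x\<close> with components \<open>u\<close> in the chart \<open>c\<close>; it is
  \<open>\<partial>\<^sub>\<lambda>\<close> for \<open>u = axis \<lambda> 1\<close>.\<close>

definition coord_vector ::
    "('m, 'n::finite) chart set \<Rightarrow> ('m, 'n) chart \<Rightarrow> 'm \<Rightarrow> real ^ 'n \<Rightarrow> ('m, 'n) tvec" where
  "coord_vector A c x u = (\<lambda>c'. if c' \<in> A \<and> x \<in> dom c'
     then frechet_derivative (coord c' \<circ> point c) (at (coord c x)) u else 0)"

text \<open>The fibre at \<open>x\<close> of \<open>\<Lambda>\<^sup>2T\<^sup>*M\<close>: alternating bilinear forms on the tangent space,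
  extended by zero to the ambient type. The basis form \<open>d\<^sup>\<lambda> \<and> d\<^sup>\<mu>\<close> corresponds to
  \<open>(u, v) \<mapsto> u\<^sup>\<lambda> v\<^sup>\<mu> - u\<^sup>\<mu> v\<^sup>\<lambda>\<close>.\<close>

type_synonym ('m, 'n) form2 = "('m, 'n) tvec \<Rightarrow> ('m, 'n) tvec \<Rightarrow> real"

definition linear_map_on :: "'a::real_vector set \<Rightarrow> ('a \<Rightarrow> 'b::real_vector) \<Rightarrow> bool" where
  "linear_map_on S f \<longleftrightarrow>
     (\<forall>u\<in>S. \<forall>v\<in>S. f (u + v) = f u + f v) \<and> (\<forall>u\<in>S. \<forall>r. f (r *\<^sub>R u) = r *\<^sub>R f u)"

definition bilinear_on ::
    "'a::real_vector set \<Rightarrow> 'b::real_vector set \<Rightarrow> ('a \<Rightarrow> 'b \<Rightarrow> 'c::real_vector) \<Rightarrow> bool" where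
  "bilinear_on S T f \<longleftrightarrow>
     (\<forall>v\<in>T. linear_map_on S (\<lambda>u. f u v)) \<and> (\<forall>u\<in>S. linear_map_on T (f u))"

definition forms2 :: "('m, 'n::finite) chart set \<Rightarrow> 'm \<Rightarrow> ('m, 'n) form2 set" where
  "forms2 A x = {\<omega>. bilinear_on (tangent_space A x) (tangent_space A x) \<omega> \<and>
     (\<forall>X\<in>tangent_space A x. \<omega> X X = 0) \<and>
     (\<forall>X Y. X \<notin> tangent_space A x \<or> Y \<notin> tangent_space A x \<longrightarrow> \<omega> X Y = 0)}"

section \<open>Vector bundles\<close>

text \<open>The fibre over \<open>x\<close> is a linear subspace \<open>fib E x\<close> of an arbitrary real vector space, so that
  the total space is \<open>Sigma (points A) (fib E)\<close>. A local trivialisation is a domain together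
  with the fibre coordinates \<open>(y\<^sup>i)\<close> on the fibres over it; \<open>(x, e) \<mapsto> (coord c x, fcoord t x e)\<close>
  are linear fibre coordinates on the total space. The topology and the smooth structure of the
  total space are the ones for which these are charts.\<close>

type_synonym ('m, 'e, 'k) trivialization = "'m set \<times> ('m \<Rightarrow> 'e \<Rightarrow> real ^ 'k)"

record ('m, 'e, 'k) vbundle =
  fib :: "'m \<Rightarrow> 'e set"
  triv :: "('m, 'e, 'k) trivialization set"

definition fcoord :: "('m, 'e, 'k) trivialization \<Rightarrow> 'm \<Rightarrow> 'e \<Rightarrow> real ^ 'k"
  where "fcoord t = snd t"

definition fpoint ::
    "('m, 'e, 'k) vbundle \<Rightarrow> ('m, 'e, 'k) trivialization \<Rightarrow> 'm \<Rightarrow> real ^ 'k \<Rightarrow> 'e"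
  where "fpoint E t x = inv_into (fib E x) (fcoord t x)"

definition vector_bundle ::
    "('m::topological_space, 'n::finite) chart set \<Rightarrow> ('m, 'e::real_vector, 'k::finite) vbundle \<Rightarrow> bool" where
  "vector_bundle A E \<longleftrightarrow>
     (\<forall>x\<in>points A. subspace (fib E x)) \<and>
     (\<forall>x\<in>points A. \<exists>t\<in>triv E. x \<in> dom t) \<and>
     (\<forall>t\<in>triv E. open (dom t) \<and> dom t \<subseteq> points A \<and>
        (\<forall>x\<in>dom t. linear_map_on (fib E x) (fcoord t x) \<and>
           bij_betw (fcoord t x) (fib E x) UNIV)) \<and>
     (\<forall>t\<in>triv E. \<forall>t'\<in>triv E. \<forall>y.
        smooth_map_on A (dom t \<inter> dom t') (\<lambda>x. fcoord t' x (fpoint E t x y)))"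

definition smooth_section ::
    "('m::topological_space, 'n::finite) chart set \<Rightarrow> ('m, 'e, 'k::finite) vbundle \<Rightarrow>
     'm set \<Rightarrow> ('m \<Rightarrow> 'e) \<Rightarrow> bool" where
  "smooth_section A E W s \<longleftrightarrow> open W \<and> W \<subseteq> points A \<and> (\<forall>x\<in>W. s x \<in> fib E x) \<and>
     (\<forall>t\<in>triv E. smooth_map_on A (dom t \<inter> W) (\<lambda>x. fcoord t x (s x)))"

definition dual_space :: "'e::real_vector set \<Rightarrow> ('e \<Rightarrow> real) set" where
  "dual_space V = {\<alpha>. linear_map_on V \<alpha> \<and> (\<forall>u. u \<notin> V \<longrightarrow> \<alpha> u = 0)}"

text \<open>Coordinates \<open>(e\<^sub>i)\<close> on the dual are the values on the frame that belongs to \<open>(y\<^sup>i)\<close>.\<close>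

definition dual_bundle ::
    "('m, 'e::real_vector, 'k::finite) vbundle \<Rightarrow> ('m, 'e \<Rightarrow> real, 'k) vbundle" where
  "dual_bundle E = \<lparr>fib = (\<lambda>x. dual_space (fib E x)),
     triv = (\<lambda>t. (dom t, \<lambda>x \<alpha>. \<chi> i. \<alpha> (fpoint E t x (axis i 1)))) ` triv E\<rparr>"

definition coframe ::
    "('m, 'e::real_vector, 'k::finite) vbundle \<Rightarrow> ('m, 'e, 'k) trivialization \<Rightarrow> 'm \<Rightarrow> 'k \<Rightarrow> 'e \<Rightarrow> real"
  where "coframe E t x i = (\<lambda>e. if e \<in> fib E x then fcoord t x e $ i else 0)"

text \<open>The tensor product of finite-dimensional spaces \<open>V\<close> and \<open>V'\<close> is the space of bilinear
  functions on \<open>V\<^sup>* \<times> V'\<^sup>*\<close>, with \<open>(e \<otimes> e')(\<alpha>, \<beta>) = \<alpha>(e) \<beta>(e')\<close>.\<close>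

definition tensor_space ::
    "'e::real_vector set \<Rightarrow> 'f::real_vector set \<Rightarrow> (('e \<Rightarrow> real) \<Rightarrow> ('f \<Rightarrow> real) \<Rightarrow> real) set" where
  "tensor_space V V' = {w. bilinear_on (dual_space V) (dual_space V') w \<and>
     (\<forall>\<alpha> \<beta>. \<alpha> \<notin> dual_space V \<or> \<beta> \<notin> dual_space V' \<longrightarrow> w \<alpha> \<beta> = 0)}"

definition tensor_bundle ::
    "('m, 'e::real_vector, 'k::finite) vbundle \<Rightarrow> ('m, 'f::real_vector, 'l::finite) vbundle \<Rightarrow>
     ('m, ('e \<Rightarrow> real) \<Rightarrow> ('f \<Rightarrow> real) \<Rightarrow> real, 'k \<times> 'l) vbundle" where
  "tensor_bundle E E' = \<lparr>fib = (\<lambda>x. tensor_space (fib E x) (fib E' x)),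
     triv = (\<lambda>(t, t'). (dom t \<inter> dom t',
        \<lambda>x w. \<chi> p. w (coframe E t x (fst p)) (coframe E' t' x (snd p)))) ` (triv E \<times> triv E')\<rparr>"

definition tensor_elem ::
    "('m, 'e::real_vector, 'k::finite) vbundle \<Rightarrow> ('m, 'f::real_vector, 'l::finite) vbundle \<Rightarrow> 'm \<Rightarrow>
     'e \<Rightarrow> 'f \<Rightarrow> ('e \<Rightarrow> real) \<Rightarrow> ('f \<Rightarrow> real) \<Rightarrow> real" where
  "tensor_elem E E' x e e' = (\<lambda>\<alpha> \<beta>.
     if \<alpha> \<in> dual_space (fib E x) \<and> \<beta> \<in> dual_space (fib E' x) then \<alpha> e * \<beta> e' else 0)"

text \<open>The tensor product of covectors, as an element of \<open>(E \<otimes> E')\<^sup>*\<close> through the identification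
  of \<open>(E \<otimes> E')\<^sup>*\<close> with \<open>E\<^sup>* \<otimes> E'\<^sup>*\<close>. It is the functional that sends \<open>e \<otimes> e'\<close> to
  \<open>\<alpha>(e) \<beta>(e')\<close>, which on bilinear functions is evaluation at \<open>(\<alpha>, \<beta>)\<close>.\<close>

definition cotensor_elem ::
    "('m, 'e::real_vector, 'k::finite) vbundle \<Rightarrow> ('m, 'f::real_vector, 'l::finite) vbundle \<Rightarrow> 'm \<Rightarrow>
     ('e \<Rightarrow> real) \<Rightarrow> ('f \<Rightarrow> real) \<Rightarrow> (('e \<Rightarrow> real) \<Rightarrow> ('f \<Rightarrow> real) \<Rightarrow> real) \<Rightarrow> real" where
  "cotensor_elem E E' x \<alpha> \<beta> = (\<lambda>w. if w \<in> fib (tensor_bundle E E') x then w \<alpha> \<beta> else 0)"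

section \<open>Jets and linear connections\<close>

text \<open>The derivative at \<open>x\<close>, in coordinates, of the section \<open>s\<close>; with \<open>u = axis \<lambda> 1\<close> its components
  are the jet coordinates \<open>y\<^sup>i\<^sub>\<lambda>\<close>.\<close>

definition section_deriv ::
    "('m, 'n::finite) chart \<Rightarrow> ('m, 'e, 'k::finite) trivialization \<Rightarrow> 'm \<Rightarrow> ('m \<Rightarrow> 'e) \<Rightarrow>
     real ^ 'n \<Rightarrow> real ^ 'k" where
  "section_deriv c t x s =
     frechet_derivative (\<lambda>z. fcoord t (point c z) (s (point c z))) (at (coord c x))"

definition local_section ::
    "('m::topological_space, 'n::finite) chart set \<Rightarrow> ('m, 'e, 'k::finite) vbundle \<Rightarrow> 'm \<Rightarrow>
     ('m \<Rightarrow> 'e) \<Rightarrow> bool" where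
  "local_section A E x s \<longleftrightarrow> (\<exists>W. x \<in> W \<and> smooth_section A E W s)"

text \<open>The jet \<open>j\<^sup>1\<^sub>x s\<close> is an equivalence class of local sections. A local section is represented by a
  total function, whose values away from \<open>x\<close> are irrelevant.\<close>

definition jet ::
    "('m::topological_space, 'n::finite) chart set \<Rightarrow> ('m, 'e, 'k::finite) vbundle \<Rightarrow> 'm \<Rightarrow>
     ('m \<Rightarrow> 'e) \<Rightarrow> ('m \<Rightarrow> 'e) set" where
  "jet A E x s = {r. local_section A E x r \<and> r x = s x \<and>
     (\<forall>c\<in>A. \<forall>t\<in>triv E. x \<in> dom c \<and> x \<in> dom t \<longrightarrow> section_deriv c t x r = section_deriv c t x s)}"

definition jet_fib ::
    "('m::topological_space, 'n::finite) chart set \<Rightarrow> ('m, 'e, 'k::finite) vbundle \<Rightarrow> 'm \<Rightarrow>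
     ('m \<Rightarrow> 'e) set set" where
  "jet_fib A E x = {jet A E x s | s. local_section A E x s}"

definition jet_add ::
    "('m::topological_space, 'n::finite) chart set \<Rightarrow> ('m, 'e::real_vector, 'k::finite) vbundle \<Rightarrow> 'm \<Rightarrow>
     ('m \<Rightarrow> 'e) set \<Rightarrow> ('m \<Rightarrow> 'e) set \<Rightarrow> ('m \<Rightarrow> 'e) set" where
  "jet_add A E x P Q = (\<Union>s\<in>P. \<Union>r\<in>Q. jet A E x (\<lambda>y. s y + r y))"

definition jet_scale ::
    "('m::topological_space, 'n::finite) chart set \<Rightarrow> ('m, 'e::real_vector, 'k::finite) vbundle \<Rightarrow> 'm \<Rightarrow>
     real \<Rightarrow> ('m \<Rightarrow> 'e) set \<Rightarrow> ('m \<Rightarrow> 'e) set" where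
  "jet_scale A E x a P = (\<Union>s\<in>P. jet A E x (\<lambda>y. a *\<^sub>R s y))"

definition jet_deriv ::
    "('m, 'n::finite) chart \<Rightarrow> ('m, 'e, 'k::finite) trivialization \<Rightarrow> 'm \<Rightarrow> ('m \<Rightarrow> 'e) set \<Rightarrow>
     real ^ 'n \<Rightarrow> real ^ 'k" where
  "jet_deriv c t x P = section_deriv c t x (SOME s. s \<in> P)"

text \<open>A linear connection as a map \<open>K : E \<rightarrow> J\<^sup>1E\<close>: a section of \<open>\<pi>\<^sup>1\<^sub>0\<close>, linear on the fibres and
  smooth in the coordinates \<open>(x\<^sup>\<lambda>, y\<^sup>i, y\<^sup>i\<^sub>\<lambda>)\<close> of \<open>J\<^sup>1E\<close>. Outside of \<open>E\<close> it has a fixed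
  dummy value, so that equal connections are equal functions.\<close>

type_synonym ('m, 'e) conn = "'m \<Rightarrow> 'e \<Rightarrow> ('m \<Rightarrow> 'e) set"

definition linear_connection ::
    "('m::topological_space, 'n::finite) chart set \<Rightarrow> ('m, 'e::real_vector, 'k::finite) vbundle \<Rightarrow>
     ('m, 'e) conn \<Rightarrow> bool" where
  "linear_connection A E K \<longleftrightarrow>
     (\<forall>x\<in>points A. \<forall>e\<in>fib E x. K x e \<in> jet_fib A E x \<and> (\<forall>s\<in>K x e. s x = e)) \<and>
     (\<forall>x\<in>points A. \<forall>e\<in>fib E x. \<forall>f\<in>fib E x. K x (e + f) = jet_add A E x (K x e) (K x f)) \<and>
     (\<forall>x\<in>points A. \<forall>e\<in>fib E x. \<forall>a. K x (a *\<^sub>R e) = jet_scale A E x a (K x e)) \<and>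
     (\<forall>c\<in>A. \<forall>t\<in>triv E. \<forall>u. smooth_on ((coord c ` (dom c \<inter> dom t)) \<times> UNIV)
        (\<lambda>(z, y). jet_deriv c t (point c z) (K (point c z) (fpoint E t (point c z) y)) u)) \<and>
     (\<forall>x e. x \<notin> points A \<or> e \<notin> fib E x \<longrightarrow> K x e = {})"

text \<open>The fibred map \<open>J\<^sup>1\<otimes> : (j\<^sup>1s, j\<^sup>1s') \<mapsto> j\<^sup>1(s \<otimes> s')\<close>.\<close>

definition jet_tensor ::
    "('m::topological_space, 'n::finite) chart set \<Rightarrow> ('m, 'e::real_vector, 'k::finite) vbundle \<Rightarrow>
     ('m, 'f::real_vector, 'l::finite) vbundle \<Rightarrow> 'm \<Rightarrow> ('m \<Rightarrow> 'e) set \<Rightarrow> ('m \<Rightarrow> 'f) set \<Rightarrow>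
     ('m \<Rightarrow> ('e \<Rightarrow> real) \<Rightarrow> ('f \<Rightarrow> real) \<Rightarrow> real) set" where
  "jet_tensor A E E' x P Q =
     (\<Union>s\<in>P. \<Union>s'\<in>Q. jet A (tensor_bundle E E') x (\<lambda>y. tensor_elem E E' y (s y) (s' y)))"

definition tensor_connection ::
    "('m::topological_space, 'n::finite) chart set \<Rightarrow> ('m, 'e::real_vector, 'k::finite) vbundle \<Rightarrow>
     ('m, 'f::real_vector, 'l::finite) vbundle \<Rightarrow> ('m, 'e) conn \<Rightarrow> ('m, 'f) conn \<Rightarrow>
     ('m, ('e \<Rightarrow> real) \<Rightarrow> ('f \<Rightarrow> real) \<Rightarrow> real) conn" where
  "tensor_connection A E E' K K' = (THE L. linear_connection A (tensor_bundle E E') L \<and>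
     (\<forall>x\<in>points A. \<forall>e\<in>fib E x. \<forall>e'\<in>fib E' x.
        L x (tensor_elem E E' x e e') = jet_tensor A E E' x (K x e) (K' x e')))"

section \<open>Curvature\<close>

definition lie_bracket :: "('v::real_normed_vector \<Rightarrow> 'v) \<Rightarrow> ('v \<Rightarrow> 'v) \<Rightarrow> 'v \<Rightarrow> 'v" where
  "lie_bracket X Y z =
     frechet_derivative Y (at z) (X z) - frechet_derivative X (at z) (Y z)"

text \<open>The Froelicher-Nijenhuis bracket of tangent-valued 1-forms \<open>K, L\<close> on an open subset of a vector
  space, evaluated at \<open>z\<close> on \<open>u, v\<close>:
  \<open>[K,L](X,Y) = [KX,LY] - [KY,LX] - L([KX,Y] - [KY,X]) - K([LX,Y] - [LY,X]) + (LK + KL)[X,Y]\<close>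
  for the constant vector fields \<open>X = u\<close> and \<open>Y = v\<close>, whose Lie bracket vanishes.\<close>

definition fn_bracket ::
    "('v::real_normed_vector \<Rightarrow> 'v \<Rightarrow> 'v) \<Rightarrow> ('v \<Rightarrow> 'v \<Rightarrow> 'v) \<Rightarrow> 'v \<Rightarrow> 'v \<Rightarrow> 'v \<Rightarrow> 'v" where
  "fn_bracket K L z u v =
     lie_bracket (\<lambda>p. K p u) (\<lambda>p. L p v) z - lie_bracket (\<lambda>p. K p v) (\<lambda>p. L p u) z
     - L z (lie_bracket (\<lambda>p. K p u) (\<lambda>_. v) z - lie_bracket (\<lambda>p. K p v) (\<lambda>_. u) z)
     - K z (lie_bracket (\<lambda>p. L p u) (\<lambda>_. v) z - lie_bracket (\<lambda>p. L p v) (\<lambda>_. u) z)"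

text \<open>A connection as a tangent-valued 1-form in linear fibre coordinates,
  \<open>K = d\<^sup>\<lambda> \<otimes> (\<partial>\<^sub>\<lambda> + K\<^sub>j\<^sup>i\<^sub>\<lambda> y\<^sup>j \<partial>\<^sub>i)\<close>: at \<open>(z, y)\<close> it sends \<open>(u, \<eta>)\<close> to
  \<open>(u\<^sup>\<lambda>, K\<^sub>j\<^sup>i\<^sub>\<lambda> y\<^sup>j u\<^sup>\<lambda>)\<close>.\<close>

definition conn_form ::
    "('m, 'e::real_vector, 'k::finite) vbundle \<Rightarrow> ('m, 'e) conn \<Rightarrow>
     ('m, 'n::finite) chart \<Rightarrow> ('m, 'e, 'k) trivialization \<Rightarrow>
     (real ^ 'n) \<times> (real ^ 'k) \<Rightarrow> (real ^ 'n) \<times> (real ^ 'k) \<Rightarrow> (real ^ 'n) \<times> (real ^ 'k)" where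
  "conn_form E K c t = (\<lambda>(z, y) (u, \<eta>).
     (u, jet_deriv c t (point c z) (K (point c z) (fpoint E t (point c z) y)) u))"

text \<open>\<open>R[K] = -[K,K]\<close> in linear fibre coordinates around \<open>x\<close>, as the bilinear map
  \<open>(e, \<alpha>) \<mapsto> R[K](e, \<alpha>)\<close> on \<open>E\<^sub>x \<times> E\<^sup>*\<^sub>x\<close>: the form \<open>-[K,K]\<close> on the total space is vertical-valued
  and annihilates vertical vectors, so it may be evaluated on any lifts of \<open>X\<close> and \<open>Y\<close>, here
  \<open>(X, 0)\<close> and \<open>(Y, 0)\<close>; its vertical component is a vector of the fibre, to which \<open>\<alpha>\<close> is
  applied.\<close>

definition curvature_in ::
    "('m, 'n::finite) chart set \<Rightarrow> ('m, 'e::real_vector, 'k::finite) vbundle \<Rightarrow> ('m, 'e) conn \<Rightarrow>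
     ('m, 'n) chart \<Rightarrow> ('m, 'e, 'k) trivialization \<Rightarrow>
     'm \<Rightarrow> 'e \<Rightarrow> ('e \<Rightarrow> real) \<Rightarrow> ('m, 'n) form2" where
  "curvature_in A E K c t x e \<alpha> = (\<lambda>X Y.
     if X \<in> tangent_space A x \<and> Y \<in> tangent_space A x
     then \<alpha> (fpoint E t x (snd (- fn_bracket (conn_form E K c t) (conn_form E K c t)
            (coord c x, fcoord t x e) (X c, 0) (Y c, 0))))
     else 0)"

text \<open>The curvature does not depend on the choice of linear fibre coordinates around \<open>x\<close>.\<close>

definition curvature ::
    "('m, 'n::finite) chart set \<Rightarrow> ('m, 'e::real_vector, 'k::finite) vbundle \<Rightarrow> ('m, 'e) conn \<Rightarrow>
     'm \<Rightarrow> 'e \<Rightarrow> ('e \<Rightarrow> real) \<Rightarrow> ('m, 'n) form2" where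
  "curvature A E K x =
     (let (c, t) = (SOME (c, t). c \<in> A \<and> t \<in> triv E \<and> x \<in> dom c \<and> x \<in> dom t)
      in curvature_in A E K c t x)"

section \<open>Bilinear morphisms\<close>

text \<open>Bilinear morphisms \<open>E \<times>\<^sub>M F \<rightarrow> \<Lambda>\<^sup>2T\<^sup>*M\<close> over \<open>M\<close>. The last condition is smoothness of the
  components in all linear fibre coordinates.\<close>

definition bilinear_morphism ::
    "('m::topological_space, 'n::finite) chart set \<Rightarrow> ('m, 'e::real_vector, 'k::finite) vbundle \<Rightarrow>
     ('m, 'f::real_vector, 'l::finite) vbundle \<Rightarrow> ('m \<Rightarrow> 'e \<Rightarrow> 'f \<Rightarrow> ('m, 'n) form2) \<Rightarrow> bool" where
  "bilinear_morphism A E F B \<longleftrightarrow>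
     (\<forall>x\<in>points A. \<forall>e\<in>fib E x. \<forall>f\<in>fib F x. B x e f \<in> forms2 A x) \<and>
     (\<forall>x\<in>points A. bilinear_on (fib E x) (fib F x) (B x)) \<and>
     (\<forall>c\<in>A. \<forall>t\<in>triv E. \<forall>t'\<in>triv F. \<forall>u v.
        smooth_on ((coord c ` (dom c \<inter> dom t \<inter> dom t')) \<times> UNIV \<times> UNIV)
          (\<lambda>(z, y, y'). let x = point c z in
             B x (fpoint E t x y) (fpoint F t' x y') (coord_vector A c x u) (coord_vector A c x v)))"

definition tensor_curvature_identity ::
    "('m::topological_space, 'n::finite) chart set \<Rightarrow> ('m, 'e::real_vector, 'k::finite) vbundle \<Rightarrow>
     ('m, 'f::real_vector, 'l::finite) vbundle \<Rightarrow> ('m, 'e) conn \<Rightarrow> ('m, 'f) conn \<Rightarrow>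
     ('m \<Rightarrow> (('e \<Rightarrow> real) \<Rightarrow> ('f \<Rightarrow> real) \<Rightarrow> real) \<Rightarrow>
       ((('e \<Rightarrow> real) \<Rightarrow> ('f \<Rightarrow> real) \<Rightarrow> real) \<Rightarrow> real) \<Rightarrow> ('m, 'n) form2) \<Rightarrow> bool" where
  "tensor_curvature_identity A E E' K K' B \<longleftrightarrow>
     (\<forall>x\<in>points A. \<forall>e\<in>fib E x. \<forall>e'\<in>fib E' x.
        \<forall>\<alpha>\<in>fib (dual_bundle E) x. \<forall>\<beta>\<in>fib (dual_bundle E') x.
          B x (tensor_elem E E' x e e') (cotensor_elem E E' x \<alpha> \<beta>)
            = \<beta> e' *\<^sub>R curvature A E K x e \<alpha> + \<alpha> e *\<^sub>R curvature A E' K' x e' \<beta>)"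

end

theory Submission
  imports Defs
begin

text \<open>In linear fibre coordinates a linear connection is given by its coefficients
  \<open>G(z, y, u)\<close>, bilinear in the fibre vector \<open>y\<close> and the direction \<open>u\<close>, namely the derivative along
  \<open>u\<close> of any section whose jet is the value of the connection on the vector with components \<open>y\<close>.
  Write \<open>\<Gamma>\<^sub>u\<close> for the matrix \<open>y \<mapsto> G(z, y, u)\<close>. The Froelicher-Nijenhuis bracket \<open>-[K, K]\<close>
  that defines the curvature then works out to twice
  \<open>C(u, v) = (\<partial>\<^sub>v \<Gamma>\<^sub>u + \<Gamma>\<^sub>u \<Gamma>\<^sub>v) - (\<partial>\<^sub>u \<Gamma>\<^sub>v + \<Gamma>\<^sub>v \<Gamma>\<^sub>u)\<close>
  (\<open>fn_bracket_linear\<close>).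

  The curvature at a point is defined through a coordinate system that is chosen separately at
  every point, so nothing about how it varies can be said before its independence of that choice is
  known. Under a change of coordinates with base part \<open>\<phi>\<close> and fibre part \<open>g\<close> the coefficients obey
  \<open>G'(\<phi> z, g y, D\<phi> u) = (\<partial>\<^sub>u g) y + g G(z, y, u)\<close>. Differentiating this law along \<open>v\<close> and
  antisymmetrizing removes \<open>D\<^sup>2\<phi>\<close> and \<open>D\<^sup>2g\<close>, which are symmetric, and leaves
  \<open>C'(D\<phi> u, D\<phi> v) g = g C(u, v)\<close> (\<open>local_curvature_transform\<close>). Hence the curvature may be computed in
  any coordinates, and its components are smooth (\<open>bilinear_morphism_curvature\<close>).

  By the Leibniz rule the jet of \<open>s \<otimes> s'\<close> has derivative \<open>\<partial>\<^sub>u s \<otimes> s' + s \<otimes> \<partial>\<^sub>u s'\<close>. Simple tensors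
  span the fibres of \<open>E \<otimes> E'\<close>, so this formula determines the tensor product connection, and
  extending it linearly in coordinates constructs it (\<open>tensor_connection_eq\<close>). Its coefficient matrices
  are \<open>\<Gamma>\<^sub>u \<otimes> 1 + 1 \<otimes> \<Gamma>'\<^sub>u\<close>. In \<open>C(u, v)\<close> the mixed products \<open>\<Gamma>\<^sub>u \<otimes> \<Gamma>'\<^sub>v + \<Gamma>\<^sub>v \<otimes> \<Gamma>'\<^sub>u\<close> are symmetric
  in \<open>u\<close> and \<open>v\<close> and drop out, so the curvature of the product is \<open>C \<otimes> 1 + 1 \<otimes> C'\<close>
  (\<open>local_curvature_outer\<close>), which paired with \<open>\<alpha> \<otimes> \<beta>\<close> is the asserted identity. Uniqueness holds because
  a bilinear map on \<open>(E \<otimes> E') \<times> (E \<otimes> E')\<^sup>*\<close> is determined by its values on pairs of simple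
  tensors (\<open>bilinear_on_tensor_unique\<close>).\<close>

section \<open>Calculus of smooth maps\<close>

lemma frechet_derivative_eqI: "(f has_derivative f') (at x) \<Longrightarrow> frechet_derivative f (at x) = f'"
  by (rule frechet_derivative_at[symmetric])

lemma differentiable_has_derivative:
  "f differentiable at x \<Longrightarrow> (f has_derivative frechet_derivative f (at x)) (at x)"
  by (simp add: frechet_derivative_works)

lemma Ck_on_cong_imp:
  assumes "open S" "\<And>x. x \<in> S \<Longrightarrow> f x = g x" "Ck_on k S f"
  shows "Ck_on k S g"
  using assms(2,3)
proof (induction k arbitrary: f g)
  case 0
  then show ?case using continuous_on_cong[of S S f g] by simp
next
  case (Suc k)
  have d: "(g has_derivative frechet_derivative f (at x)) (at x)" if "x \<in> S" for x
    using Suc.prems that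
    by (intro has_derivative_transform_within_open[OF differentiable_has_derivative \<open>open S\<close> that]) auto
  have "Ck_on k S (\<lambda>x. frechet_derivative g (at x) v)" for v
  proof (rule Suc.IH)
    show "Ck_on k S (\<lambda>x. frechet_derivative f (at x) v)"
      using Suc.prems(2) by simp
  qed (simp add: frechet_derivative_eqI[OF d])
  with d show ?case by (auto simp: differentiable_def)
qed

lemma Ck_on_SucI:
  assumes "open S" "\<And>x. x \<in> S \<Longrightarrow> (f has_derivative f' x) (at x)" "\<And>v. Ck_on k S (\<lambda>x. f' x v)"
  shows "Ck_on (Suc k) S f"
proof -
  have "Ck_on k S (\<lambda>x. frechet_derivative f (at x) v)" for v
    by (rule Ck_on_cong_imp[OF assms(1) _ assms(3)]) (simp add: frechet_derivative_eqI[OF assms(2)])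
  with assms(2) show ?thesis by (auto simp: differentiable_def)
qed

lemma Ck_on_SucD_has_derivative:
  "Ck_on (Suc k) S f \<Longrightarrow> x \<in> S \<Longrightarrow> (f has_derivative frechet_derivative f (at x)) (at x)"
  by (simp add: frechet_derivative_works)

lemma Ck_on_SucD: "Ck_on (Suc k) S f \<Longrightarrow> Ck_on k S f"
proof (induction k arbitrary: f)
  case 0
  then show ?case
    by (auto intro!: continuous_at_imp_continuous_on differentiable_imp_continuous_within)
qed auto

lemma Ck_on_subset: "Ck_on k S f \<Longrightarrow> T \<subseteq> S \<Longrightarrow> Ck_on k T f"
  by (induction k arbitrary: f) (auto intro: continuous_on_subset)

lemma Ck_on_const: "open S \<Longrightarrow> Ck_on k S (\<lambda>_. c)"
  by (induction k arbitrary: c) (auto intro!: continuous_intros)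

lemma Ck_on_bounded_linear_comp:
  assumes "open S" "bounded_linear L" "Ck_on k S f"
  shows "Ck_on k S (\<lambda>x. L (f x))"
  using assms(3)
proof (induction k arbitrary: f)
  case 0
  then show ?case using bounded_linear.continuous_on[OF assms(2)] by simp
next
  case (Suc k)
  show ?case
  proof (rule Ck_on_SucI[OF \<open>open S\<close>])
    show "((\<lambda>x. L (f x)) has_derivative (\<lambda>v. L (frechet_derivative f (at x) v))) (at x)"
      if "x \<in> S" for x
      by (rule bounded_linear.has_derivative[OF assms(2) Ck_on_SucD_has_derivative[OF Suc.prems that]])
    show "Ck_on k S (\<lambda>x. L (frechet_derivative f (at x) v))" for v
      using Suc by simp
  qed
qed

lemma Ck_on_add:
  assumes "open S" "Ck_on k S f" "Ck_on k S g"
  shows "Ck_on k S (\<lambda>x. f x + g x)"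
  using assms(2,3)
proof (induction k arbitrary: f g)
  case 0
  then show ?case by (simp add: continuous_on_add)
next
  case (Suc k)
  show ?case
  proof (rule Ck_on_SucI[OF \<open>open S\<close>])
    show "((\<lambda>x. f x + g x) has_derivative
        (\<lambda>v. frechet_derivative f (at x) v + frechet_derivative g (at x) v)) (at x)"
      if "x \<in> S" for x
      using Suc.prems that by (intro has_derivative_add Ck_on_SucD_has_derivative)
    show "Ck_on k S (\<lambda>x. frechet_derivative f (at x) v + frechet_derivative g (at x) v)" for v
      using Suc by simp
  qed
qed

lemma Ck_on_bounded_bilinear:
  assumes "open S" "bounded_bilinear B" "Ck_on k S f" "Ck_on k S g"
  shows "Ck_on k S (\<lambda>x. B (f x) (g x))"
  using assms(3,4)
proof (induction k arbitrary: f g)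
  case 0
  then show ?case using bounded_bilinear.continuous_on[OF assms(2)] by simp
next
  case (Suc k)
  show ?case
  proof (rule Ck_on_SucI[OF \<open>open S\<close>])
    show "((\<lambda>x. B (f x) (g x)) has_derivative
        (\<lambda>v. B (f x) (frechet_derivative g (at x) v) + B (frechet_derivative f (at x) v) (g x))) (at x)"
      if "x \<in> S" for x
      using Suc.prems that by (intro bounded_bilinear.FDERIV[OF assms(2)] Ck_on_SucD_has_derivative)
    show "Ck_on k S
        (\<lambda>x. B (f x) (frechet_derivative g (at x) v) + B (frechet_derivative f (at x) v) (g x))" for v
      using Suc.prems by (intro Ck_on_add[OF \<open>open S\<close>] Suc.IH Ck_on_SucD[OF Suc.prems(1)] Ck_on_SucD[OF Suc.prems(2)])
        auto
  qed
qed

lemma Ck_on_comp_affine: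
  assumes "open S" "open T" "bounded_linear L" "\<And>x. x \<in> T \<Longrightarrow> a + L x \<in> S" "Ck_on k S f"
  shows "Ck_on k T (\<lambda>x. f (a + L x))"
  using assms(5)
proof (induction k arbitrary: f)
  case 0
  have "continuous_on T (\<lambda>x. a + L x)"
    by (intro continuous_intros bounded_linear.continuous_on[OF assms(3)])
  then show ?case
    using continuous_on_compose2[of S f T "\<lambda>x. a + L x"] 0 assms(4) by (simp add: image_subset_iff)
next
  case (Suc k)
  have L: "((\<lambda>x. a + L x) has_derivative L) (at x)" for x
    by (auto intro!: derivative_eq_intros bounded_linear_imp_has_derivative assms(3))
  show ?case
  proof (rule Ck_on_SucI[OF \<open>open T\<close>])
    show "((\<lambda>x. f (a + L x)) has_derivative (\<lambda>v. frechet_derivative f (at (a + L x)) (L v))) (at x)"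
      if "x \<in> T" for x
      using has_derivative_compose[OF L Ck_on_SucD_has_derivative[OF Suc.prems assms(4)[OF that]]] .
    show "Ck_on k T (\<lambda>x. frechet_derivative f (at (a + L x)) (L v))" for v
      by (rule Suc.IH[of "\<lambda>y. frechet_derivative f (at y) (L v)"]) (use Suc.prems in simp)
  qed
qed

lemma smooth_on_cong_imp:
  "open S \<Longrightarrow> smooth_on S f \<Longrightarrow> (\<And>x. x \<in> S \<Longrightarrow> f x = g x) \<Longrightarrow> smooth_on S g"
  unfolding smooth_on_def by (blast intro: Ck_on_cong_imp)

lemma smooth_on_has_derivative:
  "smooth_on S f \<Longrightarrow> x \<in> S \<Longrightarrow> (f has_derivative frechet_derivative f (at x)) (at x)"
  unfolding smooth_on_def using Ck_on_SucD_has_derivative by blast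

lemma smooth_on_differentiable: "smooth_on S f \<Longrightarrow> x \<in> S \<Longrightarrow> f differentiable at x"
  using smooth_on_has_derivative differentiable_def by blast

lemma smooth_on_frechet_derivative:
  "smooth_on S f \<Longrightarrow> smooth_on S (\<lambda>x. frechet_derivative f (at x) v)"
  unfolding smooth_on_def by (metis Ck_on.simps(2))

lemma smooth_on_subset: "smooth_on S f \<Longrightarrow> T \<subseteq> S \<Longrightarrow> smooth_on T f"
  unfolding smooth_on_def by (blast intro: Ck_on_subset)

lemma smooth_on_const: "open S \<Longrightarrow> smooth_on S (\<lambda>_. c)"
  unfolding smooth_on_def by (blast intro: Ck_on_const)

lemma smooth_on_bounded_linear_comp:
  "open S \<Longrightarrow> bounded_linear L \<Longrightarrow> smooth_on S f \<Longrightarrow> smooth_on S (\<lambda>x. L (f x))"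
  unfolding smooth_on_def by (blast intro: Ck_on_bounded_linear_comp)

lemma smooth_on_add:
  "open S \<Longrightarrow> smooth_on S f \<Longrightarrow> smooth_on S g \<Longrightarrow> smooth_on S (\<lambda>x. f x + g x)"
  unfolding smooth_on_def by (blast intro: Ck_on_add)

lemma smooth_on_bounded_bilinear:
  "open S \<Longrightarrow> bounded_bilinear B \<Longrightarrow> smooth_on S f \<Longrightarrow> smooth_on S g \<Longrightarrow> smooth_on S (\<lambda>x. B (f x) (g x))"
  unfolding smooth_on_def by (blast intro: Ck_on_bounded_bilinear)

lemma smooth_on_comp_affine:
  "open S \<Longrightarrow> open T \<Longrightarrow> bounded_linear L \<Longrightarrow> (\<And>x. x \<in> T \<Longrightarrow> a + L x \<in> S) \<Longrightarrow> smooth_on S f \<Longrightarrow>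
    smooth_on T (\<lambda>x. f (a + L x))"
  unfolding smooth_on_def by (blast intro: Ck_on_comp_affine)

lemma smooth_on_comp_linear:
  "open S \<Longrightarrow> open T \<Longrightarrow> bounded_linear L \<Longrightarrow> (\<And>x. x \<in> T \<Longrightarrow> L x \<in> S) \<Longrightarrow> smooth_on S f \<Longrightarrow>
    smooth_on T (\<lambda>x. f (L x))"
  using smooth_on_comp_affine[of S T L 0 f] by simp

lemma smooth_on_ident: "open S \<Longrightarrow> smooth_on S (\<lambda>x. x)"
  unfolding smooth_on_def
proof
  fix k assume "open S"
  then show "Ck_on k S (\<lambda>x. x)"
    by (cases k) (auto intro!: Ck_on_const continuous_intros simp del: Ck_on.simps(2) intro: Ck_on_SucI[OF _ has_derivative_ident])
qed

lemma smooth_on_linear: "open S \<Longrightarrow> bounded_linear L \<Longrightarrow> smooth_on S L"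
  using smooth_on_bounded_linear_comp[OF _ _ smooth_on_ident] .

lemma smooth_on_sum:
  "open S \<Longrightarrow> (\<And>i. i \<in> I \<Longrightarrow> smooth_on S (f i)) \<Longrightarrow> smooth_on S (\<lambda>x. \<Sum>i\<in>I. f i x)"
  by (induction I rule: infinite_finite_induct) (simp_all add: smooth_on_const smooth_on_add)

lemma smooth_on_diff:
  "open S \<Longrightarrow> smooth_on S f \<Longrightarrow> smooth_on S g \<Longrightarrow> smooth_on S (\<lambda>x. f x - g x)"
  using smooth_on_add[OF _ _ smooth_on_bounded_linear_comp[OF _ bounded_linear_minus[OF bounded_linear_ident]]]
  by force

lemmas smooth_on_scaleR = smooth_on_bounded_bilinear[OF _ bounded_bilinear_scaleR]

lemma smooth_on_vec_nth: "open S \<Longrightarrow> smooth_on S f \<Longrightarrow> smooth_on S (\<lambda>x. f x $ i)"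
  by (rule smooth_on_bounded_linear_comp[OF _ bounded_linear_vec_nth])

section \<open>Symmetry of second derivatives\<close>

text \<open>The second difference over the parallelogram spanned by \<open>h u\<close> and \<open>h v\<close> is \<open>h\<^sup>2\<close> times a value of
  the mixed second derivative on it: the mean value theorem is applied first in the direction \<open>u\<close> to
  the difference of \<open>f\<close> along \<open>v\<close>, then in the direction \<open>v\<close> to the derivative along \<open>u\<close>.\<close>

lemma second_difference_mvt:
  fixes f :: "'a::real_normed_vector \<Rightarrow> real"
  assumes d1: "\<And>y. y \<in> S \<Longrightarrow> (f has_derivative frechet_derivative f (at y)) (at y)"
    and d2: "\<And>y. y \<in> S \<Longrightarrow> ((\<lambda>z. frechet_derivative f (at z) u) has_derivative D y) (at y)"
    and seg: "\<And>s t. 0 \<le> s \<Longrightarrow> s \<le> h \<Longrightarrow> 0 \<le> t \<Longrightarrow> t \<le> h \<Longrightarrow> x + s *\<^sub>R u + t *\<^sub>R v \<in> S"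
    and h: "0 < h"
  shows "\<exists>s t. 0 \<le> s \<and> s \<le> h \<and> 0 \<le> t \<and> t \<le> h \<and>
    f (x + h *\<^sub>R u + h *\<^sub>R v) - f (x + h *\<^sub>R u) - f (x + h *\<^sub>R v) + f x = h * h * D (x + s *\<^sub>R u + t *\<^sub>R v) v"
proof -
  have line: "((\<lambda>r. a + r *\<^sub>R w + b) has_derivative (\<lambda>r. r *\<^sub>R w)) (at s within T)" for a b w :: 'a and s T
    using has_derivative_add[OF has_derivative_add[OF has_derivative_const
        has_derivative_scaleR_left[OF has_derivative_ident]] has_derivative_const] by simp
  define F where "F s = f (x + s *\<^sub>R u + h *\<^sub>R v) - f (x + s *\<^sub>R u + 0)" for s
  have "(F has_derivative (\<lambda>r. frechet_derivative f (at (x + s *\<^sub>R u + h *\<^sub>R v)) (r *\<^sub>R u)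
      - frechet_derivative f (at (x + s *\<^sub>R u + 0)) (r *\<^sub>R u))) (at s within {0..h})"
    if "0 \<le> s" "s \<le> h" for s
    unfolding F_def
    by (intro has_derivative_diff has_derivative_compose[OF line] d1)
      (use seg[OF that, of 0] seg[OF that, of h] h in simp_all)
  from mvt_simple[OF h this] obtain s where s: "0 < s" "s < h" and
    Fh: "F h - F 0 = frechet_derivative f (at (x + s *\<^sub>R u + h *\<^sub>R v)) (h *\<^sub>R u)
      - frechet_derivative f (at (x + s *\<^sub>R u + 0)) (h *\<^sub>R u)"
    by auto
  have "x + s *\<^sub>R u + h *\<^sub>R v \<in> S" "x + s *\<^sub>R u + 0 \<in> S"
    using seg[of s h] seg[of s 0] s h by simp_all
  from linear_simps(5)[OF has_derivative_bounded_linear[OF d1[OF this(1)]]]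
    linear_simps(5)[OF has_derivative_bounded_linear[OF d1[OF this(2)]]] Fh
  have Fh: "F h - F 0 = h * (frechet_derivative f (at (x + s *\<^sub>R u + h *\<^sub>R v)) u
      - frechet_derivative f (at (x + s *\<^sub>R u)) u)"
    by (simp add: right_diff_distrib)
  define H where "H t = frechet_derivative f (at (x + s *\<^sub>R u + t *\<^sub>R v)) u" for t
  have "(H has_derivative (\<lambda>r. D (x + s *\<^sub>R u + t *\<^sub>R v) (r *\<^sub>R v))) (at t within {0..h})"
    if "0 \<le> t" "t \<le> h" for t
    unfolding H_def
    by (rule has_derivative_compose[OF line[of _ _ 0, simplified] d2]) (use seg[of s t] that s in simp)
  from mvt_simple[OF h this] obtain t where t: "0 < t" "t < h" and
    Hh: "H h - H 0 = D (x + s *\<^sub>R u + t *\<^sub>R v) (h *\<^sub>R v)"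
    by auto
  have "x + s *\<^sub>R u + t *\<^sub>R v \<in> S"
    using seg[of s t] s t by simp
  from linear_simps(5)[OF has_derivative_bounded_linear[OF d2[OF this]]] Hh
  have "H h - H 0 = h * D (x + s *\<^sub>R u + t *\<^sub>R v) v"
    by simp
  with Fh have "F h - F 0 = h * (h * D (x + s *\<^sub>R u + t *\<^sub>R v) v)"
    by (simp add: H_def)
  with s t show ?thesis
    by (intro exI[of _ s] exI[of _ t]) (simp add: F_def algebra_simps)
qed

text \<open>The second difference does not change when \<open>u\<close> and \<open>v\<close> are exchanged. Both mixed derivatives
  therefore take a common value at points arbitrarily near \<open>x\<close>, and they are continuous.\<close>

lemma second_derivative_symmetric_real:
  fixes f :: "'a::real_normed_vector \<Rightarrow> real"
  assumes S: "open S" "x \<in> S" and f: "smooth_on S f"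
  shows "frechet_derivative (\<lambda>z. frechet_derivative f (at z) u) (at x) v =
    frechet_derivative (\<lambda>z. frechet_derivative f (at z) v) (at x) u"
proof -
  define D where "D a b y = frechet_derivative (\<lambda>z. frechet_derivative f (at z) a) (at y) b" for a b y
  have cont: "isCont (D a b) x" for a b
  proof -
    have "smooth_on S (D a b)"
      unfolding D_def by (intro smooth_on_frechet_derivative f)
    then have "continuous_on S (D a b)"
      unfolding smooth_on_def using Ck_on.simps(1) by metis
    then show ?thesis using S by (simp add: continuous_on_eq_continuous_at)
  qed
  have "\<bar>D u v x - D v u x\<bar> \<le> e" if "0 < e" for e
  proof -
    have "\<forall>\<^sub>F y in nhds x. \<bar>D u v y - D u v x\<bar> < e/2 \<and> \<bar>D v u y - D v u x\<bar> < e/2 \<and> y \<in> S"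
      using tendstoD[OF cont[of u v, unfolded isCont_def tendsto_at_iff_tendsto_nhds], of "e/2"]
        tendstoD[OF cont[of v u, unfolded isCont_def tendsto_at_iff_tendsto_nhds], of "e/2"] \<open>0 < e\<close> S
      by (auto intro!: eventually_conj eventually_nhds_in_open simp: dist_real_def)
    then obtain d where d: "d > 0" "\<And>y. dist y x < d \<Longrightarrow>
        \<bar>D u v y - D u v x\<bar> < e/2 \<and> \<bar>D v u y - D v u x\<bar> < e/2 \<and> y \<in> S"
      by (auto simp: eventually_nhds_metric)
    define N where "N = norm u + norm v + 1"
    have N: "0 < N" by (simp add: N_def add_nonneg_pos)
    define h where "h = d / (2 * N)"
    have h: "0 < h" using d N by (simp add: h_def)
    have near: "dist (x + s *\<^sub>R u + t *\<^sub>R v) x < d" if "0 \<le> s" "s \<le> h" "0 \<le> t" "t \<le> h" for s t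
    proof -
      have "dist (x + s *\<^sub>R u + t *\<^sub>R v) x \<le> norm (s *\<^sub>R u) + norm (t *\<^sub>R v)"
        by (simp add: dist_norm add.assoc norm_triangle_ineq del: norm_scaleR)
      also have "\<dots> \<le> h * norm u + h * norm v"
        using that by (auto intro!: add_mono mult_right_mono)
      also have "\<dots> \<le> h * N" using h by (simp add: N_def algebra_simps)
      also have "\<dots> = d/2" using N by (simp add: h_def)
      finally show ?thesis using d by simp
    qed
    have d1: "(f has_derivative frechet_derivative f (at y)) (at y)" if "y \<in> S" for y
      using smooth_on_has_derivative[OF f that] .
    have d2: "((\<lambda>z. frechet_derivative f (at z) a) has_derivative (\<lambda>b. D a b y)) (at y)" if "y \<in> S" for y a
      unfolding D_def using smooth_on_has_derivative[OF smooth_on_frechet_derivative[OF f] that] .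
    have inS: "x + s *\<^sub>R u + t *\<^sub>R v \<in> S" and inS': "x + t *\<^sub>R v + s *\<^sub>R u \<in> S"
      if "0 \<le> s" "s \<le> h" "0 \<le> t" "t \<le> h" for s t
      using d(2)[OF near[OF that]] by (simp_all add: add_ac)
    have inS': "x + s *\<^sub>R v + t *\<^sub>R u \<in> S" if "0 \<le> s" "s \<le> h" "0 \<le> t" "t \<le> h" for s t
      using inS' that by blast
    obtain s t where st: "0 \<le> s" "s \<le> h" "0 \<le> t" "t \<le> h" and
      1: "f (x + h *\<^sub>R u + h *\<^sub>R v) - f (x + h *\<^sub>R u) - f (x + h *\<^sub>R v) + f x = h * h * D u v (x + s *\<^sub>R u + t *\<^sub>R v)"
      using second_difference_mvt[OF d1 d2[of _ u] inS h] by auto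
    obtain s' t' where st': "0 \<le> s'" "s' \<le> h" "0 \<le> t'" "t' \<le> h" and
      2: "f (x + h *\<^sub>R v + h *\<^sub>R u) - f (x + h *\<^sub>R v) - f (x + h *\<^sub>R u) + f x = h * h * D v u (x + s' *\<^sub>R v + t' *\<^sub>R u)"
      using second_difference_mvt[OF d1 d2[of _ v] inS' h] by auto
    have "h * h * D u v (x + s *\<^sub>R u + t *\<^sub>R v) = h * h * D v u (x + t' *\<^sub>R u + s' *\<^sub>R v)"
      using 1 2 by (simp only: add.commute[of "h *\<^sub>R v"] add.commute[of "s' *\<^sub>R v"] add.assoc)
    then have "D u v (x + s *\<^sub>R u + t *\<^sub>R v) = D v u (x + t' *\<^sub>R u + s' *\<^sub>R v)"
      using h by simp
    with d(2)[OF near[OF st]] d(2)[OF near[OF st'(3,4,1,2)]] show ?thesis by linarith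
  qed
  then have "D u v x = D v u x"
    using field_le_epsilon[of "\<bar>D u v x - D v u x\<bar>" 0] by simp
  then show ?thesis by (simp add: D_def)
qed

lemma second_derivative_symmetric:
  fixes f :: "'a::real_normed_vector \<Rightarrow> 'b::euclidean_space"
  assumes S: "open S" "x \<in> S" and f: "smooth_on S f"
  shows "frechet_derivative (\<lambda>z. frechet_derivative f (at z) u) (at x) v =
    frechet_derivative (\<lambda>z. frechet_derivative f (at z) v) (at x) u"
proof (rule euclidean_eqI)
  fix b :: 'b
  have 1: "frechet_derivative (\<lambda>z. g z \<bullet> b) (at y) = (\<lambda>w. frechet_derivative g (at y) w \<bullet> b)"
    if "smooth_on S g" "y \<in> S" for g :: "'a \<Rightarrow> 'b" and y
    by (intro frechet_derivative_eqI has_derivative_inner_left smooth_on_has_derivative[OF that])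
  have 2: "frechet_derivative (\<lambda>z. frechet_derivative (\<lambda>z. f z \<bullet> b) (at z) a) (at x) c =
    frechet_derivative (\<lambda>z. frechet_derivative f (at z) a) (at x) c \<bullet> b" for a c
  proof -
    have "((\<lambda>z. frechet_derivative (\<lambda>z. f z \<bullet> b) (at z) a) has_derivative
      (\<lambda>w. frechet_derivative (\<lambda>z. frechet_derivative f (at z) a) (at x) w \<bullet> b)) (at x)"
    proof (rule has_derivative_transform_within_open[OF _ S])
      show "((\<lambda>z. frechet_derivative f (at z) a \<bullet> b) has_derivative
         (\<lambda>w. frechet_derivative (\<lambda>z. frechet_derivative f (at z) a) (at x) w \<bullet> b)) (at x)"
        by (intro has_derivative_inner_left smooth_on_has_derivative[OF smooth_on_frechet_derivative[OF f] S(2)])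
    qed (simp add: 1[OF f])
    then show ?thesis by (simp add: frechet_derivative_eqI)
  qed
  have "smooth_on S (\<lambda>z. f z \<bullet> b)"
    by (rule smooth_on_bounded_linear_comp[OF S(1) bounded_linear_inner_left f])
  from second_derivative_symmetric_real[OF S this, of u v]
  show "frechet_derivative (\<lambda>z. frechet_derivative f (at z) u) (at x) v \<bullet> b =
    frechet_derivative (\<lambda>z. frechet_derivative f (at z) v) (at x) u \<bullet> b"
    by (simp add: 2)
qed

section \<open>The curvature of connection coefficients\<close>

text \<open>The product rule for \<open>z \<mapsto> M(z) a(z)\<close>. The derivative of \<open>M\<close> is taken with the vector held fixed at
  \<open>a(x)\<close>, so that no topology on the space of linear maps enters; expansion of \<open>a(z)\<close> in a basis reduces
  the rule to the one for products with scalars.\<close>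

lemma has_derivative_linear_family:
  fixes M :: "'a::real_normed_vector \<Rightarrow> 'y::euclidean_space \<Rightarrow> 'b::real_normed_vector"
  assumes U: "open U" "x \<in> U" and lin: "\<And>z. z \<in> U \<Longrightarrow> linear (M z)"
    and diff: "\<And>y. (\<lambda>z. M z y) differentiable (at x)"
    and a: "(a has_derivative a') (at x)"
  shows "((\<lambda>z. M z (a z)) has_derivative
    (\<lambda>v. M x (a' v) + frechet_derivative (\<lambda>z. M z (a x)) (at x) v)) (at x)"
proof -
  have expand: "M z y = (\<Sum>b\<in>Basis. (y \<bullet> b) *\<^sub>R M z b)" if "z \<in> U" for z y
  proof -
    have "M z (\<Sum>b\<in>Basis. (y \<bullet> b) *\<^sub>R b) = (\<Sum>b\<in>Basis. (y \<bullet> b) *\<^sub>R M z b)"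
      using lin[OF that] by (simp add: linear_sum linear_scale)
    then show ?thesis by (simp add: euclidean_representation)
  qed
  let ?D = "\<lambda>b. frechet_derivative (\<lambda>z. M z b) (at x)"
  have D: "((\<lambda>z. M z b) has_derivative ?D b) (at x)" for b
    using diff frechet_derivative_works by blast
  have "((\<lambda>z. \<Sum>b\<in>Basis. (a z \<bullet> b) *\<^sub>R M z b) has_derivative
      (\<lambda>v. \<Sum>b\<in>Basis. (a x \<bullet> b) *\<^sub>R ?D b v + (a' v \<bullet> b) *\<^sub>R M x b)) (at x)" (is "(_ has_derivative ?d) _")
    by (intro has_derivative_sum has_derivative_scaleR has_derivative_inner_left a D)
  then have 1: "((\<lambda>z. M z (a z)) has_derivative ?d) (at x)"
    by (rule has_derivative_transform_within_open[OF _ U]) (simp add: expand[symmetric])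
  have "((\<lambda>z. \<Sum>b\<in>Basis. (a x \<bullet> b) *\<^sub>R M z b) has_derivative
      (\<lambda>v. \<Sum>b\<in>Basis. (a x \<bullet> b) *\<^sub>R ?D b v)) (at x)"
    by (intro has_derivative_sum has_derivative_scaleR_right D)
  then have "((\<lambda>z. M z (a x)) has_derivative (\<lambda>v. \<Sum>b\<in>Basis. (a x \<bullet> b) *\<^sub>R ?D b v)) (at x)"
    by (rule has_derivative_transform_within_open[OF _ U]) (simp add: expand[symmetric])
  from frechet_derivative_eqI[OF this] 1 show ?thesis
    by (simp add: sum.distrib expand[OF U(2), of "a' _"] add.commute)
qed

lemma linear_frechet_derivative_family:
  fixes M :: "'a::real_normed_vector \<Rightarrow> 'y::real_vector \<Rightarrow> 'b::real_normed_vector"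
  assumes U: "open U" "x \<in> U" and lin: "\<And>z. z \<in> U \<Longrightarrow> linear (M z)"
    and diff: "\<And>y. (\<lambda>z. M z y) differentiable (at x)"
  shows "linear (\<lambda>y. frechet_derivative (\<lambda>z. M z y) (at x) v)"
proof (rule linearI)
  have D: "((\<lambda>z. M z b) has_derivative frechet_derivative (\<lambda>z. M z b) (at x)) (at x)" for b
    using diff frechet_derivative_works by blast
  fix y y' and r :: real
  have "((\<lambda>z. M z (y + y')) has_derivative
    (\<lambda>v. frechet_derivative (\<lambda>z. M z y) (at x) v + frechet_derivative (\<lambda>z. M z y') (at x) v)) (at x)"
    by (rule has_derivative_transform_within_open[OF has_derivative_add[OF D D] U])
      (simp add: linear_add[OF lin])
  then show "frechet_derivative (\<lambda>z. M z (y + y')) (at x) v =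
      frechet_derivative (\<lambda>z. M z y) (at x) v + frechet_derivative (\<lambda>z. M z y') (at x) v"
    by (simp add: frechet_derivative_eqI)
  have "((\<lambda>z. M z (r *\<^sub>R y)) has_derivative (\<lambda>v. r *\<^sub>R frechet_derivative (\<lambda>z. M z y) (at x) v)) (at x)"
    by (rule has_derivative_transform_within_open[OF has_derivative_scaleR_right[OF D] U])
      (simp add: linear_scale[OF lin])
  then show "frechet_derivative (\<lambda>z. M z (r *\<^sub>R y)) (at x) v = r *\<^sub>R frechet_derivative (\<lambda>z. M z y) (at x) v"
    by (simp add: frechet_derivative_eqI)
qed

text \<open>Half of the components of \<open>R[K] = -[K,K]\<close>, where \<open>G z y u\<close> stands for \<open>K\<^sub>j\<^sup>i\<^sub>\<lambda> y\<^sup>j u\<^sup>\<lambda>\<close>; the factor 2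
  comes from the two terms of the antisymmetrization in the bracket.\<close>

definition local_curvature ::
    "('z::real_normed_vector \<Rightarrow> 'y::real_normed_vector \<Rightarrow> 'z \<Rightarrow> 'y) \<Rightarrow> 'z \<Rightarrow> 'y \<Rightarrow> 'z \<Rightarrow> 'z \<Rightarrow> 'y" where
  "local_curvature G z y u v =
     (frechet_derivative (\<lambda>z. G z y u) (at z) v + G z (G z y v) u)
     - (frechet_derivative (\<lambda>z. G z y v) (at z) u + G z (G z y u) v)"

definition smooth_coeff ::
    "'z::real_normed_vector set \<Rightarrow> ('z \<Rightarrow> 'y::real_normed_vector \<Rightarrow> 'z \<Rightarrow> 'y) \<Rightarrow> bool" where
  "smooth_coeff U G \<longleftrightarrow> open U \<and> (\<forall>y u. smooth_on U (\<lambda>z. G z y u)) \<and>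
     (\<forall>z\<in>U. (\<forall>u. linear (\<lambda>y. G z y u)) \<and> (\<forall>y. linear (G z y)))"

lemma smooth_coeffD:
  assumes "smooth_coeff U G"
  shows "open U" "smooth_on U (\<lambda>z. G z y u)"
    "z \<in> U \<Longrightarrow> linear (\<lambda>y. G z y u)" "z \<in> U \<Longrightarrow> linear (G z y)"
  using assms unfolding smooth_coeff_def by auto

text \<open>Connection coefficients change by an inhomogeneous law, but their curvature changes like a
  tensor. Differentiation of the law for the direction \<open>u\<close> along \<open>v\<close> yields the terms \<open>D\<^sup>2\<phi>(u, v)\<close>, \<open>D\<^sup>2g(u, v)\<close> and, together with the quadratic
  terms, \<open>(\<partial>\<^sub>v g) \<Gamma>\<^sub>u + (\<partial>\<^sub>u g) \<Gamma>\<^sub>v\<close>. All of these are symmetric in \<open>u\<close> and \<open>v\<close>.\<close>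

lemma local_curvature_transform:
  fixes \<phi> :: "'z::euclidean_space \<Rightarrow> 'z" and g :: "'z \<Rightarrow> 'y::euclidean_space \<Rightarrow> 'y"
  assumes G: "smooth_coeff U G" and G': "smooth_coeff U' G'"
    and z: "z \<in> U" and \<phi>U: "\<And>z. z \<in> U \<Longrightarrow> \<phi> z \<in> U'"
    and \<phi>: "smooth_on U \<phi>" and g: "\<And>y. smooth_on U (\<lambda>z. g z y)" "\<And>z. z \<in> U \<Longrightarrow> linear (g z)"
    and law: "\<And>z y u. z \<in> U \<Longrightarrow> G' (\<phi> z) (g z y) (frechet_derivative \<phi> (at z) u) =
      frechet_derivative (\<lambda>z. g z y) (at z) u + g z (G z y u)"
  shows "local_curvature G' (\<phi> z) (g z y) (frechet_derivative \<phi> (at z) u) (frechet_derivative \<phi> (at z) v) =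
    g z (local_curvature G z y u v)"
proof -
  note GU = smooth_coeffD[OF G] and GU' = smooth_coeffD[OF G']
  define J where "J z u = frechet_derivative \<phi> (at z) u" for z u
  define dg where "dg z y u = frechet_derivative (\<lambda>z. g z y) (at z) u" for z y u
  have d\<phi>: "(\<phi> has_derivative J z) (at z)"
    unfolding J_def using smooth_on_has_derivative[OF \<phi> z] .
  have dJ: "((\<lambda>z. J z u) has_derivative frechet_derivative (\<lambda>z. J z u) (at z)) (at z)" for u
    unfolding J_def using smooth_on_has_derivative[OF smooth_on_frechet_derivative[OF \<phi>] z] .
  have dg: "((\<lambda>z. g z y) has_derivative dg z y) (at z)" for y
    unfolding dg_def using smooth_on_has_derivative[OF g(1) z] .
  have ddg: "((\<lambda>z. dg z y u) has_derivative frechet_derivative (\<lambda>z. dg z y u) (at z)) (at z)" for y u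
    unfolding dg_def using smooth_on_has_derivative[OF smooth_on_frechet_derivative[OF g(1)] z] .
  have dG: "((\<lambda>z. G z y u) has_derivative frechet_derivative (\<lambda>z. G z y u) (at z)) (at z)" for y u
    using smooth_on_has_derivative[OF GU(2) z] .
  have dG': "((\<lambda>p. G' p y u) has_derivative frechet_derivative (\<lambda>p. G' p y u) (at (\<phi> z))) (at (\<phi> z))" for y u
    using smooth_on_has_derivative[OF GU'(2) \<phi>U[OF z]] .
  have dG'\<phi>: "((\<lambda>z. G' (\<phi> z) y u) has_derivative
      (\<lambda>v. frechet_derivative (\<lambda>p. G' p y u) (at (\<phi> z)) (J z v))) (at z)" for y u
    using has_derivative_compose[OF d\<phi> dG'] .
  \<comment> \<open>the left side of the law is differentiated first in the direction argument, then in the fibre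
    argument, each time by the product rule for a linear family\<close>
  have L1: "((\<lambda>z. G' (\<phi> z) y' (J z u)) has_derivative
      (\<lambda>v. G' (\<phi> z) y' (frechet_derivative (\<lambda>z. J z u) (at z) v)
         + frechet_derivative (\<lambda>p. G' p y' (J z u)) (at (\<phi> z)) (J z v))) (at z)" for y' u
    using has_derivative_linear_family[OF GU(1) z, of "\<lambda>z. G' (\<phi> z) y'", OF GU'(4)[OF \<phi>U] differentiableI[OF dG'\<phi>] dJ]
      frechet_derivative_eqI[OF dG'\<phi>] by simp
  have linU: "linear (\<lambda>y. G' (\<phi> p) y (J p u))" if "p \<in> U" for p u
    using GU'(3)[OF \<phi>U[OF that]] .
  have L2: "((\<lambda>z. G' (\<phi> z) (g z y) (J z u)) has_derivative
      (\<lambda>v. G' (\<phi> z) (dg z y v) (J z u) + (G' (\<phi> z) (g z y) (frechet_derivative (\<lambda>z. J z u) (at z) v)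
         + frechet_derivative (\<lambda>p. G' p (g z y) (J z u)) (at (\<phi> z)) (J z v)))) (at z)" for y u
    using has_derivative_linear_family[OF GU(1) z, of "\<lambda>z y. G' (\<phi> z) y (J z u)", OF linU differentiableI[OF L1] dg]
      frechet_derivative_eqI[OF L1] by simp
  have R1: "((\<lambda>z. g z (G z y u)) has_derivative
      (\<lambda>v. g z (frechet_derivative (\<lambda>z. G z y u) (at z) v) + dg z (G z y u) v)) (at z)" for y u
    using has_derivative_linear_family[OF GU(1) z g(2) differentiableI[OF dg] dG]
    unfolding dg_def by simp
  have R2: "((\<lambda>z. G' (\<phi> z) (g z y) (J z u)) has_derivative
     (\<lambda>v. frechet_derivative (\<lambda>z. dg z y u) (at z) v +
       (g z (frechet_derivative (\<lambda>z. G z y u) (at z) v) + dg z (G z y u) v))) (at z)" for y u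
    by (rule has_derivative_transform_within_open[OF has_derivative_add[OF ddg R1] GU(1) z])
      (simp add: law J_def dg_def)
  have E: "G' (\<phi> z) (dg z y v) (J z u) + (G' (\<phi> z) (g z y) (frechet_derivative (\<lambda>z. J z u) (at z) v)
         + frechet_derivative (\<lambda>p. G' p (g z y) (J z u)) (at (\<phi> z)) (J z v)) =
     frechet_derivative (\<lambda>z. dg z y u) (at z) v +
       (g z (frechet_derivative (\<lambda>z. G z y u) (at z) v) + dg z (G z y u) v)" for u v
    using has_derivative_unique[OF L2 R2] by meson
  have Q: "G' (\<phi> z) (G' (\<phi> z) (g z y) (J z v)) (J z u) =
     G' (\<phi> z) (dg z y v) (J z u) + (dg z (G z y v) u + g z (G z (G z y v) u))" for u v
  proof -
    have "G' (\<phi> z) (G' (\<phi> z) (g z y) (J z v)) (J z u) = G' (\<phi> z) (dg z y v + g z (G z y v)) (J z u)"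
      using law[OF z] by (simp add: J_def dg_def)
    also have "\<dots> = G' (\<phi> z) (dg z y v) (J z u) + G' (\<phi> z) (g z (G z y v)) (J z u)"
      using linear_add[OF linU[OF z]] .
    finally show ?thesis using law[OF z] by (simp add: J_def dg_def)
  qed
  have S\<phi>: "frechet_derivative (\<lambda>z. J z v) (at z) u = frechet_derivative (\<lambda>z. J z u) (at z) v"
    unfolding J_def by (rule second_derivative_symmetric[OF GU(1) z \<phi>])
  have Sg: "frechet_derivative (\<lambda>z. dg z y v) (at z) u = frechet_derivative (\<lambda>z. dg z y u) (at z) v"
    unfolding dg_def by (rule second_derivative_symmetric[OF GU(1) z g(1)])
  \<comment> \<open>the shared \<open>b\<close> and \<open>d\<close> are the second derivatives of \<open>\<phi>\<close> and \<open>g\<close>; \<open>f\<close> and \<open>f'\<close> cancel crosswise\<close>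
  have cancel: "(c + (a + (f' + q))) - (c' + (a' + (f + q'))) = (e + q) - (e' + q')"
    if "a + (b + c) = d + (e + f)" "a' + (b + c') = d + (e' + f')"
    for a b c d e f q a' c' e' f' q' :: 'y
  proof -
    have "c = d + (e + f) - a - b" "c' = d + (e' + f') - a' - b"
      using that by (simp_all add: algebra_simps)
    then show ?thesis by simp
  qed
  have "local_curvature G' (\<phi> z) (g z y) (J z u) (J z v) =
    (g z (frechet_derivative (\<lambda>z. G z y u) (at z) v) + g z (G z (G z y v) u))
    - (g z (frechet_derivative (\<lambda>z. G z y v) (at z) u) + g z (G z (G z y u) v))"
    unfolding local_curvature_def Q[of u v] Q[of v u]
    by (rule cancel[OF E[of v u] E[of u v, unfolded S\<phi> Sg]])
  also have "\<dots> = g z (local_curvature G z y u v)"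
    unfolding local_curvature_def by (simp add: linear_add[OF g(2)[OF z]] linear_diff[OF g(2)[OF z]])
  finally show ?thesis by (simp add: J_def)
qed

section \<open>Charts and tangent vectors\<close>

locale manifold =
  fixes A :: "('m::{second_countable_topology, t2_space}, 'n::finite) chart set"
  assumes manifold: "smooth_manifold A"
begin

lemma open_dom: "c \<in> A \<Longrightarrow> open (dom c)"
  using manifold unfolding smooth_manifold_def by blast

lemma chart_homeomorphism: "c \<in> A \<Longrightarrow> homeomorphism (dom c) (coord c ` dom c) (coord c) (point c)"
  using manifold unfolding smooth_manifold_def by blast

lemma point_coord: "c \<in> A \<Longrightarrow> x \<in> dom c \<Longrightarrow> point c (coord c x) = x"
  using homeomorphism_apply1[OF chart_homeomorphism] .

lemma chart_at: "x \<in> points A \<Longrightarrow> \<exists>c\<in>A. x \<in> dom c"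
  unfolding points_def by blast

lemma open_coord_image:
  assumes "c \<in> A" "open W"
  shows "open (coord c ` (dom c \<inter> W))"
proof (rule openin_open_trans)
  show "openin (top_of_set (coord c ` dom c)) (coord c ` (dom c \<inter> W))"
    using assms by (intro homeomorphism_imp_open_map[OF chart_homeomorphism]) (auto intro: openin_open_Int)
  show "open (coord c ` dom c)"
    using manifold assms unfolding smooth_manifold_def by blast
qed

lemma coord_imageE:
  assumes "c \<in> A" "z \<in> coord c ` (dom c \<inter> W)"
  shows "point c z \<in> dom c" "point c z \<in> W" "coord c (point c z) = z"
  using assms by (auto simp: point_coord[OF assms(1)])

lemma smooth_map_onD:
  "smooth_map_on A W f \<Longrightarrow> c \<in> A \<Longrightarrow> smooth_on (coord c ` (dom c \<inter> W)) (\<lambda>z. f (point c z))"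
  unfolding smooth_map_on_def o_def by blast

lemma smooth_map_on_cong_imp:
  assumes "open W" "smooth_map_on A W f" "\<And>x. x \<in> W \<Longrightarrow> f x = g x"
  shows "smooth_map_on A W g"
  unfolding smooth_map_on_def o_def
proof
  fix c assume c: "c \<in> A"
  show "smooth_on (coord c ` (dom c \<inter> W)) (\<lambda>z. g (point c z))"
    by (rule smooth_on_cong_imp[OF open_coord_image[OF c assms(1)] smooth_map_onD[OF assms(2) c]])
      (use assms(3) coord_imageE[OF c] in auto)
qed

lemma smooth_map_on_subset: "smooth_map_on A W f \<Longrightarrow> V \<subseteq> W \<Longrightarrow> smooth_map_on A V f"
  unfolding smooth_map_on_def by (blast intro: smooth_on_subset)

lemma smooth_map_on_add:
  "open W \<Longrightarrow> smooth_map_on A W f \<Longrightarrow> smooth_map_on A W g \<Longrightarrow> smooth_map_on A W (\<lambda>x. f x + g x)"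
  unfolding smooth_map_on_def o_def by (simp add: smooth_on_add open_coord_image)

lemma smooth_map_on_bounded_bilinear:
  "open W \<Longrightarrow> bounded_bilinear B \<Longrightarrow> smooth_map_on A W f \<Longrightarrow> smooth_map_on A W g \<Longrightarrow>
    smooth_map_on A W (\<lambda>x. B (f x) (g x))"
  unfolding smooth_map_on_def o_def 
  by (intro ballI smooth_on_bounded_bilinear[where B = B] open_coord_image) auto

lemma smooth_map_on_const: "open W \<Longrightarrow> smooth_map_on A W (\<lambda>x. c)"
  unfolding smooth_map_on_def o_def by (blast intro: smooth_on_const open_coord_image)

lemma smooth_map_on_sum:
  "open W \<Longrightarrow> (\<And>i. i \<in> I \<Longrightarrow> smooth_map_on A W (f i)) \<Longrightarrow> smooth_map_on A W (\<lambda>x. \<Sum>i\<in>I. f i x)"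
  by (induction I rule: infinite_finite_induct) (simp_all add: smooth_map_on_const smooth_map_on_add)

definition chart_change :: "('m, 'n) chart \<Rightarrow> ('m, 'n) chart \<Rightarrow> real ^ 'n \<Rightarrow> real ^ 'n"
  where "chart_change c c' = coord c' \<circ> point c"

definition jacobian :: "('m, 'n) chart \<Rightarrow> ('m, 'n) chart \<Rightarrow> 'm \<Rightarrow> real ^ 'n \<Rightarrow> real ^ 'n"
  where "jacobian c c' x = frechet_derivative (chart_change c c') (at (coord c x))"

lemma smooth_chart_change:
  "c \<in> A \<Longrightarrow> c' \<in> A \<Longrightarrow> smooth_on (coord c ` (dom c \<inter> dom c')) (chart_change c c')"
  using manifold unfolding smooth_manifold_def chart_change_def by blast

lemma chart_change_coord: "c \<in> A \<Longrightarrow> x \<in> dom c \<Longrightarrow> chart_change c c' (coord c x) = coord c' x"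
  by (simp add: chart_change_def point_coord)

lemma has_derivative_chart_change:
  "c \<in> A \<Longrightarrow> c' \<in> A \<Longrightarrow> x \<in> dom c \<Longrightarrow> x \<in> dom c' \<Longrightarrow>
    (chart_change c c' has_derivative jacobian c c' x) (at (coord c x))"
  unfolding jacobian_def by (rule smooth_on_has_derivative[OF smooth_chart_change]) auto

lemma jacobian_refl:
  assumes "c \<in> A" "x \<in> dom c" shows "jacobian c c x u = u"
proof -
  have "(chart_change c c has_derivative (\<lambda>u. u)) (at (coord c x))"
    by (rule has_derivative_transform_within_open[OF has_derivative_ident open_coord_image[OF assms(1) open_UNIV]])
      (use assms in \<open>auto simp: chart_change_coord\<close>)
  then show ?thesis by (simp add: jacobian_def frechet_derivative_eqI)
qed

lemma jacobian_comp:
  assumes c: "c \<in> A" "c' \<in> A" "c'' \<in> A" and x: "x \<in> dom c" "x \<in> dom c'" "x \<in> dom c''"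
  shows "jacobian c' c'' x (jacobian c c' x u) = jacobian c c'' x u"
proof -
  let ?U = "coord c ` (dom c \<inter> (dom c' \<inter> dom c''))"
  have d: "((\<lambda>z. chart_change c' c'' (chart_change c c' z)) has_derivative
      (\<lambda>u. jacobian c' c'' x (jacobian c c' x u))) (at (coord c x))"
    by (rule has_derivative_compose[OF has_derivative_chart_change[OF c(1,2) x(1,2)]])
      (use has_derivative_chart_change[OF c(2,3) x(2,3)] c x in \<open>simp add: chart_change_coord\<close>)
  have "(chart_change c c'' has_derivative (\<lambda>u. jacobian c' c'' x (jacobian c c' x u))) (at (coord c x))"
    by (rule has_derivative_transform_within_open[OF d open_coord_image[OF c(1) open_Int[OF open_dom[OF c(2)] open_dom[OF c(3)]]]])
      (use c x in \<open>auto simp: chart_change_coord\<close>)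
  then show ?thesis by (simp add: jacobian_def frechet_derivative_eqI)
qed

lemma tangent_space_jacobian:
  "X \<in> tangent_space A x \<Longrightarrow> c \<in> A \<Longrightarrow> c' \<in> A \<Longrightarrow> x \<in> dom c \<Longrightarrow> x \<in> dom c' \<Longrightarrow>
    X c' = jacobian c c' x (X c)"
  unfolding tangent_space_def jacobian_def chart_change_def by blast

text \<open>By the chain rule a coordinate vector is compatible with all charts at the point. The curvature
  is zero by definition outside the tangent space, so its components along coordinate vectors are
  meaningful only because of this.\<close>

lemma coord_vector_in_tangent_space:
  assumes "c \<in> A" "x \<in> dom c"
  shows "coord_vector A c x u \<in> tangent_space A x"
  using assms jacobian_comp[of c]
  unfolding tangent_space_def coord_vector_def jacobian_def[unfolded chart_change_def, symmetric]
  by auto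

lemma coord_vector_component:
  assumes "c \<in> A" "x \<in> dom c"
  shows "coord_vector A c x u c = u"
  using assms jacobian_refl[of c x]
  unfolding coord_vector_def jacobian_def[unfolded chart_change_def, symmetric] by simp

end

section \<open>Fibre coordinates and jets of sections\<close>

lemma linear_map_on_add: "linear_map_on S f \<Longrightarrow> u \<in> S \<Longrightarrow> v \<in> S \<Longrightarrow> f (u + v) = f u + f v"
  and linear_map_on_scale: "linear_map_on S f \<Longrightarrow> u \<in> S \<Longrightarrow> f (r *\<^sub>R u) = r *\<^sub>R f u"
  unfolding linear_map_on_def by blast+

lemma linear_map_on_zero: "linear_map_on S f \<Longrightarrow> subspace S \<Longrightarrow> f 0 = 0"
  using linear_map_on_scale[of S f 0 0] subspace_0[of S] by simp

lemma linear_map_on_sum: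
  assumes "linear_map_on S f" "subspace S" "\<And>i. i \<in> I \<Longrightarrow> u i \<in> S"
  shows "f (\<Sum>i\<in>I. r i *\<^sub>R u i) = (\<Sum>i\<in>I. r i *\<^sub>R f (u i))"
  using assms(3)
proof (induction I rule: infinite_finite_induct)
  case (insert i I)
  have "(\<Sum>i\<in>I. r i *\<^sub>R u i) \<in> S"
    using insert.prems assms(2) by (intro subspace_sum subspace_scale) auto
  then show ?case
    using insert assms(2) by (simp add: linear_map_on_add[OF assms(1)] linear_map_on_scale[OF assms(1)] subspace_scale)
qed (simp_all add: linear_map_on_zero[OF assms(1,2)])

locale vector_bundle_on = manifold A
  for A :: "('m::{second_countable_topology, t2_space}, 'n::finite) chart set" +
  fixes E :: "('m, 'e::real_vector, 'k::finite) vbundle"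
  assumes vector_bundle: "vector_bundle A E"
begin

lemma subspace_fib: "x \<in> points A \<Longrightarrow> subspace (fib E x)"
  using vector_bundle unfolding vector_bundle_def by blast

lemma triv_at: "x \<in> points A \<Longrightarrow> \<exists>t\<in>triv E. x \<in> dom t"
  using vector_bundle unfolding vector_bundle_def by blast

lemma open_triv: "t \<in> triv E \<Longrightarrow> open (dom t)"
  using vector_bundle unfolding vector_bundle_def by blast

lemma triv_subset_points: "t \<in> triv E \<Longrightarrow> dom t \<subseteq> points A"
  using vector_bundle unfolding vector_bundle_def by blast

lemma triv_points: "t \<in> triv E \<Longrightarrow> x \<in> dom t \<Longrightarrow> x \<in> points A"
  using triv_subset_points by blast

lemma linear_fcoord: "t \<in> triv E \<Longrightarrow> x \<in> dom t \<Longrightarrow> linear_map_on (fib E x) (fcoord t x)"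
  using vector_bundle unfolding vector_bundle_def by blast

lemma bij_fcoord: "t \<in> triv E \<Longrightarrow> x \<in> dom t \<Longrightarrow> bij_betw (fcoord t x) (fib E x) UNIV"
  using vector_bundle unfolding vector_bundle_def by blast

lemma fpoint_fcoord: "t \<in> triv E \<Longrightarrow> x \<in> dom t \<Longrightarrow> e \<in> fib E x \<Longrightarrow> fpoint E t x (fcoord t x e) = e"
  unfolding fpoint_def using bij_fcoord bij_betw_inv_into_left by metis

lemma fcoord_fpoint: "t \<in> triv E \<Longrightarrow> x \<in> dom t \<Longrightarrow> fcoord t x (fpoint E t x y) = y"
  unfolding fpoint_def using bij_fcoord bij_betw_inv_into_right by (metis UNIV_I)

lemma fpoint_in_fib: "t \<in> triv E \<Longrightarrow> x \<in> dom t \<Longrightarrow> fpoint E t x y \<in> fib E x"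
  unfolding fpoint_def using bij_fcoord bij_betw_apply[OF bij_betw_inv_into] by (metis UNIV_I)

lemma fcoord_inject:
  "t \<in> triv E \<Longrightarrow> x \<in> dom t \<Longrightarrow> e \<in> fib E x \<Longrightarrow> f \<in> fib E x \<Longrightarrow> fcoord t x e = fcoord t x f \<Longrightarrow> e = f"
  using fpoint_fcoord by metis

lemma linear_fpoint:
  assumes "t \<in> triv E" "x \<in> dom t"
  shows "linear (fpoint E t x)"
proof (rule linearI)
  note s = subspace_fib[OF triv_points[OF assms]]
  show "fpoint E t x (y + y') = fpoint E t x y + fpoint E t x y'" for y y'
    by (rule fcoord_inject[OF assms])
      (simp_all add: assms fcoord_fpoint fpoint_in_fib subspace_add[OF s] linear_map_on_add[OF linear_fcoord])
  show "fpoint E t x (r *\<^sub>R y) = r *\<^sub>R fpoint E t x y" for r y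
    by (rule fcoord_inject[OF assms])
      (simp_all add: assms fcoord_fpoint fpoint_in_fib subspace_scale[OF s] linear_map_on_scale[OF linear_fcoord])
qed

definition fibre_change ::
    "('m, 'n) chart \<Rightarrow> ('m, 'e, 'k) trivialization \<Rightarrow> ('m, 'e, 'k) trivialization \<Rightarrow> real ^ 'n \<Rightarrow> real ^ 'k \<Rightarrow> real ^ 'k"
  where "fibre_change c t t' z y = fcoord t' (point c z) (fpoint E t (point c z) y)"

lemma smooth_fibre_change:
  "c \<in> A \<Longrightarrow> t \<in> triv E \<Longrightarrow> t' \<in> triv E \<Longrightarrow>
    smooth_on (coord c ` (dom c \<inter> (dom t \<inter> dom t'))) (\<lambda>z. fibre_change c t t' z y)"
  unfolding fibre_change_def using smooth_map_onD[of "dom t \<inter> dom t'"] vector_bundle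
  unfolding vector_bundle_def by blast

lemma linear_fibre_change:
  assumes "t \<in> triv E" "t' \<in> triv E" "point c z \<in> dom t" "point c z \<in> dom t'"
  shows "linear (fibre_change c t t' z)"
  unfolding fibre_change_def
  by (rule linearI)
    (simp_all add: assms linear_add[OF linear_fpoint] linear_scale[OF linear_fpoint]
      linear_map_on_add[OF linear_fcoord] linear_map_on_scale[OF linear_fcoord] fpoint_in_fib)

lemma fibre_change_fcoord:
  assumes "c \<in> A" "t \<in> triv E" "x \<in> dom c" "x \<in> dom t" "e \<in> fib E x"
  shows "fibre_change c t t' (coord c x) (fcoord t x e) = fcoord t' x e"
  using assms by (simp add: fibre_change_def point_coord fpoint_fcoord)

definition section_rep ::
    "('m, 'n) chart \<Rightarrow> ('m, 'e, 'k) trivialization \<Rightarrow> ('m \<Rightarrow> 'e) \<Rightarrow> real ^ 'n \<Rightarrow> real ^ 'k"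
  where "section_rep c t s z = fcoord t (point c z) (s (point c z))"

lemma section_rep_coord: "c \<in> A \<Longrightarrow> x \<in> dom c \<Longrightarrow> section_rep c t s (coord c x) = fcoord t x (s x)"
  by (simp add: section_rep_def point_coord)

lemma has_derivative_section_rep:
  assumes s: "local_section A E x s" and "c \<in> A" "t \<in> triv E" "x \<in> dom c" "x \<in> dom t"
  shows "(section_rep c t s has_derivative section_deriv c t x s) (at (coord c x))"
proof -
  from s obtain W where "x \<in> W" and W: "smooth_section A E W s"
    unfolding local_section_def by blast
  then have "smooth_on (coord c ` (dom c \<inter> (dom t \<inter> W))) (section_rep c t s)"
    using smooth_map_onD[of "dom t \<inter> W"] assms(2,3) unfolding smooth_section_def section_rep_def by blast
  from smooth_on_has_derivative[OF this] show ?thesis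
    unfolding section_deriv_def section_rep_def using assms \<open>x \<in> W\<close> by blast
qed

lemma local_section_in_fib: "local_section A E x s \<Longrightarrow> s x \<in> fib E x"
  unfolding local_section_def smooth_section_def by blast

lemma local_section_points: "local_section A E x s \<Longrightarrow> x \<in> points A"
  unfolding local_section_def smooth_section_def by blast

text \<open>The coordinate change on first jets: a representative in the new fibre coordinates is
  \<open>g(z) \<sigma>(z)\<close>, to which the product rule applies, while the chart change contributes its Jacobian
  by the chain rule.\<close>

lemma section_deriv_transform:
  assumes s: "local_section A E x s" and c: "c \<in> A" "c' \<in> A" and t: "t \<in> triv E" "t' \<in> triv E"
    and x: "x \<in> dom c" "x \<in> dom c'" "x \<in> dom t" "x \<in> dom t'"
  shows "section_deriv c' t' x s (jacobian c c' x u) =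
    frechet_derivative (\<lambda>z. fibre_change c t t' z (fcoord t x (s x))) (at (coord c x)) u
    + fibre_change c t t' (coord c x) (section_deriv c t x s u)"
proof -
  from s obtain W where W: "x \<in> W" "open W" "\<And>y. y \<in> W \<Longrightarrow> s y \<in> fib E y"
    unfolding local_section_def smooth_section_def by blast
  define U where "U = coord c ` (dom c \<inter> (dom t \<inter> dom t' \<inter> dom c' \<inter> W))"
  have U: "open U" "coord c x \<in> U" "\<And>z. z \<in> U \<Longrightarrow> point c z \<in> dom c \<inter> dom t \<inter> dom t' \<inter> dom c' \<inter> W"
    unfolding U_def using W c(2) t x
    by (auto simp: point_coord[OF c(1)] c(1) intro!: open_coord_image open_Int open_triv open_dom)
  have Uc: "coord c (point c z) = z" if "z \<in> U" for z
    using that c(1) unfolding U_def by (auto simp: point_coord)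
  have 1: "((\<lambda>z. section_rep c' t' s (chart_change c c' z)) has_derivative
      (\<lambda>u. section_deriv c' t' x s (jacobian c c' x u))) (at (coord c x))"
    by (rule has_derivative_compose[OF has_derivative_chart_change[OF c x(1,2)]])
      (use has_derivative_section_rep[OF s c(2) t(2) x(2,4)] c x in \<open>simp add: chart_change_coord\<close>)
  have 2: "((\<lambda>z. fibre_change c t t' z (section_rep c t s z)) has_derivative
      (\<lambda>u. fibre_change c t t' (coord c x) (section_deriv c t x s u)
         + frechet_derivative (\<lambda>z. fibre_change c t t' z (section_rep c t s (coord c x))) (at (coord c x)) u))
      (at (coord c x))"
  proof (rule has_derivative_linear_family[OF U(1,2) _ _ has_derivative_section_rep[OF s c(1) t(1) x(1,3)]])
    show "linear (fibre_change c t t' z)" if "z \<in> U" for z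
      using U(3)[OF that] by (intro linear_fibre_change t) auto
    show "(\<lambda>z. fibre_change c t t' z y) differentiable (at (coord c x))" for y
      by (rule smooth_on_differentiable[OF smooth_fibre_change[OF c(1) t]]) (use x in auto)
  qed
  have 3: "((\<lambda>z. fibre_change c t t' z (section_rep c t s z)) has_derivative
      (\<lambda>u. section_deriv c' t' x s (jacobian c c' x u))) (at (coord c x))"
  proof (rule has_derivative_transform_within_open[OF 1 U(1,2)])
    fix z assume "z \<in> U"
    with U(3)[OF this] c t W(3) show "section_rep c' t' s (chart_change c c' z) = fibre_change c t t' z (section_rep c t s z)"
      by (simp add: section_rep_def chart_change_def point_coord fibre_change_def fpoint_fcoord)
  qed
  from has_derivative_unique[OF 2 3] show ?thesis
    using c(1) x(1) by (simp add: section_rep_coord fun_eq_iff add.commute)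
qed

lemma local_section_add:
  assumes "local_section A E x s" "local_section A E x r"
  shows "local_section A E x (\<lambda>y. s y + r y)"
proof -
  from assms obtain V W where V: "x \<in> V" "smooth_section A E V s" and W: "x \<in> W" "smooth_section A E W r"
    unfolding local_section_def by blast
  have "smooth_section A E (V \<inter> W) (\<lambda>y. s y + r y)"
    unfolding smooth_section_def
  proof (intro conjI ballI)
    show "open (V \<inter> W)" "V \<inter> W \<subseteq> points A"
      using V W unfolding smooth_section_def by auto
    show "s y + r y \<in> fib E y" if "y \<in> V \<inter> W" for y
      using V W that unfolding smooth_section_def by (blast intro: subspace_add subspace_fib)
    show "smooth_map_on A (dom t \<inter> (V \<inter> W)) (\<lambda>y. fcoord t y (s y + r y))" if t: "t \<in> triv E" for t
    proof (rule smooth_map_on_cong_imp)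
      show o: "open (dom t \<inter> (V \<inter> W))" using V W open_triv[OF t] unfolding smooth_section_def by auto
      show "smooth_map_on A (dom t \<inter> (V \<inter> W)) (\<lambda>y. fcoord t y (s y) + fcoord t y (r y))"
        using V W t unfolding smooth_section_def
        by (intro smooth_map_on_add[OF o]) (auto intro: smooth_map_on_subset)
      show "fcoord t y (s y) + fcoord t y (r y) = fcoord t y (s y + r y)" if "y \<in> dom t \<inter> (V \<inter> W)" for y
        using V W t that unfolding smooth_section_def by (auto simp: linear_map_on_add[OF linear_fcoord])
    qed
  qed
  with V W show ?thesis unfolding local_section_def by blast
qed

lemma local_section_scale:
  assumes "local_section A E x s"
  shows "local_section A E x (\<lambda>y. a *\<^sub>R s y)"
proof -
  from assms obtain V where V: "x \<in> V" "smooth_section A E V s"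
    unfolding local_section_def by blast
  have "smooth_section A E V (\<lambda>y. a *\<^sub>R s y)"
    unfolding smooth_section_def
  proof (intro conjI ballI)
    show "open V" "V \<subseteq> points A"
      using V unfolding smooth_section_def by auto
    show "a *\<^sub>R s y \<in> fib E y" if "y \<in> V" for y
      using V that unfolding smooth_section_def by (blast intro: subspace_scale subspace_fib)
    show "smooth_map_on A (dom t \<inter> V) (\<lambda>y. fcoord t y (a *\<^sub>R s y))" if t: "t \<in> triv E" for t
    proof (rule smooth_map_on_cong_imp)
      show o: "open (dom t \<inter> V)" using V open_triv[OF t] unfolding smooth_section_def by auto
      show "smooth_map_on A (dom t \<inter> V) (\<lambda>y. a *\<^sub>R fcoord t y (s y))"
        using V t unfolding smooth_section_def
        by (intro smooth_map_on_bounded_bilinear[OF o bounded_bilinear_scaleR] smooth_map_on_const[OF o]) auto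
      show "a *\<^sub>R fcoord t y (s y) = fcoord t y (a *\<^sub>R s y)" if "y \<in> dom t \<inter> V" for y
        using V t that unfolding smooth_section_def by (auto simp: linear_map_on_scale[OF linear_fcoord])
    qed
  qed
  with V show ?thesis unfolding local_section_def by blast
qed

lemma section_deriv_add:
  assumes s: "local_section A E x s" and r: "local_section A E x r"
    and ct: "c \<in> A" "t \<in> triv E" "x \<in> dom c" "x \<in> dom t"
  shows "section_deriv c t x (\<lambda>y. s y + r y) u = section_deriv c t x s u + section_deriv c t x r u"
proof -
  from s r obtain V W where V: "x \<in> V" "smooth_section A E V s" and W: "x \<in> W" "smooth_section A E W r"
    unfolding local_section_def by blast
  then have U: "open (coord c ` (dom c \<inter> (dom t \<inter> V \<inter> W)))"
    using ct unfolding smooth_section_def by (intro open_coord_image open_Int open_triv) auto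
  have "(section_rep c t (\<lambda>y. s y + r y) has_derivative
      (\<lambda>u. section_deriv c t x s u + section_deriv c t x r u)) (at (coord c x))"
    by (rule has_derivative_transform_within_open[OF has_derivative_add[OF
        has_derivative_section_rep[OF s ct] has_derivative_section_rep[OF r ct]] U])
      (use V W ct in \<open>auto simp: section_rep_coord smooth_section_def linear_map_on_add[OF linear_fcoord]\<close>)
  from has_derivative_unique[OF has_derivative_section_rep[OF local_section_add[OF s r] ct] this]
  show ?thesis by simp
qed

lemma section_deriv_scale:
  assumes s: "local_section A E x s" and ct: "c \<in> A" "t \<in> triv E" "x \<in> dom c" "x \<in> dom t"
  shows "section_deriv c t x (\<lambda>y. a *\<^sub>R s y) u = a *\<^sub>R section_deriv c t x s u"
proof -
  from s obtain V where V: "x \<in> V" "smooth_section A E V s"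
    unfolding local_section_def by blast
  then have U: "open (coord c ` (dom c \<inter> (dom t \<inter> V)))"
    using ct unfolding smooth_section_def by (intro open_coord_image open_Int open_triv) auto
  have "(section_rep c t (\<lambda>y. a *\<^sub>R s y) has_derivative (\<lambda>u. a *\<^sub>R section_deriv c t x s u)) (at (coord c x))"
    by (rule has_derivative_transform_within_open[OF has_derivative_scaleR_right[OF
        has_derivative_section_rep[OF s ct]] U])
      (use V ct in \<open>auto simp: section_rep_coord smooth_section_def linear_map_on_scale[OF linear_fcoord]\<close>)
  from has_derivative_unique[OF has_derivative_section_rep[OF local_section_scale[OF s] ct] this]
  show ?thesis by simp
qed

lemma in_jet_self: "local_section A E x s \<Longrightarrow> s \<in> jet A E x s"
  unfolding jet_def by simp

lemma jet_eqI: "r \<in> jet A E x s \<Longrightarrow> jet A E x r = jet A E x s"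
  unfolding jet_def by auto

end

section \<open>Linear connections in coordinates\<close>

text \<open>On the lifts \<open>(u, 0)\<close> and \<open>(v, 0)\<close> only the Lie bracket of the horizontal fields \<open>\<Phi> u\<close> and \<open>\<Phi> v\<close>
  contributes, and it does so twice. The correction terms apply \<open>\<Phi>\<close> to vertical vectors, which it
  annihilates.\<close>

lemma fn_bracket_linear:
  fixes G :: "'z::euclidean_space \<Rightarrow> 'y::euclidean_space \<Rightarrow> 'z \<Rightarrow> 'y"
  assumes G: "smooth_coeff U G" and z: "z \<in> U"
  defines "\<Phi> \<equiv> \<lambda>(z, y) (u, \<eta>::'y). (u, G z y u)"
  shows "fn_bracket \<Phi> \<Phi> (z, y) (u, 0) (v, 0) = (0, - 2 *\<^sub>R local_curvature G z y u v)"
proof -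
  note GU = smooth_coeffD[OF G]
  define D where "D y u = frechet_derivative (\<lambda>z. G z y u) (at z)" for y u
  have d: "((\<lambda>z. G z y u) has_derivative D y u) (at (fst (z, y')))" for y u and y' :: 'y
    unfolding D_def using smooth_on_has_derivative[OF GU(2) z] by simp
  have d1: "((\<lambda>p. G (fst p) y u) has_derivative (\<lambda>w. D y u (fst w))) (at (z, y'))" for y u and y' :: 'y
    by (rule has_derivative_compose[OF bounded_linear_imp_has_derivative[OF bounded_linear_fst] d])
  have "((\<lambda>p. G (fst p) (snd p) u) has_derivative (\<lambda>w. G z (snd w) u + D y u (fst w))) (at (z, y))" for u
  proof -
    have "open (U \<times> (UNIV :: 'y set))" using GU(1) by (simp add: open_Times)
    from has_derivative_linear_family[OF this, of "(z, y)" "\<lambda>p y. G (fst p) y u" snd snd,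
        OF _ _ differentiableI[OF d1] bounded_linear_imp_has_derivative[OF bounded_linear_snd]]
    show ?thesis
      using z GU(3) frechet_derivative_eqI[OF d1] by (simp add: mem_Times_iff)
  qed
  from has_derivative_Pair[OF has_derivative_const this]
  have d\<Phi>: "frechet_derivative (\<lambda>p. \<Phi> p (u, 0)) (at (z, y)) = (\<lambda>w. (0, G z (snd w) u + D y u (fst w)))" for u
    by (intro frechet_derivative_eqI) (simp add: \<Phi>_def case_prod_beta)
  have \<Phi>: "\<Phi> (z, y) (u, \<eta>) = (u, G z y u)" for u \<eta>
    by (simp add: \<Phi>_def)
  have G0: "G z 0 u = 0" "G z y 0 = 0" for y u
    using linear_0[OF GU(3)[OF z]] linear_0[OF GU(4)[OF z]] by auto
  have "fn_bracket \<Phi> \<Phi> (z, y) (u, 0) (v, 0) =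
    (0, 2 *\<^sub>R ((G z (G z y u) v + D y v u) - (G z (G z y v) u + D y u v)))"
    unfolding fn_bracket_def lie_bracket_def d\<Phi> \<Phi> frechet_derivative_const
    by (simp add: \<Phi> G0 scaleR_2 zero_prod_def[symmetric] flip: scaleR_2) (simp add: algebra_simps scaleR_2)
  also have "\<dots> = (0, - 2 *\<^sub>R local_curvature G z y u v)"
    by (simp add: local_curvature_def D_def algebra_simps)
  finally show ?thesis .
qed

lemma local_curvature_linear:
  fixes G :: "'z::euclidean_space \<Rightarrow> 'y::euclidean_space \<Rightarrow> 'z \<Rightarrow> 'y"
  assumes G: "smooth_coeff U G" and z: "z \<in> U"
  shows "linear (\<lambda>y. local_curvature G z y u v)" "linear (\<lambda>u. local_curvature G z y u v)"
    "linear (\<lambda>v. local_curvature G z y u v)"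
proof -
  note GU = smooth_coeffD[OF G]
  have diff: "(\<lambda>z. G z y u) differentiable (at z)" for y u
    using smooth_on_differentiable[OF GU(2) z] .
  have D: "linear (\<lambda>y. frechet_derivative (\<lambda>z. G z y u) (at z) v)"
    "linear (\<lambda>u. frechet_derivative (\<lambda>z. G z y u) (at z) v)"
    "linear (\<lambda>v. frechet_derivative (\<lambda>z. G z y u) (at z) v)" for y u v
    using linear_frechet_derivative_family[OF GU(1) z, of "\<lambda>z y. G z y u" v, OF GU(3) diff]
      linear_frechet_derivative_family[OF GU(1) z, of "\<lambda>z u. G z y u" v, OF GU(4) diff]
      linear_frechet_derivative[OF diff] by auto
  note GG = GU(3)[OF z] GU(4)[OF z]
  have GG2: "linear (\<lambda>y. G z (G z y u) v)" "linear (\<lambda>u. G z (G z y u) v)" for y u v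
    using linear_compose[OF GG(1) GG(1)] linear_compose[OF GG(2) GG(1)] by (auto simp: o_def)
  show "linear (\<lambda>y. local_curvature G z y u v)" "linear (\<lambda>u. local_curvature G z y u v)"
    "linear (\<lambda>v. local_curvature G z y u v)"
    unfolding local_curvature_def
    by (intro linear_compose_add linear_compose_sub D GG GG2)+
qed

lemma smooth_local_curvature:
  fixes G :: "'z::euclidean_space \<Rightarrow> 'y::euclidean_space \<Rightarrow> 'z \<Rightarrow> 'y"
  assumes G: "smooth_coeff U G"
  shows "smooth_on U (\<lambda>z. local_curvature G z y u v)"
proof -
  note GU = smooth_coeffD[OF G]
  have "smooth_on U (\<lambda>z. G z (G z y u) v)" for u v
  proof (rule smooth_on_cong_imp[OF GU(1)])
    show "smooth_on U (\<lambda>z. \<Sum>b\<in>Basis. (G z y u \<bullet> b) *\<^sub>R G z b v)"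
      by (intro smooth_on_sum smooth_on_scaleR GU smooth_on_bounded_linear_comp[OF _ bounded_linear_inner_left])
    show "(\<Sum>b\<in>Basis. (G z y u \<bullet> b) *\<^sub>R G z b v) = G z (G z y u) v" if "z \<in> U" for z
    proof -
      have "(\<Sum>b\<in>Basis. (G z y u \<bullet> b) *\<^sub>R G z b v) = G z (\<Sum>b\<in>Basis. (G z y u \<bullet> b) *\<^sub>R b) v"
        by (simp add: linear_sum[OF GU(3)[OF that]] linear_scale[OF GU(3)[OF that]])
      then show ?thesis by (simp add: euclidean_representation)
    qed
  qed
  then show ?thesis
    unfolding local_curvature_def
    by (intro smooth_on_diff smooth_on_add smooth_on_frechet_derivative GU)
qed

locale linear_connection_on = vector_bundle_on A E
  for A :: "('m::{second_countable_topology, t2_space}, 'n::finite) chart set"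
    and E :: "('m, 'e::real_vector, 'k::finite) vbundle" +
  fixes K :: "('m, 'e) conn"
  assumes connection: "linear_connection A E K"
begin

text \<open>All sections in the jet \<open>K x e\<close> are equivalent, so any of them may represent it. This frees the
  arguments below from the arbitrary representative in \<open>jet_deriv\<close>.\<close>

lemma connection_jet:
  assumes "x \<in> points A" "e \<in> fib E x"
  shows "\<exists>s. s \<in> K x e" and "s \<in> K x e \<Longrightarrow> local_section A E x s \<and> s x = e \<and> K x e = jet A E x s"
proof -
  have "K x e \<in> jet_fib A E x \<and> (\<forall>s\<in>K x e. s x = e)"
    using connection assms unfolding linear_connection_def by blast
  then obtain r where r: "local_section A E x r" "K x e = jet A E x r"
    and e: "\<And>s. s \<in> K x e \<Longrightarrow> s x = e"
    unfolding jet_fib_def by blast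
  from r show "\<exists>s. s \<in> K x e" using in_jet_self by blast
  assume "s \<in> K x e"
  with r e show "local_section A E x s \<and> s x = e \<and> K x e = jet A E x s"
    using jet_eqI[of s x r] by (auto simp: jet_def)
qed

definition coeff :: "('m, 'n) chart \<Rightarrow> ('m, 'e, 'k) trivialization \<Rightarrow> real ^ 'n \<Rightarrow> real ^ 'k \<Rightarrow> real ^ 'n \<Rightarrow> real ^ 'k"
  where "coeff c t z y u = jet_deriv c t (point c z) (K (point c z) (fpoint E t (point c z) y)) u"

lemma section_deriv_connection:
  assumes "c \<in> A" "t \<in> triv E" "x \<in> dom c" "x \<in> dom t" and e: "e \<in> fib E x" and s: "s \<in> K x e"
  shows "section_deriv c t x s u = coeff c t (coord c x) (fcoord t x e) u"
proof -
  have x: "x \<in> points A" using assms triv_points by blast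
  have "(SOME r. r \<in> K x e) \<in> K x e" by (rule someI[of _ s]) (rule s)
  moreover have "K x e = jet A E x s" using connection_jet(2)[OF x e s] by blast
  ultimately have "section_deriv c t x (SOME r. r \<in> K x e) = section_deriv c t x s"
    using assms unfolding jet_def by auto
  then show ?thesis using assms by (simp add: coeff_def point_coord fpoint_fcoord jet_deriv_def)
qed

lemma section_deriv_connection_fpoint:
  assumes "c \<in> A" "t \<in> triv E" "x \<in> dom c" "x \<in> dom t" and s: "s \<in> K x (fpoint E t x y)"
  shows "section_deriv c t x s u = coeff c t (coord c x) y u"
  using section_deriv_connection[OF assms(1-4) fpoint_in_fib[OF assms(2,4)] s] assms
  by (simp add: fcoord_fpoint)

lemma sections_add:
  assumes "x \<in> points A" "e \<in> fib E x" "f \<in> fib E x" "s \<in> K x e" "r \<in> K x f"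
  shows "(\<lambda>y. s y + r y) \<in> K x (e + f)"
proof -
  have "K x (e + f) = jet_add A E x (K x e) (K x f)"
    using connection assms unfolding linear_connection_def by blast
  moreover have "local_section A E x (\<lambda>y. s y + r y)"
    using connection_jet(2) assms by (intro local_section_add) blast+
  ultimately show ?thesis
    using assms unfolding jet_add_def by (auto intro: in_jet_self)
qed

lemma sections_scale:
  assumes "x \<in> points A" "e \<in> fib E x" "s \<in> K x e"
  shows "(\<lambda>y. a *\<^sub>R s y) \<in> K x (a *\<^sub>R e)"
proof -
  have "K x (a *\<^sub>R e) = jet_scale A E x a (K x e)"
    using connection assms unfolding linear_connection_def by blast
  moreover have "local_section A E x (\<lambda>y. a *\<^sub>R s y)"
    using connection_jet(2) assms by (intro local_section_scale) blast+
  ultimately show ?thesis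
    using assms unfolding jet_scale_def by (auto intro: in_jet_self)
qed

definition chart_region :: "('m, 'n) chart \<Rightarrow> ('m, 'e, 'k) trivialization \<Rightarrow> (real ^ 'n) set"
  where "chart_region c t = coord c ` (dom c \<inter> dom t)"

lemma open_chart_region: "c \<in> A \<Longrightarrow> t \<in> triv E \<Longrightarrow> open (chart_region c t)"
  unfolding chart_region_def by (intro open_coord_image open_triv)

lemma coord_in_chart_region: "x \<in> dom c \<Longrightarrow> x \<in> dom t \<Longrightarrow> coord c x \<in> chart_region c t"
  unfolding chart_region_def by blast

text \<open>Linearity in \<open>y\<close> is linearity of the connection read off from derivatives of sums and multiples of
  representing sections; linearity in \<open>u\<close> holds because the coefficients are the derivative of one
  section.\<close>

lemma smooth_coeff_coeff:
  assumes c: "c \<in> A" and t: "t \<in> triv E"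
  shows "smooth_coeff (chart_region c t) (coeff c t)"
  unfolding smooth_coeff_def
proof (intro conjI allI ballI)
  show o: "open (chart_region c t)" using open_chart_region assms .
  show "smooth_on (chart_region c t) (\<lambda>z. coeff c t z y u)" for y u
  proof -
    have S: "smooth_on (chart_region c t \<times> UNIV) (\<lambda>(z, y). coeff c t z y u)"
      using connection assms unfolding linear_connection_def coeff_def chart_region_def by blast
    have "smooth_on (chart_region c t) (\<lambda>z. (\<lambda>(z, y). coeff c t z y u) ((0, y) + (z, 0)))"
      by (rule smooth_on_comp_affine[OF _ o _ _ S])
        (auto intro!: open_Times o bounded_linear_Pair bounded_linear_ident bounded_linear_zero)
    then show ?thesis by simp
  qed
  fix z assume z: "z \<in> chart_region c t"
  define x where "x = point c z"
  have x: "x \<in> dom c" "x \<in> dom t" "coord c x = z"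
    using coord_imageE[OF c] z unfolding chart_region_def x_def by auto
  have xp: "x \<in> points A" using x t triv_points by blast
  note ct = c t x(1,2)
  show "linear (\<lambda>y. coeff c t z y u)" for u
  proof (rule linearI)
    fix y y' and r :: real
    let ?e = "fpoint E t x"
    obtain s s' where s: "s \<in> K x (?e y)" "s' \<in> K x (?e y')"
      using connection_jet(1)[OF xp] fpoint_in_fib[OF t x(2)] by meson
    note ls = connection_jet(2)[OF xp fpoint_in_fib[OF t x(2)] s(1)] connection_jet(2)[OF xp fpoint_in_fib[OF t x(2)] s(2)]
    have "(\<lambda>p. s p + s' p) \<in> K x (?e (y + y'))"
      using sections_add[OF xp fpoint_in_fib[OF t x(2)] fpoint_in_fib[OF t x(2)] s]
      by (simp add: linear_add[OF linear_fpoint[OF t x(2)]])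
    from section_deriv_connection_fpoint[OF ct this] show "coeff c t z (y + y') u = coeff c t z y u + coeff c t z y' u"
      using section_deriv_connection_fpoint[OF ct s(1)] section_deriv_connection_fpoint[OF ct s(2)]
        section_deriv_add[OF _ _ ct] ls by (simp add: x(3))
    have "(\<lambda>p. r *\<^sub>R s p) \<in> K x (?e (r *\<^sub>R y))"
      using sections_scale[OF xp fpoint_in_fib[OF t x(2)] s(1)]
      by (simp add: linear_scale[OF linear_fpoint[OF t x(2)]])
    from section_deriv_connection_fpoint[OF ct this] show "coeff c t z (r *\<^sub>R y) u = r *\<^sub>R coeff c t z y u"
      using section_deriv_connection_fpoint[OF ct s(1)] section_deriv_scale[OF _ ct] ls by (simp add: x(3))
  qed
  show "linear (coeff c t z y)" for y
  proof -
    obtain s where s: "s \<in> K x (fpoint E t x y)"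
      using connection_jet(1)[OF xp fpoint_in_fib[OF t x(2)]] by blast
    have "coeff c t z y = section_deriv c t x s"
      using section_deriv_connection_fpoint[OF ct s] by (simp add: x(3) fun_eq_iff)
    moreover have "local_section A E x s"
      using connection_jet(2)[OF xp fpoint_in_fib[OF t x(2)] s] by blast
    ultimately show ?thesis
      using has_derivative_section_rep[OF _ ct] has_derivative_linear by metis
  qed
qed

text \<open>The inhomogeneous law is the coordinate change of the jet of a section that represents the value
  of the connection.\<close>

lemma coeff_transform:
  assumes c: "c \<in> A" "c' \<in> A" and t: "t \<in> triv E" "t' \<in> triv E"
    and x: "x \<in> dom c" "x \<in> dom c'" "x \<in> dom t" "x \<in> dom t'"
  shows "coeff c' t' (coord c' x) (fibre_change c t t' (coord c x) y) (jacobian c c' x u) =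
    frechet_derivative (\<lambda>z. fibre_change c t t' z y) (at (coord c x)) u
    + fibre_change c t t' (coord c x) (coeff c t (coord c x) y u)"
proof -
  have xp: "x \<in> points A" using x t triv_points by blast
  note e = fpoint_in_fib[OF t(1) x(3)]
  obtain s where s: "s \<in> K x (fpoint E t x y)" using connection_jet(1)[OF xp e] by blast
  then have "local_section A E x s" "s x = fpoint E t x y" using connection_jet(2)[OF xp e] by auto
  from section_deriv_transform[OF this(1) c t x, of u] this(2) show ?thesis
    using section_deriv_connection[OF c(1) t(1) x(1,3) e s] section_deriv_connection[OF c(2) t(2) x(2,4) e s] c t x
    by (simp add: fcoord_fpoint fibre_change_def point_coord)
qed

text \<open>The region where both coordinate systems are defined is open, so the transformation law for
  coefficients may be differentiated there.\<close>

lemma local_curvature_coordinate_change: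
  assumes c: "c \<in> A" "c' \<in> A" and t: "t \<in> triv E" "t' \<in> triv E"
    and x: "x \<in> dom c" "x \<in> dom c'" "x \<in> dom t" "x \<in> dom t'"
  shows "local_curvature (coeff c' t') (coord c' x) (fibre_change c t t' (coord c x) y)
      (jacobian c c' x u) (jacobian c c' x v) =
    fibre_change c t t' (coord c x) (local_curvature (coeff c t) (coord c x) y u v)"
proof -
  define U where "U = coord c ` (dom c \<inter> (dom c' \<inter> (dom t \<inter> dom t')))"
  have U: "\<exists>p. p \<in> dom c \<and> p \<in> dom c' \<and> p \<in> dom t \<and> p \<in> dom t' \<and> z = coord c p" if "z \<in> U" for z
    using that unfolding U_def by blast
  have oU: "open U" unfolding U_def by (intro open_coord_image open_Int open_triv open_dom c t)
  have sub: "U \<subseteq> chart_region c t" unfolding U_def chart_region_def by blast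
  have J: "jacobian c c' x u = frechet_derivative (chart_change c c') (at (coord c x)) u" for u x
    by (simp add: jacobian_def)
  have "local_curvature (coeff c' t') (chart_change c c' (coord c x)) (fibre_change c t t' (coord c x) y)
      (frechet_derivative (chart_change c c') (at (coord c x)) u)
      (frechet_derivative (chart_change c c') (at (coord c x)) v) =
    fibre_change c t t' (coord c x) (local_curvature (coeff c t) (coord c x) y u v)"
  proof (rule local_curvature_transform[where U = U and U' = "chart_region c' t'"])
    show "smooth_coeff U (coeff c t)"
      using smooth_coeff_coeff[OF c(1) t(1)] oU sub unfolding smooth_coeff_def
      by (blast intro: smooth_on_subset)
    show "smooth_coeff (chart_region c' t') (coeff c' t')"
      by (rule smooth_coeff_coeff[OF c(2) t(2)])
    show "coord c x \<in> U" unfolding U_def using x by blast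
    show "smooth_on U (chart_change c c')"
      by (rule smooth_on_subset[OF smooth_chart_change[OF c]]) (auto simp: U_def)
    show "smooth_on U (\<lambda>z. fibre_change c t t' z y)" for y
      by (rule smooth_on_subset[OF smooth_fibre_change[OF c(1) t]]) (auto simp: U_def)
    fix z assume "z \<in> U"
    then obtain p where p: "p \<in> dom c" "p \<in> dom c'" "p \<in> dom t" "p \<in> dom t'" and z: "z = coord c p"
      using U by blast
    show "chart_change c c' z \<in> chart_region c' t'"
      using p c by (simp add: z chart_change_coord coord_in_chart_region)
    show "linear (fibre_change c t t' z)"
      using p c t by (intro linear_fibre_change) (simp_all add: z point_coord)
    show "coeff c' t' (chart_change c c' z) (fibre_change c t t' z y) (frechet_derivative (chart_change c c') (at z) u) =
      frechet_derivative (\<lambda>z. fibre_change c t t' z y) (at z) u + fibre_change c t t' z (coeff c t z y u)" for y u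
      using coeff_transform[OF c t p, of y u] p c by (simp add: z chart_change_coord J)
  qed
  then show ?thesis using c x by (simp add: chart_change_coord J)
qed

end

section \<open>The curvature as a bilinear morphism\<close>

lemma linear_vec_expand:
  fixes y :: "real ^ 'j::finite"
  assumes f: "linear f" shows "f y = (\<Sum>i\<in>UNIV. y $ i *\<^sub>R f (axis i 1))"
proof -
  have "y = (\<Sum>i\<in>UNIV. y $ i *\<^sub>R axis i 1)"
    by (simp add: vec_eq_iff axis_def if_distrib[where f="\<lambda>t. _ * t"] cong: if_cong)
  then have "f y = f (\<Sum>i\<in>UNIV. y $ i *\<^sub>R axis i 1)" by (rule arg_cong)
  then show ?thesis by (simp add: linear_sum[OF f] linear_scale[OF f])
qed

lemma scaleR_fun_apply: "(r *\<^sub>R f) x = r *\<^sub>R f x"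
  by (simp add: scaleR_fun_def)

context manifold
begin

lemma linear_jacobian:
  "c \<in> A \<Longrightarrow> c' \<in> A \<Longrightarrow> x \<in> dom c \<Longrightarrow> x \<in> dom c' \<Longrightarrow> linear (jacobian c c' x)"
  using has_derivative_chart_change has_derivative_linear by blast

lemma tangent_spaceI:
  "(\<And>c c'. c \<in> A \<Longrightarrow> c' \<in> A \<Longrightarrow> x \<in> dom c \<Longrightarrow> x \<in> dom c' \<Longrightarrow> X c' = jacobian c c' x (X c)) \<Longrightarrow>
    (\<And>c. \<not> (c \<in> A \<and> x \<in> dom c) \<Longrightarrow> X c = 0) \<Longrightarrow> X \<in> tangent_space A x"
  unfolding tangent_space_def jacobian_def chart_change_def by blast

lemma tangent_space_outside: "X \<in> tangent_space A x \<Longrightarrow> \<not> (c \<in> A \<and> x \<in> dom c) \<Longrightarrow> X c = 0"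
  unfolding tangent_space_def by blast

lemma subspace_tangent_space: "subspace (tangent_space A x)"
proof (rule subspaceI)
  show "0 \<in> tangent_space A x"
    by (rule tangent_spaceI) (simp_all add: linear_0[OF linear_jacobian])
  show "X + Y \<in> tangent_space A x" if "X \<in> tangent_space A x" "Y \<in> tangent_space A x" for X Y
    using that by (intro tangent_spaceI)
      (simp_all add: linear_add[OF linear_jacobian] tangent_space_outside flip: tangent_space_jacobian)
  show "r *\<^sub>R X \<in> tangent_space A x" if "X \<in> tangent_space A x" for r X
    using that by (intro tangent_spaceI)
      (simp_all add: scaleR_fun_apply linear_scale[OF linear_jacobian] tangent_space_outside flip: tangent_space_jacobian)
qed

end

context vector_bundle_on
begin

lemma fib_dual_bundle: "fib (dual_bundle E) x = dual_space (fib E x)"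
  by (simp add: dual_bundle_def)

lemma dual_trivE:
  assumes "t' \<in> triv (dual_bundle E)"
  obtains t where "t \<in> triv E" "dom t' = dom t"
    "fcoord t' = (\<lambda>x \<alpha>. \<chi> i. \<alpha> (fpoint E t x (axis i 1)))"
  using assms unfolding dual_bundle_def by (auto simp: dom_def fcoord_def)

lemma linear_dual_fpoint:
  assumes "t \<in> triv E" "x \<in> dom t" "\<alpha> \<in> dual_space (fib E x)"
  shows "linear (\<lambda>y. \<alpha> (fpoint E t x y))"
proof -
  have "linear_map_on (fib E x) \<alpha>" using assms(3) unfolding dual_space_def by blast
  then show ?thesis
    using assms(1,2)
    by (intro linearI) (simp_all add: linear_map_on_add linear_map_on_scale fpoint_in_fib
      linear_add[OF linear_fpoint] linear_scale[OF linear_fpoint])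
qed

text \<open>Coordinates on the dual are values on a frame, so the pairing of a covector and a vector, both given
  by components in the same trivialization, is the standard inner product.\<close>

lemma dual_fpoint:
  assumes t: "t \<in> triv E" and x: "x \<in> dom t"
    and t': "fcoord t' = (\<lambda>x \<alpha>. \<chi> i. \<alpha> (fpoint E t x (axis i 1)))"
  shows "fpoint (dual_bundle E) t' x y' \<in> dual_space (fib E x)"
    and "fpoint (dual_bundle E) t' x y' (fpoint E t x \<eta>) = y' \<bullet> \<eta>"
proof -
  let ?V = "fib E x"
  note s = subspace_fib[OF triv_points[OF t x]]
  define \<omega> where "\<omega> e = (if e \<in> ?V then y' \<bullet> fcoord t x e else 0)" for e
  have \<omega>: "\<omega> \<in> dual_space ?V"
    using t x unfolding dual_space_def linear_map_on_def \<omega>_def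
    by (simp add: subspace_add[OF s] subspace_scale[OF s] linear_map_on_add[OF linear_fcoord]
        linear_map_on_scale[OF linear_fcoord] inner_add_right)
  moreover have "fcoord t' x \<omega> = y'"
    using t x by (simp add: t' \<omega>_def fpoint_in_fib fcoord_fpoint vec_eq_iff inner_axis)
  ultimately have y': "y' \<in> fcoord t' x ` fib (dual_bundle E) x"
    unfolding fib_dual_bundle by blast
  show 1: "fpoint (dual_bundle E) t' x y' \<in> dual_space ?V"
    using inv_into_into[OF y'] unfolding fpoint_def fib_dual_bundle .
  have "fcoord t' x (fpoint (dual_bundle E) t' x y') = y'"
    unfolding fpoint_def using f_inv_into_f[OF y'] .
  then have "fpoint (dual_bundle E) t' x y' (fpoint E t x (axis i 1)) = y' $ i" for i
    unfolding t' by (metis vec_lambda_beta)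
  then show "fpoint (dual_bundle E) t' x y' (fpoint E t x \<eta>) = y' \<bullet> \<eta>"
    using linear_vec_expand[OF linear_dual_fpoint[OF t x 1], of \<eta>]
    by (simp add: inner_vec_def mult.commute)
qed

end

context linear_connection_on
begin

lemma conn_form_coeff: "conn_form E K c t = (\<lambda>(z, y) (u, \<eta>). (u, coeff c t z y u))"
  by (simp add: conn_form_def coeff_def fun_eq_iff)

lemma curvature_in_eq:
  assumes ct: "c \<in> A" "t \<in> triv E" "x \<in> dom c" "x \<in> dom t"
  shows "curvature_in A E K c t x e \<alpha> = (\<lambda>X Y. if X \<in> tangent_space A x \<and> Y \<in> tangent_space A x
     then \<alpha> (fpoint E t x (2 *\<^sub>R local_curvature (coeff c t) (coord c x) (fcoord t x e) (X c) (Y c))) else 0)"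
proof -
  have "snd (- fn_bracket (conn_form E K c t) (conn_form E K c t) (coord c x, y) (u, 0) (v, 0)) =
      2 *\<^sub>R local_curvature (coeff c t) (coord c x) y u v" for y u v
    unfolding conn_form_coeff
      fn_bracket_linear[OF smooth_coeff_coeff[OF ct(1,2)] coord_in_chart_region[OF ct(3,4)]]
    by (simp flip: scaleR_minus_left)
  then show ?thesis unfolding curvature_in_def by (simp only:)
qed

text \<open>Whatever coordinates the definition of the curvature selects at \<open>x\<close>, the coordinates \<open>c\<close>, \<open>t\<close> give the
  same value: the components of \<open>e\<close>, of the tangent vectors and of the result all change by the same
  coordinate change.\<close>

lemma curvature_eq:
  assumes ct: "c \<in> A" "t \<in> triv E" "x \<in> dom c" "x \<in> dom t" and e: "e \<in> fib E x"
  shows "curvature A E K x e \<alpha> = (\<lambda>X Y. if X \<in> tangent_space A x \<and> Y \<in> tangent_space A x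
     then \<alpha> (fpoint E t x (2 *\<^sub>R local_curvature (coeff c t) (coord c x) (fcoord t x e) (X c) (Y c))) else 0)"
proof -
  define p where "p = (SOME (c, t). c \<in> A \<and> t \<in> triv E \<and> x \<in> dom c \<and> x \<in> dom t)"
  obtain c' t' where p: "p = (c', t')" by (rule prod.exhaust)
  have "case p of (c, t) \<Rightarrow> c \<in> A \<and> t \<in> triv E \<and> x \<in> dom c \<and> x \<in> dom t"
    unfolding p_def by (rule someI[of _ "(c, t)"]) (use ct in simp)
  then have ct': "c' \<in> A" "t' \<in> triv E" "x \<in> dom c'" "x \<in> dom t'" by (auto simp: p)
  have "fpoint E t' x (2 *\<^sub>R local_curvature (coeff c' t') (coord c' x) (fcoord t' x e) (X c') (Y c')) =
      fpoint E t x (2 *\<^sub>R local_curvature (coeff c t) (coord c x) (fcoord t x e) (X c) (Y c))"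
    if "X \<in> tangent_space A x" "Y \<in> tangent_space A x" for X Y
  proof -
    let ?L = "local_curvature (coeff c t) (coord c x) (fcoord t x e) (X c) (Y c)"
    have "local_curvature (coeff c' t') (coord c' x) (fcoord t' x e) (X c') (Y c') =
        fibre_change c t t' (coord c x) ?L"
      using local_curvature_coordinate_change[OF ct(1) ct'(1) ct(2) ct'(2) ct(3) ct'(3) ct(4) ct'(4),
          of "fcoord t x e" "X c" "Y c"] ct ct' e that
      by (simp add: tangent_space_jacobian[symmetric] fibre_change_fcoord)
    also have "\<dots> = fcoord t' x (fpoint E t x ?L)"
      using ct by (simp add: fibre_change_def point_coord)
    finally show ?thesis
      using ct ct' by (simp add: linear_scale[OF linear_fpoint] fpoint_fcoord fpoint_in_fib)
  qed
  then show ?thesis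
    unfolding curvature_def p_def[symmetric] p curvature_in_eq[OF ct'] Let_def
    by (auto simp: curvature_in_eq[OF ct'] fun_eq_iff)
qed

lemma curvature_in_forms2:
  assumes x: "x \<in> points A" and e: "e \<in> fib E x" and \<alpha>: "\<alpha> \<in> dual_space (fib E x)"
  shows "curvature A E K x e \<alpha> \<in> forms2 A x"
proof -
  obtain c t where ct: "c \<in> A" "t \<in> triv E" "x \<in> dom c" "x \<in> dom t"
    using chart_at[OF x] triv_at[OF x] by blast
  note s = subspace_tangent_space[of x]
  note L = local_curvature_linear[OF smooth_coeff_coeff[OF ct(1,2)] coord_in_chart_region[OF ct(3,4)]]
  note la = linear_dual_fpoint[OF ct(2,4) \<alpha>]
  define k where "k u v = \<alpha> (fpoint E t x (2 *\<^sub>R local_curvature (coeff c t) (coord c x) (fcoord t x e) u v))" for u v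
  have k: "k (u + u') v = k u v + k u' v" "k (r *\<^sub>R u) v = r *\<^sub>R k u v"
    "k v (u + u') = k v u + k v u'" "k v (r *\<^sub>R u) = r *\<^sub>R k v u" "k u u = 0" for u u' v r
    unfolding k_def
    by (simp_all add: linear_add[OF L(2)] linear_add[OF L(3)] linear_scale[OF L(2)] linear_scale[OF L(3)]
        scaleR_add_right linear_add[OF la] linear_scale[OF la])
      (simp add: local_curvature_def linear_0[OF la])
  show ?thesis
    unfolding forms2_def bilinear_on_def linear_map_on_def curvature_eq[OF ct e] k_def[symmetric]
    by (simp add: subspace_add[OF s] subspace_scale[OF s] k scaleR_fun_apply)
qed

lemma bilinear_curvature:
  assumes x: "x \<in> points A"
  shows "bilinear_on (fib E x) (dual_space (fib E x)) (curvature A E K x)"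
proof -
  obtain c t where ct: "c \<in> A" "t \<in> triv E" "x \<in> dom c" "x \<in> dom t"
    using chart_at[OF x] triv_at[OF x] by blast
  note s = subspace_fib[OF x]
  note L = local_curvature_linear[OF smooth_coeff_coeff[OF ct(1,2)] coord_in_chart_region[OF ct(3,4)]]
  note la = linear_dual_fpoint[OF ct(2,4)]
  define k where "k y \<alpha> u v = \<alpha> (fpoint E t x (2 *\<^sub>R local_curvature (coeff c t) (coord c x) y u v))"
    for y and \<alpha> :: "'e \<Rightarrow> real" and u v
  have k: "k (y + y') \<alpha> u v = k y \<alpha> u v + k y' \<alpha> u v" "k (r *\<^sub>R y) \<alpha> u v = r *\<^sub>R k y \<alpha> u v"
    if "\<alpha> \<in> dual_space (fib E x)" for y y' \<alpha> u v r
    unfolding k_def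
    by (simp_all add: linear_add[OF L(1)] linear_scale[OF L(1)]
        scaleR_add_right linear_add[OF la[OF that]] linear_scale[OF la[OF that]])
  have k': "k y (\<alpha> + \<beta>) u v = k y \<alpha> u v + k y \<beta> u v" "k y (r *\<^sub>R \<alpha>) u v = r *\<^sub>R k y \<alpha> u v" for y \<alpha> \<beta> u v r
    by (simp_all add: k_def scaleR_fun_apply)
  show ?thesis
    unfolding bilinear_on_def linear_map_on_def
    using ct
    by (simp add: curvature_eq[OF ct] fun_eq_iff subspace_add[OF s] subspace_scale[OF s] k_def[symmetric]
        linear_map_on_add[OF linear_fcoord] linear_map_on_scale[OF linear_fcoord] k k' scaleR_fun_apply)
qed

text \<open>With \<open>c\<close> and \<open>t\<close> held fixed near the point, the curvature is a polynomial in the fibre coordinates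
  whose coefficients are smooth functions of the base point. The trivialization \<open>t'\<close> of the dual may come from
  a trivialization \<open>t2\<close> of \<open>E\<close> other than \<open>t\<close>; the fibre change between them enters as one more smooth factor.\<close>

lemma smooth_curvature:
  assumes ct: "c \<in> A" "t \<in> triv E" and t': "t' \<in> triv (dual_bundle E)"
  shows "smooth_on ((coord c ` (dom c \<inter> dom t \<inter> dom t')) \<times> UNIV \<times> UNIV)
    (\<lambda>(z, y, y'). let x = point c z in
       curvature A E K x (fpoint E t x y) (fpoint (dual_bundle E) t' x y') (coord_vector A c x u) (coord_vector A c x v))"
    (is "smooth_on (?U \<times> _ \<times> _) ?F")
proof -
  obtain t2 where t2: "t2 \<in> triv E" "dom t' = dom t2"
    and ft': "fcoord t' = (\<lambda>x \<alpha>. \<chi> i. \<alpha> (fpoint E t2 x (axis i 1)))"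
    using dual_trivE[OF t'] by metis
  let ?S = "?U \<times> (UNIV :: (real ^ 'k) set) \<times> (UNIV :: (real ^ 'k) set)"
  have U: "?U = coord c ` (dom c \<inter> (dom t \<inter> dom t2))" by (simp add: t2 Int_assoc)
  have oU: "open ?U" unfolding U by (intro open_coord_image ct open_Int open_triv t2)
  have oS: "open ?S" by (intro open_Times oU open_UNIV)
  define q where "q z j = (\<Sum>i\<in>UNIV. (local_curvature (coeff c t) z (axis j 1) u v) $ i *\<^sub>R
     fibre_change c t t2 z (axis i 1))" for z and j :: 'k
  have "smooth_on ?U (\<lambda>z. q z j)" for j
    unfolding q_def
  proof (intro smooth_on_sum smooth_on_scaleR smooth_on_vec_nth oU)
    show "smooth_on ?U (\<lambda>z. local_curvature (coeff c t) z (axis j 1) u v)"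
      by (rule smooth_on_subset[OF smooth_local_curvature[OF smooth_coeff_coeff[OF ct]]])
        (auto simp: chart_region_def)
    show "smooth_on ?U (\<lambda>z. fibre_change c t t2 z (axis i 1))" for i
      unfolding U by (rule smooth_fibre_change[OF ct t2(1)])
  qed
  then have q: "smooth_on ?S (\<lambda>p. q (fst p) j)" for j
    by (intro smooth_on_comp_linear[OF oU oS bounded_linear_fst, of "\<lambda>z. q z j"]) auto
  have "smooth_on ?S (\<lambda>p. 2 *\<^sub>R (snd (snd p) \<bullet> (\<Sum>j\<in>UNIV. (fst (snd p)) $ j *\<^sub>R q (fst p) j)))"
    by (intro smooth_on_scaleR smooth_on_bounded_bilinear[OF _ bounded_bilinear_inner] smooth_on_sum
        smooth_on_vec_nth smooth_on_const q oS smooth_on_linear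
        bounded_linear_compose[OF bounded_linear_fst bounded_linear_snd]
        bounded_linear_compose[OF bounded_linear_snd bounded_linear_snd])
  then show ?thesis
  proof (rule smooth_on_cong_imp[OF oS])
    fix p assume "p \<in> ?S"
    then obtain z y y' where p: "p = (z, y, y')" and z: "z \<in> ?U" by force
    define x where "x = point c z"
    have x: "x \<in> dom c" "x \<in> dom t" "x \<in> dom t2" "coord c x = z"
      using coord_imageE[OF ct(1) z[unfolded U]] unfolding x_def by auto
    note ctx = ct x(1,2)
    note T = coord_vector_in_tangent_space[OF ct(1) x(1)] coord_vector_component[OF ct(1) x(1)]
    let ?l = "local_curvature (coeff c t) z y u v"
    have lf: "linear (fibre_change c t t2 z)"
      using x by (intro linear_fibre_change ct t2) (simp_all add: x_def)
    have ll: "linear (\<lambda>y. local_curvature (coeff c t) z y u v)"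
      using local_curvature_linear(1)[OF smooth_coeff_coeff[OF ct] coord_in_chart_region[OF x(1,2)]] x by simp
    have "fibre_change c t t2 z (local_curvature (coeff c t) z (axis j 1) u v) = q z j" for j
      unfolding q_def by (rule linear_vec_expand[OF lf])
    then have eq: "fibre_change c t t2 z ?l = (\<Sum>j\<in>UNIV. y $ j *\<^sub>R q z j)"
      using linear_vec_expand[OF linear_compose[OF ll lf], of y] by simp
    have "fpoint E t x ?l = fpoint E t2 x (fibre_change c t t2 z ?l)"
      using x t2 ct by (simp add: fibre_change_def x_def[symmetric] fpoint_fcoord fpoint_in_fib)
    then have "fpoint (dual_bundle E) t' x y' (fpoint E t x ?l) = y' \<bullet> fibre_change c t t2 z ?l"
      by (simp add: dual_fpoint(2)[OF t2(1) x(3) ft'])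
    moreover have "fpoint (dual_bundle E) t' x y' (2 *\<^sub>R fpoint E t x ?l) = 2 * fpoint (dual_bundle E) t' x y' (fpoint E t x ?l)"
      using linear_scale[OF linear_dual_fpoint[OF ct(2) x(2) dual_fpoint(1)[OF t2(1) x(3) ft']], of y' 2 ?l]
      by (simp add: linear_scale[OF linear_fpoint[OF ct(2) x(2)]])
    ultimately show "2 *\<^sub>R (snd (snd p) \<bullet> (\<Sum>j\<in>UNIV. (fst (snd p)) $ j *\<^sub>R q (fst p) j)) = ?F p"
      using x ct by (simp add: p Let_def x_def[symmetric] curvature_eq[OF ctx fpoint_in_fib[OF ctx(2,4)]] T
          fcoord_fpoint eq linear_scale[OF linear_fpoint[OF ct(2) x(2)]])
  qed
qed

lemma bilinear_morphism_curvature: "bilinear_morphism A E (dual_bundle E) (curvature A E K)"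
  unfolding bilinear_morphism_def
  using curvature_in_forms2 bilinear_curvature smooth_curvature by (simp add: fib_dual_bundle)

end

section \<open>The tensor product bundle\<close>

lemma sum_apply: "(\<Sum>i\<in>I. f i) x = (\<Sum>i\<in>I. f i x)"
  by (induction I rule: infinite_finite_induct) simp_all

lemma subspace_dual_space: "subspace (dual_space V)"
  by (rule subspaceI) (simp_all add: dual_space_def linear_map_on_def scaleR_fun_apply algebra_simps)

lemma subspace_tensor_space: "subspace (tensor_space V V')"
  by (rule subspaceI)
    (simp_all add: tensor_space_def bilinear_on_def linear_map_on_def scaleR_fun_apply algebra_simps)

lemma fib_tensor_bundle: "fib (tensor_bundle E E') x = tensor_space (fib E x) (fib E' x)"
  by (simp add: tensor_bundle_def)

lemma tensor_elem_in_tensor_space: "tensor_elem E E' x e e' \<in> tensor_space (fib E x) (fib E' x)"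
proof -
  note s = subspace_dual_space[of "fib E x"] subspace_dual_space[of "fib E' x"]
  show ?thesis
    by (simp add: tensor_space_def bilinear_on_def linear_map_on_def tensor_elem_def scaleR_fun_apply
      algebra_simps subspace_add[OF s(1)] subspace_scale[OF s(1)] subspace_add[OF s(2)] subspace_scale[OF s(2)])
qed

text \<open>The components of \<open>y \<otimes> z\<close> in the basis of products of basis vectors.\<close>

definition outer :: "real ^ 'k::finite \<Rightarrow> real ^ 'l::finite \<Rightarrow> real ^ ('k \<times> 'l)"
  where "outer y z = (\<chi> p. y $ fst p * z $ snd p)"

lemma bounded_bilinear_outer: "bounded_bilinear outer"
proof
  show "outer (a + a') b = outer a b + outer a' b" for a a' :: "real ^ 'k" and b :: "real ^ 'l"
    by (simp add: outer_def vec_eq_iff algebra_simps)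
  show "outer a (b + b') = outer a b + outer a b'" for a :: "real ^ 'k" and b b' :: "real ^ 'l"
    by (simp add: outer_def vec_eq_iff algebra_simps)
  show "outer (r *\<^sub>R a) b = r *\<^sub>R outer a b" for r and a :: "real ^ 'k" and b :: "real ^ 'l"
    by (simp add: outer_def vec_eq_iff)
  show "outer a (r *\<^sub>R b) = r *\<^sub>R outer a b" for r and a :: "real ^ 'k" and b :: "real ^ 'l"
    by (simp add: outer_def vec_eq_iff)
  have "norm (outer a b) \<le> norm a * norm b * real CARD('k \<times> 'l)"
    for a :: "real ^ 'k::finite" and b :: "real ^ 'l::finite"
  proof -
    have "norm (outer a b) \<le> (\<Sum>p\<in>UNIV. \<bar>outer a b $ p\<bar>)" by (rule norm_le_l1_cart)
    also have "\<dots> \<le> (\<Sum>p\<in>(UNIV :: ('k \<times> 'l) set). norm a * norm b)"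
      by (intro sum_mono) (simp add: outer_def abs_mult mult_mono component_le_norm_cart)
    finally show ?thesis by (simp add: mult.commute)
  qed
  then show "\<exists>K. \<forall>(a :: real ^ 'k::finite) (b :: real ^ 'l::finite). norm (outer a b) \<le> norm a * norm b * K" by blast
qed

lemma outer_axis: "outer (axis i 1) (axis a 1) = axis (i, a) 1"
  by (auto simp: outer_def vec_eq_iff axis_def)

lemmas linear_outer_left = bounded_linear.linear[OF bounded_bilinear.bounded_linear_left[OF bounded_bilinear_outer]]
lemmas linear_outer_right = bounded_linear.linear[OF bounded_bilinear.bounded_linear_right[OF bounded_bilinear_outer]]

definition tensor_triv ::
    "('m, 'e::real_vector, 'k::finite) vbundle \<Rightarrow> ('m, 'f::real_vector, 'l::finite) vbundle \<Rightarrow>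
     ('m, 'e, 'k) trivialization \<Rightarrow> ('m, 'f, 'l) trivialization \<Rightarrow>
     ('m, ('e \<Rightarrow> real) \<Rightarrow> ('f \<Rightarrow> real) \<Rightarrow> real, 'k \<times> 'l) trivialization"
  where "tensor_triv E E' t t' =
    (dom t \<inter> dom t', \<lambda>x w. \<chi> p. w (coframe E t x (fst p)) (coframe E' t' x (snd p)))"

lemma triv_tensor_bundle: "triv (tensor_bundle E E') = {tensor_triv E E' t t' | t t'. t \<in> triv E \<and> t' \<in> triv E'}"
  by (auto simp: tensor_bundle_def tensor_triv_def)

lemma tensor_triv_in: "t \<in> triv E \<Longrightarrow> t' \<in> triv E' \<Longrightarrow> tensor_triv E E' t t' \<in> triv (tensor_bundle E E')"
  unfolding triv_tensor_bundle by blast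

lemma dom_tensor_triv: "dom (tensor_triv E E' t t') = dom t \<inter> dom t'"
  by (simp add: tensor_triv_def dom_def)

lemma fcoord_tensor_triv:
  "fcoord (tensor_triv E E' t t') x w = (\<chi> p. w (coframe E t x (fst p)) (coframe E' t' x (snd p)))"
  by (simp add: tensor_triv_def fcoord_def)

lemma linear_fcoord_tensor_triv: "linear (fcoord (tensor_triv E E' t t') x)"
  by (rule linearI) (simp_all add: fcoord_tensor_triv vec_eq_iff scaleR_fun_apply)

context vector_bundle_on
begin

lemma coframe_in_dual_space:
  assumes "t \<in> triv E" "x \<in> dom t"
  shows "coframe E t x i \<in> dual_space (fib E x)"
  using linear_fcoord[OF assms] subspace_add[OF subspace_fib[OF triv_points[OF assms]]]
    subspace_scale[OF subspace_fib[OF triv_points[OF assms]]]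
  by (simp add: dual_space_def linear_map_on_def coframe_def)

lemma dual_expand:
  assumes t: "t \<in> triv E" "x \<in> dom t" and \<alpha>: "\<alpha> \<in> dual_space (fib E x)"
  shows "\<alpha> = (\<Sum>i\<in>UNIV. \<alpha> (fpoint E t x (axis i 1)) *\<^sub>R coframe E t x i)"
proof
  fix e
  show "\<alpha> e = (\<Sum>i\<in>UNIV. \<alpha> (fpoint E t x (axis i 1)) *\<^sub>R coframe E t x i) e"
  proof (cases "e \<in> fib E x")
    case True
    with linear_vec_expand[OF linear_dual_fpoint[OF t \<alpha>], of "fcoord t x e"] show ?thesis
      by (simp add: sum_apply scaleR_fun_apply coframe_def fpoint_fcoord[OF t] mult.commute)
  next
    case False
    with \<alpha> show ?thesis by (simp add: sum_apply scaleR_fun_apply coframe_def dual_space_def)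
  qed
qed

end

locale bundle_pair = E: vector_bundle_on A E + E': vector_bundle_on A E'
  for A :: "('m::{second_countable_topology, t2_space}, 'n::finite) chart set"
    and E :: "('m, 'e::real_vector, 'k::finite) vbundle"
    and E' :: "('m, 'f::real_vector, 'l::finite) vbundle"
begin

abbreviation T where "T \<equiv> tensor_bundle E E'"
abbreviation tens where "tens \<equiv> tensor_elem E E'"

abbreviation frame_elem where
  "frame_elem t t' x p \<equiv> tens x (fpoint E t x (axis (fst p) 1)) (fpoint E' t' x (axis (snd p) 1))"

lemma fcoord_tens:
  assumes "t \<in> triv E" "t' \<in> triv E'" "x \<in> dom t" "x \<in> dom t'" "e \<in> fib E x" "e' \<in> fib E' x"
  shows "fcoord (tensor_triv E E' t t') x (tens x e e') = outer (fcoord t x e) (fcoord t' x e')"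
  using assms E.coframe_in_dual_space E'.coframe_in_dual_space
  by (simp add: fcoord_tensor_triv outer_def vec_eq_iff tensor_elem_def) (simp add: coframe_def)

lemma fcoord_frame_sum:
  assumes "t \<in> triv E" "t' \<in> triv E'" "x \<in> dom t" "x \<in> dom t'"
    "s \<in> triv E" "s' \<in> triv E'" "x \<in> dom s" "x \<in> dom s'"
  shows "fcoord (tensor_triv E E' s s') x (\<Sum>p\<in>UNIV. y $ p *\<^sub>R frame_elem t t' x p) =
    (\<Sum>p\<in>UNIV. y $ p *\<^sub>R outer (fcoord s x (fpoint E t x (axis (fst p) 1)))
       (fcoord s' x (fpoint E' t' x (axis (snd p) 1))))"
  using assms
  by (simp add: linear_sum[OF linear_fcoord_tensor_triv] linear_scale[OF linear_fcoord_tensor_triv]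
      fcoord_tens E.fpoint_in_fib E'.fpoint_in_fib)

text \<open>A tensor is a bilinear function on covectors, hence determined by its values on the coframes, which
  are its coordinates.\<close>

lemma tensor_expand:
  assumes t: "t \<in> triv E" "x \<in> dom t" and t': "t' \<in> triv E'" "x \<in> dom t'"
    and w: "w \<in> tensor_space (fib E x) (fib E' x)"
  shows "w = (\<Sum>p\<in>UNIV. fcoord (tensor_triv E E' t t') x w $ p *\<^sub>R frame_elem t t' x p)"
proof (intro ext)
  fix \<alpha> \<beta>
  let ?D = "dual_space (fib E x)" and ?D' = "dual_space (fib E' x)"
  show "w \<alpha> \<beta> = (\<Sum>p\<in>UNIV. fcoord (tensor_triv E E' t t') x w $ p *\<^sub>R frame_elem t t' x p) \<alpha> \<beta>"
  proof (cases "\<alpha> \<in> ?D \<and> \<beta> \<in> ?D'")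
    case True
    then have \<alpha>: "\<alpha> \<in> ?D" and \<beta>: "\<beta> \<in> ?D'" by auto
    let ?a = "\<lambda>i. \<alpha> (fpoint E t x (axis i 1))" and ?b = "\<lambda>i. \<beta> (fpoint E' t' x (axis i 1))"
    let ?f = "coframe E t x" and ?f' = "coframe E' t' x"
    have bil: "linear_map_on ?D (\<lambda>\<alpha>. w \<alpha> b)" "linear_map_on ?D' (w a)" if "a \<in> ?D" "b \<in> ?D'" for a b
      using w that unfolding tensor_space_def bilinear_on_def by blast+
    have "w \<alpha> \<beta> = w (\<Sum>i\<in>UNIV. ?a i *\<^sub>R ?f i) \<beta>"
      by (rule arg_cong[OF E.dual_expand[OF t \<alpha>]])
    also have "\<dots> = (\<Sum>i\<in>UNIV. ?a i *\<^sub>R w (?f i) \<beta>)"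
      by (rule linear_map_on_sum[OF bil(1)[OF \<alpha> \<beta>] subspace_dual_space E.coframe_in_dual_space[OF t]])
    also have "\<dots> = (\<Sum>i\<in>UNIV. ?a i *\<^sub>R (\<Sum>j\<in>UNIV. ?b j *\<^sub>R w (?f i) (?f' j)))"
    proof (intro sum.cong refl arg_cong2[of _ _ _ _ scaleR])
      fix i
      have "w (?f i) \<beta> = w (?f i) (\<Sum>j\<in>UNIV. ?b j *\<^sub>R ?f' j)"
        by (rule arg_cong[OF E'.dual_expand[OF t' \<beta>]])
      also have "\<dots> = (\<Sum>j\<in>UNIV. ?b j *\<^sub>R w (?f i) (?f' j))"
        by (rule linear_map_on_sum[OF bil(2)[OF E.coframe_in_dual_space[OF t] \<beta>] subspace_dual_space
              E'.coframe_in_dual_space[OF t']])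
      finally show "w (?f i) \<beta> = (\<Sum>j\<in>UNIV. ?b j *\<^sub>R w (?f i) (?f' j))" .
    qed
    also have "\<dots> = (\<Sum>p\<in>UNIV. w (?f (fst p)) (?f' (snd p)) * (?a (fst p) * ?b (snd p)))"
      by (simp add: sum_distrib_left sum.cartesian_product case_prod_beta mult_ac)
    also have "\<dots> = (\<Sum>p\<in>UNIV. fcoord (tensor_triv E E' t t') x w $ p *\<^sub>R frame_elem t t' x p) \<alpha> \<beta>"
      using \<alpha> \<beta> by (simp add: sum_apply scaleR_fun_apply tensor_elem_def fcoord_tensor_triv)
    finally show ?thesis .
  next
    case False
    then have "w \<alpha> \<beta> = 0" using w unfolding tensor_space_def by blast
    with False show ?thesis by (auto simp: sum_apply scaleR_fun_apply tensor_elem_def)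
  qed
qed

lemma frame_sum_in_fib: "(\<Sum>p\<in>UNIV. y $ p *\<^sub>R frame_elem t t' x p) \<in> fib T x"
  unfolding fib_tensor_bundle
  by (intro subspace_sum subspace_scale subspace_tensor_space tensor_elem_in_tensor_space)

lemma fcoord_frame_sum_same:
  assumes "t \<in> triv E" "t' \<in> triv E'" "x \<in> dom t" "x \<in> dom t'"
  shows "fcoord (tensor_triv E E' t t') x (\<Sum>p\<in>UNIV. y $ p *\<^sub>R frame_elem t t' x p) = y"
proof -
  have "fcoord (tensor_triv E E' t t') x (\<Sum>p\<in>UNIV. y $ p *\<^sub>R frame_elem t t' x p) =
      (\<Sum>p\<in>UNIV. y $ p *\<^sub>R axis p 1)"
    using fcoord_frame_sum[OF assms assms, of y] assms
    by (simp add: E.fcoord_fpoint E'.fcoord_fpoint outer_axis)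
  also have "\<dots> = y" using linear_vec_expand[OF linear_ident, of y] by simp
  finally show ?thesis .
qed

lemma bij_fcoord_tensor:
  assumes "t \<in> triv E" "t' \<in> triv E'" "x \<in> dom t" "x \<in> dom t'"
  shows "bij_betw (fcoord (tensor_triv E E' t t') x) (fib T x) UNIV"
  unfolding bij_betw_def
proof
  show "inj_on (fcoord (tensor_triv E E' t t') x) (fib T x)"
  proof (rule inj_onI)
    fix w w' assume w: "w \<in> fib T x" "w' \<in> fib T x"
      and eq: "fcoord (tensor_triv E E' t t') x w = fcoord (tensor_triv E E' t t') x w'"
    have "w = (\<Sum>p\<in>UNIV. fcoord (tensor_triv E E' t t') x w' $ p *\<^sub>R frame_elem t t' x p)"
      using tensor_expand[OF assms(1,3,2,4) w(1)[unfolded fib_tensor_bundle]] unfolding eq .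
    also have "\<dots> = w'"
      using tensor_expand[OF assms(1,3,2,4) w(2)[unfolded fib_tensor_bundle]] by (rule sym)
    finally show "w = w'" .
  qed
  have "y \<in> fcoord (tensor_triv E E' t t') x ` fib T x" for y
    by (rule image_eqI[OF _ frame_sum_in_fib]) (rule fcoord_frame_sum_same[OF assms, symmetric])
  then show "fcoord (tensor_triv E E' t t') x ` fib T x = UNIV" by blast
qed

lemma fpoint_tensor:
  assumes "t \<in> triv E" "t' \<in> triv E'" "x \<in> dom t" "x \<in> dom t'"
  shows "fpoint T (tensor_triv E E' t t') x y = (\<Sum>p\<in>UNIV. y $ p *\<^sub>R frame_elem t t' x p)"
proof -
  let ?S = "\<Sum>p\<in>UNIV. y $ p *\<^sub>R frame_elem t t' x p" and ?f = "fcoord (tensor_triv E E' t t') x"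
  have "inv_into (fib T x) ?f (?f ?S) = ?S"
    by (rule inv_into_f_f[OF bij_betw_imp_inj_on[OF bij_fcoord_tensor[OF assms]]]) (rule frame_sum_in_fib)
  then show ?thesis unfolding fpoint_def[of T] fcoord_frame_sum_same[OF assms] .
qed

text \<open>The transition functions of the tensor product are the products of the transition functions of the
  factors.\<close>

lemma vector_bundle_tensor: "vector_bundle A T"
  unfolding vector_bundle_def
proof (intro conjI ballI allI)
  show "subspace (fib T x)" for x
    unfolding fib_tensor_bundle by (rule subspace_tensor_space)
  show "\<exists>t\<in>triv T. x \<in> dom t" if x: "x \<in> points A" for x
  proof -
    obtain t t' where "t \<in> triv E" "t' \<in> triv E'" "x \<in> dom t" "x \<in> dom t'"
      using E.triv_at[OF x] E'.triv_at[OF x] by blast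
    then show ?thesis by (intro bexI[of _ "tensor_triv E E' t t'"]) (auto simp: dom_tensor_triv tensor_triv_in)
  qed
  fix \<tau> assume "\<tau> \<in> triv T"
  then obtain t t' where t: "t \<in> triv E" "t' \<in> triv E'" and \<tau>: "\<tau> = tensor_triv E E' t t'"
    unfolding triv_tensor_bundle by blast
  show "open (dom \<tau>)"
    unfolding \<tau> dom_tensor_triv using t by (intro open_Int E.open_triv E'.open_triv)
  show "dom \<tau> \<subseteq> points A"
    unfolding \<tau> dom_tensor_triv using E.triv_subset_points[OF t(1)] by blast
  show "linear_map_on (fib T x) (fcoord \<tau> x)" for x
    unfolding \<tau> linear_map_on_def
    by (simp add: linear_add[OF linear_fcoord_tensor_triv] linear_scale[OF linear_fcoord_tensor_triv])
  show "bij_betw (fcoord \<tau> x) (fib T x) UNIV" if "x \<in> dom \<tau>" for x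
    using that t unfolding \<tau> dom_tensor_triv by (intro bij_fcoord_tensor) auto
  fix \<sigma> y assume "\<sigma> \<in> triv T"
  then obtain s s' where s: "s \<in> triv E" "s' \<in> triv E'" and \<sigma>: "\<sigma> = tensor_triv E E' s s'"
    unfolding triv_tensor_bundle by blast
  let ?W = "dom \<tau> \<inter> dom \<sigma>"
  have W: "?W = (dom t \<inter> dom s) \<inter> (dom t' \<inter> dom s')" by (auto simp: \<tau> \<sigma> dom_tensor_triv)
  have o: "open ?W" unfolding W using t s by (intro open_Int E.open_triv E'.open_triv)
  have sm: "smooth_map_on A ?W (\<lambda>x. fcoord s x (fpoint E t x y))" "smooth_map_on A ?W (\<lambda>x. fcoord s' x (fpoint E' t' x y'))" for y y'
  proof -
    have "smooth_map_on A (dom t \<inter> dom s) (\<lambda>x. fcoord s x (fpoint E t x y))"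
      using E.vector_bundle t s unfolding vector_bundle_def by blast
    then show "smooth_map_on A ?W (\<lambda>x. fcoord s x (fpoint E t x y))"
      by (rule E.smooth_map_on_subset) (auto simp: W)
    have "smooth_map_on A (dom t' \<inter> dom s') (\<lambda>x. fcoord s' x (fpoint E' t' x y'))"
      using E'.vector_bundle t s unfolding vector_bundle_def by blast
    then show "smooth_map_on A ?W (\<lambda>x. fcoord s' x (fpoint E' t' x y'))"
      by (rule E.smooth_map_on_subset) (auto simp: W)
  qed
  show "smooth_map_on A ?W (\<lambda>x. fcoord \<sigma> x (fpoint T \<tau> x y))"
  proof (rule E.smooth_map_on_cong_imp[OF o])
    show "smooth_map_on A ?W (\<lambda>x. \<Sum>p\<in>UNIV. y $ p *\<^sub>R outer (fcoord s x (fpoint E t x (axis (fst p) 1)))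
       (fcoord s' x (fpoint E' t' x (axis (snd p) 1))))"
      by (intro E.smooth_map_on_sum E.smooth_map_on_bounded_bilinear[OF _ bounded_bilinear_scaleR]
          E.smooth_map_on_bounded_bilinear[OF _ bounded_bilinear_outer] E.smooth_map_on_const sm o)
    show "(\<Sum>p\<in>UNIV. y $ p *\<^sub>R outer (fcoord s x (fpoint E t x (axis (fst p) 1)))
       (fcoord s' x (fpoint E' t' x (axis (snd p) 1)))) = fcoord \<sigma> x (fpoint T \<tau> x y)" if "x \<in> ?W" for x
    proof -
      from that have x: "x \<in> dom t" "x \<in> dom t'" "x \<in> dom s" "x \<in> dom s'" unfolding W by auto
      show ?thesis
        unfolding \<tau> \<sigma> fpoint_tensor[OF t x(1,2)] by (rule fcoord_frame_sum[OF t x(1,2) s x(3,4), symmetric])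
    qed
  qed
qed

sublocale T: vector_bundle_on A T
  by unfold_locales (rule vector_bundle_tensor)

lemma tens_in_fib: "tens x e e' \<in> fib T x"
  unfolding fib_tensor_bundle by (rule tensor_elem_in_tensor_space)

lemma fpoint_outer:
  assumes "t \<in> triv E" "t' \<in> triv E'" "x \<in> dom t" "x \<in> dom t'"
  shows "fpoint T (tensor_triv E E' t t') x (outer y z) = tens x (fpoint E t x y) (fpoint E' t' x z)"
proof -
  note \<tau> = tensor_triv_in[OF assms(1,2)]
  have x: "x \<in> dom (tensor_triv E E' t t')" using assms by (simp add: dom_tensor_triv)
  show ?thesis
  proof (rule T.fcoord_inject[OF \<tau> x T.fpoint_in_fib[OF \<tau> x] tens_in_fib])
    have "fcoord (tensor_triv E E' t t') x (tens x (fpoint E t x y) (fpoint E' t' x z)) = outer y z"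
      unfolding fcoord_tens[OF assms E.fpoint_in_fib[OF assms(1,3)] E'.fpoint_in_fib[OF assms(2,4)]]
        E.fcoord_fpoint[OF assms(1,3)] E'.fcoord_fpoint[OF assms(2,4)] ..
    then show "fcoord (tensor_triv E E' t t') x (fpoint T (tensor_triv E E' t t') x (outer y z)) =
        fcoord (tensor_triv E E' t t') x (tens x (fpoint E t x y) (fpoint E' t' x z))"
      unfolding T.fcoord_fpoint[OF \<tau> x] by (rule sym)
  qed
qed

lemma cotensor_elem_in_dual: "cotensor_elem E E' x \<alpha> \<beta> \<in> dual_space (fib T x)"
proof -
  have "subspace (fib T x)"
    unfolding fib_tensor_bundle by (rule subspace_tensor_space)
  from subspace_add[OF this] subspace_scale[OF this] show ?thesis
    by (simp add: dual_space_def linear_map_on_def cotensor_elem_def scaleR_fun_apply)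
qed

text \<open>The coframe of the product frame consists of the products of the coframes, so covectors on the
  tensor product are combinations of products of covectors.\<close>

lemma dual_tensor_expand:
  assumes t: "t \<in> triv E" "t' \<in> triv E'" and x: "x \<in> dom t" "x \<in> dom t'" and \<omega>: "\<omega> \<in> dual_space (fib T x)"
  shows "\<omega> = (\<Sum>p\<in>UNIV. \<omega> (frame_elem t t' x p) *\<^sub>R
    cotensor_elem E E' x (coframe E t x (fst p)) (coframe E' t' x (snd p)))"
proof -
  have frame: "fpoint T (tensor_triv E E' t t') x (axis p 1) = frame_elem t t' x p" for p
    using fpoint_outer[OF t x, of "axis (fst p) 1" "axis (snd p) 1"] by (simp add: outer_axis)
  have coframe: "coframe T (tensor_triv E E' t t') x p =
      cotensor_elem E E' x (coframe E t x (fst p)) (coframe E' t' x (snd p))" for p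
    by (rule ext) (simp add: coframe_def[of T] cotensor_elem_def fcoord_tensor_triv)
  have "x \<in> dom (tensor_triv E E' t t')" using x by (simp add: dom_tensor_triv)
  from T.dual_expand[OF tensor_triv_in[OF t] this \<omega>] show ?thesis
    unfolding frame coframe .
qed

text \<open>Both arguments expand in simple tensors, with coefficients that do not depend on the bilinear map.\<close>

lemma bilinear_on_tensor_unique:
  fixes B B' :: "(('e \<Rightarrow> real) \<Rightarrow> ('f \<Rightarrow> real) \<Rightarrow> real) \<Rightarrow> ((('e \<Rightarrow> real) \<Rightarrow> ('f \<Rightarrow> real) \<Rightarrow> real) \<Rightarrow> real) \<Rightarrow> 'g::real_vector"
  assumes x: "x \<in> points A"
    and B: "bilinear_on (fib T x) (dual_space (fib T x)) B" and B': "bilinear_on (fib T x) (dual_space (fib T x)) B'"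
    and eq: "\<And>e e' \<alpha> \<beta>. e \<in> fib E x \<Longrightarrow> e' \<in> fib E' x \<Longrightarrow> \<alpha> \<in> dual_space (fib E x) \<Longrightarrow> \<beta> \<in> dual_space (fib E' x) \<Longrightarrow>
      B (tens x e e') (cotensor_elem E E' x \<alpha> \<beta>) = B' (tens x e e') (cotensor_elem E E' x \<alpha> \<beta>)"
    and w: "w \<in> fib T x" and \<omega>: "\<omega> \<in> dual_space (fib T x)"
  shows "B w \<omega> = B' w \<omega>"
proof -
  obtain t t' where t: "t \<in> triv E" "t' \<in> triv E'" "x \<in> dom t" "x \<in> dom t'"
    using E.triv_at[OF x] E'.triv_at[OF x] by blast
  let ?k = "\<lambda>q. cotensor_elem E E' x (coframe E t x (fst q)) (coframe E' t' x (snd q))"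
  have "C w \<omega> = (\<Sum>p\<in>UNIV. fcoord (tensor_triv E E' t t') x w $ p *\<^sub>R
      (\<Sum>q\<in>UNIV. \<omega> (frame_elem t t' x q) *\<^sub>R C (frame_elem t t' x p) (?k q)))"
    if C: "bilinear_on (fib T x) (dual_space (fib T x)) C" for C :: "_ \<Rightarrow> _ \<Rightarrow> 'g"
  proof -
    have l: "linear_map_on (fib T x) (\<lambda>w. C w \<omega>)" "linear_map_on (dual_space (fib T x)) (C w)" if "w \<in> fib T x" for w
      using C \<omega> that unfolding bilinear_on_def by blast+
    have "C w \<omega> = C (\<Sum>p\<in>UNIV. fcoord (tensor_triv E E' t t') x w $ p *\<^sub>R frame_elem t t' x p) \<omega>"
      by (rule arg_cong[OF tensor_expand[OF t(1,3,2,4) w[unfolded fib_tensor_bundle]]])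
    also have "\<dots> = (\<Sum>p\<in>UNIV. fcoord (tensor_triv E E' t t') x w $ p *\<^sub>R C (frame_elem t t' x p) \<omega>)"
      by (rule linear_map_on_sum[OF l(1)[OF w] T.subspace_fib[OF x] tens_in_fib])
    also have "\<dots> = (\<Sum>p\<in>UNIV. fcoord (tensor_triv E E' t t') x w $ p *\<^sub>R
      (\<Sum>q\<in>UNIV. \<omega> (frame_elem t t' x q) *\<^sub>R C (frame_elem t t' x p) (?k q)))"
    proof (intro sum.cong refl arg_cong2[of _ _ _ _ scaleR])
      fix p
      have "C (frame_elem t t' x p) \<omega> = C (frame_elem t t' x p) (\<Sum>q\<in>UNIV. \<omega> (frame_elem t t' x q) *\<^sub>R ?k q)"
        by (rule arg_cong[OF dual_tensor_expand[OF t \<omega>]])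
      also have "\<dots> = (\<Sum>q\<in>UNIV. \<omega> (frame_elem t t' x q) *\<^sub>R C (frame_elem t t' x p) (?k q))"
        by (rule linear_map_on_sum[OF l(2)[OF tens_in_fib] subspace_dual_space cotensor_elem_in_dual])
      finally show "C (frame_elem t t' x p) \<omega> = (\<Sum>q\<in>UNIV. \<omega> (frame_elem t t' x q) *\<^sub>R C (frame_elem t t' x p) (?k q))" .
    qed
    finally show ?thesis .
  qed
  from this[OF B] this[OF B'] show ?thesis
    using t by (simp add: eq E.fpoint_in_fib E'.fpoint_in_fib E.coframe_in_dual_space E'.coframe_in_dual_space)
qed

lemma local_section_tens:
  assumes "local_section A E x s" "local_section A E' x s'"
  shows "local_section A T x (\<lambda>y. tens y (s y) (s' y))"
proof -
  from assms obtain V W where V: "x \<in> V" "smooth_section A E V s" and W: "x \<in> W" "smooth_section A E' W s'"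
    unfolding local_section_def by blast
  have "smooth_section A T (V \<inter> W) (\<lambda>y. tens y (s y) (s' y))"
    unfolding smooth_section_def
  proof (intro conjI ballI)
    show "open (V \<inter> W)" "V \<inter> W \<subseteq> points A"
      using V W unfolding smooth_section_def by auto
    show "tens y (s y) (s' y) \<in> fib T y" for y by (rule tens_in_fib)
    fix \<tau> assume "\<tau> \<in> triv T"
    then obtain t t' where t: "t \<in> triv E" "t' \<in> triv E'" and \<tau>: "\<tau> = tensor_triv E E' t t'"
      unfolding triv_tensor_bundle by blast
    show "smooth_map_on A (dom \<tau> \<inter> (V \<inter> W)) (\<lambda>y. fcoord \<tau> y (tens y (s y) (s' y)))"
    proof (rule E.smooth_map_on_cong_imp)
      show o: "open (dom \<tau> \<inter> (V \<inter> W))"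
        using V W E.open_triv[OF t(1)] E'.open_triv[OF t(2)] unfolding smooth_section_def \<tau> dom_tensor_triv by auto
      have 1: "smooth_map_on A (dom t \<inter> V) (\<lambda>y. fcoord t y (s y))" "smooth_map_on A (dom t' \<inter> W) (\<lambda>y. fcoord t' y (s' y))"
        using V W t unfolding smooth_section_def by auto
      show "smooth_map_on A (dom \<tau> \<inter> (V \<inter> W)) (\<lambda>y. outer (fcoord t y (s y)) (fcoord t' y (s' y)))"
        by (rule E.smooth_map_on_bounded_bilinear[OF o bounded_bilinear_outer
            E.smooth_map_on_subset[OF 1(1)] E.smooth_map_on_subset[OF 1(2)]])
          (auto simp: \<tau> dom_tensor_triv)
      show "outer (fcoord t y (s y)) (fcoord t' y (s' y)) = fcoord \<tau> y (tens y (s y) (s' y))"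
        if "y \<in> dom \<tau> \<inter> (V \<inter> W)" for y
        using V W t that unfolding smooth_section_def by (auto simp: \<tau> dom_tensor_triv fcoord_tens)
    qed
  qed
  with V W show ?thesis unfolding local_section_def by blast
qed

text \<open>The Leibniz rule, in components.\<close>

lemma section_deriv_tens:
  assumes s: "local_section A E x s" "local_section A E' x s'"
    and ct: "c \<in> A" "t \<in> triv E" "t' \<in> triv E'" and x: "x \<in> dom c" "x \<in> dom t" "x \<in> dom t'"
  shows "section_deriv c (tensor_triv E E' t t') x (\<lambda>y. tens y (s y) (s' y)) u =
    outer (section_deriv c t x s u) (fcoord t' x (s' x)) + outer (fcoord t x (s x)) (section_deriv c t' x s' u)"
proof -
  from s obtain V W where V: "x \<in> V" "smooth_section A E V s" and W: "x \<in> W" "smooth_section A E' W s'"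
    unfolding local_section_def by blast
  then have U: "open (coord c ` (dom c \<inter> (dom t \<inter> dom t' \<inter> V \<inter> W)))"
    using ct unfolding smooth_section_def by (intro E.open_coord_image open_Int E.open_triv E'.open_triv) auto
  note d = bounded_bilinear.FDERIV[OF bounded_bilinear_outer
      E.has_derivative_section_rep[OF s(1) ct(1,2) x(1,2)] E'.has_derivative_section_rep[OF s(2) ct(1,3) x(1,3)]]
  have "(T.section_rep c (tensor_triv E E' t t') (\<lambda>y. tens y (s y) (s' y)) has_derivative
      (\<lambda>u. outer (E.section_rep c t s (coord c x)) (section_deriv c t' x s' u) +
        outer (section_deriv c t x s u) (E'.section_rep c t' s' (coord c x)))) (at (coord c x))"
    by (rule has_derivative_transform_within_open[OF d U])
      (use V W ct x in \<open>auto simp: E.section_rep_coord E'.section_rep_coord T.section_rep_coord smooth_section_def fcoord_tens\<close>)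
  from has_derivative_unique[OF T.has_derivative_section_rep[OF local_section_tens[OF s] ct(1) tensor_triv_in[OF ct(2,3)] x(1)] this]
  show ?thesis
    using x ct by (simp add: dom_tensor_triv E.section_rep_coord E'.section_rep_coord add.commute)
qed

end

section \<open>The tensor product connection and its curvature\<close>

lemma bilinear_vec_expand:
  fixes y :: "real ^ 'k::finite" and y' :: "real ^ 'l::finite"
  assumes "\<And>y'. linear (\<lambda>y. b y y')" "\<And>y. linear (b y)"
  shows "b y y' = (\<Sum>p\<in>UNIV. outer y y' $ p *\<^sub>R b (axis (fst p) 1) (axis (snd p) 1))"
proof -
  have "b y y' = (\<Sum>i\<in>UNIV. y $ i *\<^sub>R b (axis i 1) y')"
    by (rule linear_vec_expand[OF assms(1)])
  also have "\<dots> = (\<Sum>i\<in>UNIV. y $ i *\<^sub>R (\<Sum>j\<in>UNIV. y' $ j *\<^sub>R b (axis i 1) (axis j 1)))"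
    by (intro sum.cong refl arg_cong2[of _ _ _ _ scaleR] linear_vec_expand[OF assms(2)])
  also have "\<dots> = (\<Sum>p\<in>UNIV. outer y y' $ p *\<^sub>R b (axis (fst p) 1) (axis (snd p) 1))"
    by (simp add: scaleR_sum_right sum.cartesian_product case_prod_beta outer_def)
  finally show ?thesis .
qed

text \<open>Applying the coefficients of the product twice to \<open>y \<otimes> y'\<close> yields, besides the two terms that
  belong to the factors, the mixed terms \<open>\<Gamma>\<^sub>v y \<otimes> \<Gamma>'\<^sub>u y' + \<Gamma>\<^sub>u y \<otimes> \<Gamma>'\<^sub>v y'\<close>. They are symmetric in \<open>u\<close> and \<open>v\<close>
  and cancel.\<close>

lemma local_curvature_outer:
  fixes G :: "'z::euclidean_space \<Rightarrow> real ^ 'k::finite \<Rightarrow> 'z \<Rightarrow> real ^ 'k"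
    and G' :: "'z \<Rightarrow> real ^ 'l::finite \<Rightarrow> 'z \<Rightarrow> real ^ 'l"
  assumes U: "open U" "z \<in> U" and G: "smooth_coeff V G" "U \<subseteq> V" and G': "smooth_coeff V' G'" "U \<subseteq> V'"
    and H: "linear (\<lambda>w. H z w u)" "linear (\<lambda>w. H z w v)"
    and outer: "\<And>z y y' u. z \<in> U \<Longrightarrow> H z (outer y y') u = outer (G z y u) y' + outer y (G' z y' u)"
  shows "local_curvature H z (outer y y') u v =
    outer (local_curvature G z y u v) y' + outer y (local_curvature G' z y' u v)"
proof -
  interpret outer: bounded_bilinear "outer :: real ^ 'k \<Rightarrow> real ^ 'l \<Rightarrow> _" by (rule bounded_bilinear_outer)
  have zV: "z \<in> V" "z \<in> V'" using U G G' by auto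
  have D: "frechet_derivative (\<lambda>z. H z (outer y y') u) (at z) v =
      outer (frechet_derivative (\<lambda>z. G z y u) (at z) v) y' + outer y (frechet_derivative (\<lambda>z. G' z y' u) (at z) v)" for u v
  proof -
    have "((\<lambda>z. outer (G z y u) y' + outer y (G' z y' u)) has_derivative
      (\<lambda>v. outer (frechet_derivative (\<lambda>z. G z y u) (at z) v) y' + outer y (frechet_derivative (\<lambda>z. G' z y' u) (at z) v))) (at z)"
      by (intro has_derivative_add
          bounded_linear.has_derivative[OF outer.bounded_linear_left]
          bounded_linear.has_derivative[OF outer.bounded_linear_right]
          smooth_on_has_derivative[OF smooth_coeffD(2)[OF G(1)] zV(1)]
          smooth_on_has_derivative[OF smooth_coeffD(2)[OF G'(1)] zV(2)])
    then have "((\<lambda>z. H z (outer y y') u) has_derivative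
      (\<lambda>v. outer (frechet_derivative (\<lambda>z. G z y u) (at z) v) y' + outer y (frechet_derivative (\<lambda>z. G' z y' u) (at z) v))) (at z)"
      by (rule has_derivative_transform_within_open[OF _ U]) (simp add: outer)
    then show ?thesis by (simp add: frechet_derivative_eqI)
  qed
  have HH: "H z (H z (outer y y') b) a = (outer (G z (G z y b) a) y' + outer (G z y b) (G' z y' a))
      + (outer (G z y a) (G' z y' b) + outer y (G' z (G' z y' b) a))" if "linear (\<lambda>w. H z w a)" for a b
    by (simp add: outer[OF U(2)] linear_add[OF that])
  show ?thesis
    unfolding local_curvature_def D HH[OF H(1)] HH[OF H(2)]
    by (simp add: outer.add_left outer.add_right outer.diff_left outer.diff_right)
qed

locale connection_pair = bundle_pair A E E' + E: linear_connection_on A E K + E': linear_connection_on A E' K'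
  for A :: "('m::{second_countable_topology, t2_space}, 'n::finite) chart set"
    and E :: "('m, 'e::real_vector, 'k::finite) vbundle"
    and E' :: "('m, 'f::real_vector, 'l::finite) vbundle"
    and K :: "('m, 'e) conn" and K' :: "('m, 'f) conn"
begin

text \<open>The linear extension of \<open>y \<otimes> y' \<mapsto> \<Gamma>\<^sub>u y \<otimes> y' + y \<otimes> \<Gamma>'\<^sub>u y'\<close> from basis tensors to all tensors.\<close>

definition tensor_coeff where
  "tensor_coeff c t t' z w u = (\<Sum>p\<in>UNIV. w $ p *\<^sub>R
     (outer (E.coeff c t z (axis (fst p) 1) u) (axis (snd p) 1) + outer (axis (fst p) 1) (E'.coeff c t' z (axis (snd p) 1) u)))"

lemma linear_tensor_coeff: "linear (\<lambda>w. tensor_coeff c t t' z w u)"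
  by (rule linearI) (simp_all add: tensor_coeff_def algebra_simps sum.distrib scaleR_sum_right)

lemma tensor_coeff_outer:
  assumes "c \<in> A" "t \<in> triv E" "t' \<in> triv E'" "z \<in> E.chart_region c t" "z \<in> E'.chart_region c t'"
  shows "tensor_coeff c t t' z (outer y y') u = outer (E.coeff c t z y u) y' + outer y (E'.coeff c t' z y' u)"
proof -
  note l = smooth_coeffD(3)[OF E.smooth_coeff_coeff[OF assms(1,2)] assms(4)]
    smooth_coeffD(3)[OF E'.smooth_coeff_coeff[OF assms(1,3)] assms(5)]
  have "linear (\<lambda>y. outer (E.coeff c t z y u) y' + outer y (E'.coeff c t' z y' u))" for y'
    by (intro linear_compose_add linear_outer_left linear_compose[OF l(1) linear_outer_left, unfolded o_def])
  moreover have "linear (\<lambda>y'. outer (E.coeff c t z y u) y' + outer y (E'.coeff c t' z y' u))" for y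
    by (intro linear_compose_add linear_outer_right linear_compose[OF l(2) linear_outer_right, unfolded o_def])
  ultimately show ?thesis
    unfolding tensor_coeff_def by (rule bilinear_vec_expand[symmetric])
qed

text \<open>Prescribing the derivative in all coordinate systems at once makes the definition manifestly
  independent of choices. The price is that it has to be shown that the prescriptions are compatible, which
  is the nonemptiness of these sets.\<close>

definition product_conn where
  "product_conn x w = {r. local_section A T x r \<and> r x = w \<and>
     (\<forall>c\<in>A. \<forall>t\<in>triv E. \<forall>t'\<in>triv E'. x \<in> dom c \<and> x \<in> dom t \<and> x \<in> dom t' \<longrightarrow>
        (\<forall>u. section_deriv c (tensor_triv E E' t t') x r u =
          tensor_coeff c t t' (coord c x) (fcoord (tensor_triv E E' t t') x w) u))}"

lemma product_conn_tens:
  assumes x: "x \<in> points A" and e: "e \<in> fib E x" "e' \<in> fib E' x" and s: "s \<in> K x e" "s' \<in> K' x e'"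
  shows "(\<lambda>y. tens y (s y) (s' y)) \<in> product_conn x (tens x e e')"
proof -
  have ls: "local_section A E x s" "s x = e" "local_section A E' x s'" "s' x = e'"
    using E.connection_jet(2)[OF x e(1) s(1)] E'.connection_jet(2)[OF x e(2) s(2)] by auto
  show ?thesis
    unfolding product_conn_def using e s ls
    by (simp add: local_section_tens section_deriv_tens fcoord_tens
      tensor_coeff_outer E.coord_in_chart_region E'.coord_in_chart_region
      E.section_deriv_connection E'.section_deriv_connection)
qed

lemma product_conn_add:
  assumes "r \<in> product_conn x w" "r' \<in> product_conn x w'"
  shows "(\<lambda>y. r y + r' y) \<in> product_conn x (w + w')"
  using assms unfolding product_conn_def
  by (auto simp: T.local_section_add T.section_deriv_add tensor_triv_in dom_tensor_triv
    linear_add[OF linear_fcoord_tensor_triv] linear_add[OF linear_tensor_coeff])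

lemma product_conn_scale:
  assumes "r \<in> product_conn x w"
  shows "(\<lambda>y. a *\<^sub>R r y) \<in> product_conn x (a *\<^sub>R w)"
  using assms unfolding product_conn_def
  by (auto simp: T.local_section_scale T.section_deriv_scale tensor_triv_in dom_tensor_triv
    linear_scale[OF linear_fcoord_tensor_triv] linear_scale[OF linear_tensor_coeff])

lemma product_conn_jet:
  assumes r: "r \<in> product_conn x w"
  shows "product_conn x w = jet A T x r"
proof (intro equalityI subsetI)
  fix s assume s: "s \<in> product_conn x w"
  have "section_deriv c \<tau> x s = section_deriv c \<tau> x r" if "c \<in> A" "\<tau> \<in> triv T" "x \<in> dom c" "x \<in> dom \<tau>" for c \<tau>
  proof -
    from that(2) obtain t t' where "t \<in> triv E" "t' \<in> triv E'" "\<tau> = tensor_triv E E' t t'"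
      unfolding triv_tensor_bundle by blast
    with r s that show ?thesis unfolding product_conn_def fun_eq_iff by (simp add: dom_tensor_triv)
  qed
  with r s show "s \<in> jet A T x r" unfolding product_conn_def jet_def by simp
next
  fix s assume "s \<in> jet A T x r"
  with r show "s \<in> product_conn x w" unfolding product_conn_def jet_def by (simp add: tensor_triv_in dom_tensor_triv)
qed

text \<open>Compatibility of the prescribed derivatives costs no computation with transition functions: tensor
  products of sections satisfy them in every coordinate system, sums and multiples inherit this, and
  simple tensors span.\<close>

lemma product_conn_nonempty:
  assumes x: "x \<in> points A" and w: "w \<in> fib T x"
  shows "\<exists>r. r \<in> product_conn x w"
proof -
  obtain t t' where t: "t \<in> triv E" "t' \<in> triv E'" "x \<in> dom t" "x \<in> dom t'"
    using E.triv_at[OF x] E'.triv_at[OF x] by blast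
  have frame: "\<exists>r. r \<in> product_conn x (a *\<^sub>R frame_elem t t' x p)" for p a
    using E.connection_jet(1)[OF x E.fpoint_in_fib[OF t(1,3)]] E'.connection_jet(1)[OF x E'.fpoint_in_fib[OF t(2,4)]]
      product_conn_tens[OF x E.fpoint_in_fib[OF t(1,3)] E'.fpoint_in_fib[OF t(2,4)]] product_conn_scale by meson
  have "\<exists>r. r \<in> product_conn x (\<Sum>p\<in>P. f p *\<^sub>R frame_elem t t' x p)" for P and f :: "'k \<times> 'l \<Rightarrow> real"
  proof (induction P rule: infinite_finite_induct)
    case (infinite P)
    show ?case unfolding sum.infinite[OF infinite] using frame[of 0 undefined] unfolding scaleR_zero_left .
  next
    case empty
    show ?case unfolding sum.empty using frame[of 0 undefined] unfolding scaleR_zero_left .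
  next
    case (insert p P)
    then obtain r r' where "r \<in> product_conn x (f p *\<^sub>R frame_elem t t' x p)"
      "r' \<in> product_conn x (\<Sum>p\<in>P. f p *\<^sub>R frame_elem t t' x p)"
      using frame by blast
    from product_conn_add[OF this] show ?case unfolding sum.insert[OF insert(1,2)] by blast
  qed
  from this[of "\<lambda>p. fcoord (tensor_triv E E' t t') x w $ p" UNIV] show ?thesis
    unfolding tensor_expand[OF t(1,3,2,4) w[unfolded fib_tensor_bundle], symmetric] .
qed

lemma product_conn_section_deriv:
  assumes "c \<in> A" "t \<in> triv E" "t' \<in> triv E'" "x \<in> dom c" "x \<in> dom t" "x \<in> dom t'" "r \<in> product_conn x w"
  shows "section_deriv c (tensor_triv E E' t t') x r u =
    tensor_coeff c t t' (coord c x) (fcoord (tensor_triv E E' t t') x w) u"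
  using assms unfolding product_conn_def by blast

text \<open>In coordinates the construction is an explicit formula, whose smoothness is evident.\<close>

lemma product_conn_jet_deriv:
  assumes ct: "c \<in> A" "t \<in> triv E" "t' \<in> triv E'" and z: "z \<in> coord c ` (dom c \<inter> (dom t \<inter> dom t'))"
  shows "jet_deriv c (tensor_triv E E' t t') (point c z)
     (product_conn (point c z) (fpoint T (tensor_triv E E' t t') (point c z) w)) u = tensor_coeff c t t' z w u"
proof -
  let ?x = "point c z" and ?\<tau> = "tensor_triv E E' t t'"
  have x: "?x \<in> dom c" "?x \<in> dom t" "?x \<in> dom t'" "coord c ?x = z"
    using E.coord_imageE[OF ct(1) z] by auto
  note \<tau> = tensor_triv_in[OF ct(2,3)]
  have x\<tau>: "?x \<in> dom ?\<tau>" using x by (simp add: dom_tensor_triv)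
  have "\<exists>r. r \<in> product_conn ?x (fpoint T ?\<tau> ?x w)"
    by (rule product_conn_nonempty[OF E.triv_points[OF ct(2) x(2)] T.fpoint_in_fib[OF \<tau> x\<tau>]])
  then have "(SOME r. r \<in> product_conn ?x (fpoint T ?\<tau> ?x w)) \<in> product_conn ?x (fpoint T ?\<tau> ?x w)"
    by (rule someI_ex)
  from product_conn_section_deriv[OF ct x(1-3) this] show ?thesis
    unfolding jet_deriv_def T.fcoord_fpoint[OF \<tau> x\<tau>] x(4) .
qed

lemma smooth_tensor_coeff:
  assumes ct: "c \<in> A" "t \<in> triv E" "t' \<in> triv E'"
  shows "smooth_on (coord c ` (dom c \<inter> (dom t \<inter> dom t')) \<times> UNIV) (\<lambda>(z, w). tensor_coeff c t t' z w u)"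
proof -
  let ?U = "coord c ` (dom c \<inter> (dom t \<inter> dom t'))"
  have oU: "open ?U" using ct by (intro E.open_coord_image open_Int E.open_triv E'.open_triv)
  have oS: "open (?U \<times> (UNIV :: (real ^ ('k \<times> 'l)) set))" by (intro open_Times oU open_UNIV)
  define q where "q z p = outer (E.coeff c t z (axis (fst p) 1) u) (axis (snd p) 1) +
    outer (axis (fst p) 1) (E'.coeff c t' z (axis (snd p) 1) u)" for z p
  have "smooth_on ?U (\<lambda>z. E.coeff c t z y u)" "smooth_on ?U (\<lambda>z. E'.coeff c t' z y' u)" for y y'
    by (rule smooth_on_subset[OF smooth_coeffD(2)[OF E.smooth_coeff_coeff[OF ct(1,2)]]]
        smooth_on_subset[OF smooth_coeffD(2)[OF E'.smooth_coeff_coeff[OF ct(1,3)]]],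
        auto simp: E.chart_region_def E'.chart_region_def)+
  then have "smooth_on ?U (\<lambda>z. q z p)" for p
    unfolding q_def by (intro smooth_on_add smooth_on_bounded_bilinear[OF _ bounded_bilinear_outer] smooth_on_const oU)
  then have q: "smooth_on (?U \<times> (UNIV :: (real ^ ('k \<times> 'l)) set)) (\<lambda>p. q (fst p) j)" for j
    by (intro smooth_on_comp_linear[OF oU oS bounded_linear_fst, of "\<lambda>z. q z j"]) auto
  show ?thesis
    unfolding tensor_coeff_def case_prod_beta q_def[symmetric]
    by (intro smooth_on_sum smooth_on_scaleR smooth_on_vec_nth q oS smooth_on_linear bounded_linear_snd)
qed

lemma product_conn_points: "r \<in> product_conn x w \<Longrightarrow> x \<in> points A \<and> w \<in> fib T x"
  unfolding product_conn_def using T.local_section_points T.local_section_in_fib by blast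

lemma jet_add_product_conn:
  assumes "x \<in> points A" "w \<in> fib T x" "w' \<in> fib T x"
  shows "product_conn x (w + w') = jet_add A T x (product_conn x w) (product_conn x w')"
proof -
  have "jet A T x (\<lambda>y. r y + r' y) = product_conn x (w + w')" if "r \<in> product_conn x w" "r' \<in> product_conn x w'" for r r'
    using product_conn_jet[OF product_conn_add[OF that]] ..
  with product_conn_nonempty[OF assms(1,2)] product_conn_nonempty[OF assms(1,3)] show ?thesis
    unfolding jet_add_def by blast
qed

lemma jet_scale_product_conn:
  assumes "x \<in> points A" "w \<in> fib T x"
  shows "product_conn x (a *\<^sub>R w) = jet_scale A T x a (product_conn x w)"
proof -
  have "jet A T x (\<lambda>y. a *\<^sub>R r y) = product_conn x (a *\<^sub>R w)" if "r \<in> product_conn x w" for r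
    using product_conn_jet[OF product_conn_scale[OF that]] ..
  with product_conn_nonempty[OF assms] show ?thesis
    unfolding jet_scale_def by blast
qed

lemma jet_tensor_product_conn:
  assumes "x \<in> points A" "e \<in> fib E x" "e' \<in> fib E' x"
  shows "product_conn x (tens x e e') = jet_tensor A E E' x (K x e) (K' x e')"
proof -
  have "jet A T x (\<lambda>y. tens y (s y) (s' y)) = product_conn x (tens x e e')" if "s \<in> K x e" "s' \<in> K' x e'" for s s'
    using product_conn_jet[OF product_conn_tens[OF assms that]] ..
  with E.connection_jet(1)[OF assms(1,2)] E'.connection_jet(1)[OF assms(1,3)] show ?thesis
    unfolding jet_tensor_def by blast
qed

lemma linear_connection_product_conn: "linear_connection A T product_conn"
  unfolding linear_connection_def
proof (intro conjI ballI allI impI)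
  show "product_conn x w \<in> jet_fib A T x" if "x \<in> points A" "w \<in> fib T x" for x w
    using product_conn_nonempty[OF that] product_conn_jet unfolding jet_fib_def product_conn_def by blast
  show "s x = w" if "s \<in> product_conn x w" for s x w
    using that unfolding product_conn_def by blast
  show "product_conn x w = {}" if "x \<notin> points A \<or> w \<notin> fib T x" for x w
    using that product_conn_points by blast
  show "smooth_on (coord c ` (dom c \<inter> dom \<tau>) \<times> UNIV)
      (\<lambda>(z, y). jet_deriv c \<tau> (point c z) (product_conn (point c z) (fpoint T \<tau> (point c z) y)) u)"
    if c: "c \<in> A" and \<tau>: "\<tau> \<in> triv T" for c \<tau> u
  proof -
    from \<tau> obtain t t' where t: "t \<in> triv E" "t' \<in> triv E'" and \<tau>: "\<tau> = tensor_triv E E' t t'"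
      unfolding triv_tensor_bundle by blast
    show ?thesis
      unfolding \<tau> dom_tensor_triv
    proof (rule smooth_on_cong_imp[OF _ smooth_tensor_coeff[OF c t]])
      show "open (coord c ` (dom c \<inter> (dom t \<inter> dom t')) \<times> (UNIV :: (real ^ ('k \<times> 'l)) set))"
        using c t by (intro open_Times open_UNIV E.open_coord_image open_Int E.open_triv E'.open_triv)
    qed (auto simp: product_conn_jet_deriv[OF c t])
  qed
qed (use jet_add_product_conn jet_scale_product_conn in auto)

text \<open>A linear connection respects sums and multiples, so its value on a tensor is determined by its
  values on the simple tensors in an expansion.\<close>

lemma tensor_connection_unique:
  assumes L: "linear_connection A T L" "\<And>x e e'. x \<in> points A \<Longrightarrow> e \<in> fib E x \<Longrightarrow> e' \<in> fib E' x \<Longrightarrow>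
      L x (tens x e e') = jet_tensor A E E' x (K x e) (K' x e')"
  shows "L = product_conn"
proof (intro ext)
  fix x w
  show "L x w = product_conn x w"
  proof (cases "x \<in> points A \<and> w \<in> fib T x")
    case False
    then show ?thesis
      using L(1) linear_connection_product_conn unfolding linear_connection_def by metis
  next
    case True
    then have x: "x \<in> points A" and w: "w \<in> fib T x" by auto
    obtain t t' where t: "t \<in> triv E" "t' \<in> triv E'" "x \<in> dom t" "x \<in> dom t'"
      using E.triv_at[OF x] E'.triv_at[OF x] by blast
    have add: "L x (w + w') = jet_add A T x (L x w) (L x w')" and scale: "L x (a *\<^sub>R w) = jet_scale A T x a (L x w)"
      if "w \<in> fib T x" "w' \<in> fib T x" for w w' a
      using L(1) x that unfolding linear_connection_def by blast+
    have frame: "L x (a *\<^sub>R frame_elem t t' x p) = product_conn x (a *\<^sub>R frame_elem t t' x p)" for a p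
      using t x by (simp add: scale[OF tens_in_fib tens_in_fib] jet_scale_product_conn tens_in_fib L(2) jet_tensor_product_conn
        E.fpoint_in_fib E'.fpoint_in_fib)
    have "L x (\<Sum>p\<in>P. f p *\<^sub>R frame_elem t t' x p) = product_conn x (\<Sum>p\<in>P. f p *\<^sub>R frame_elem t t' x p)"
      for P and f :: "'k \<times> 'l \<Rightarrow> real"
    proof (induction P rule: infinite_finite_induct)
      case (infinite P)
      show ?case unfolding sum.infinite[OF infinite] using frame[of 0 undefined] unfolding scaleR_zero_left .
    next
      case empty
      show ?case unfolding sum.empty using frame[of 0 undefined] unfolding scaleR_zero_left .
    next
      case (insert p P)
      have "f p *\<^sub>R frame_elem t t' x p \<in> fib T x" "(\<Sum>p\<in>P. f p *\<^sub>R frame_elem t t' x p) \<in> fib T x"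
        by (intro subspace_sum subspace_scale T.subspace_fib x tens_in_fib)+
      then show ?case
        unfolding sum.insert[OF insert(1,2)] by (simp only: add jet_add_product_conn[OF x] frame insert.IH)
    qed
    from this[of "\<lambda>p. fcoord (tensor_triv E E' t t') x w $ p" UNIV] show ?thesis
      unfolding tensor_expand[OF t(1,3,2,4) w[unfolded fib_tensor_bundle], symmetric] .
  qed
qed

lemma tensor_connection_eq: "tensor_connection A E E' K K' = product_conn"
  unfolding tensor_connection_def
proof (rule the_equality)
  show "linear_connection A T product_conn \<and> (\<forall>x\<in>points A. \<forall>e\<in>fib E x. \<forall>e'\<in>fib E' x.
      product_conn x (tens x e e') = jet_tensor A E E' x (K x e) (K' x e'))"
    by (intro conjI ballI linear_connection_product_conn jet_tensor_product_conn)
next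
  fix L assume "linear_connection A T L \<and> (\<forall>x\<in>points A. \<forall>e\<in>fib E x. \<forall>e'\<in>fib E' x.
      L x (tens x e e') = jet_tensor A E E' x (K x e) (K' x e'))"
  then show "L = product_conn" by (intro tensor_connection_unique) blast+
qed

sublocale TK: linear_connection_on A T "tensor_connection A E E' K K'"
  by unfold_locales (simp add: tensor_connection_eq linear_connection_product_conn)

lemma local_curvature_tensor:
  assumes ct: "c \<in> A" "t \<in> triv E" "t' \<in> triv E'" and x: "x \<in> dom c" "x \<in> dom t" "x \<in> dom t'"
  shows "local_curvature (TK.coeff c (tensor_triv E E' t t')) (coord c x) (outer y y') u v =
    outer (local_curvature (E.coeff c t) (coord c x) y u v) y' + outer y (local_curvature (E'.coeff c t') (coord c x) y' u v)"
proof -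
  let ?U = "coord c ` (dom c \<inter> (dom t \<inter> dom t'))"
  have T: "TK.coeff c (tensor_triv E E' t t') z w u = tensor_coeff c t t' z w u" if "z \<in> ?U" for z w u
    unfolding TK.coeff_def unfolding tensor_connection_eq by (rule product_conn_jet_deriv[OF ct that])
  have z: "coord c x \<in> ?U" using x by blast
  have lin: "linear (\<lambda>w. TK.coeff c (tensor_triv E E' t t') (coord c x) w u)" for u
    unfolding T[OF z] by (rule linear_tensor_coeff)
  show ?thesis
  proof (rule local_curvature_outer[OF _ z E.smooth_coeff_coeff[OF ct(1,2)] _ E'.smooth_coeff_coeff[OF ct(1,3)]])
    show "open ?U" using ct by (intro E.open_coord_image open_Int E.open_triv E'.open_triv)
    show sub: "?U \<subseteq> E.chart_region c t" "?U \<subseteq> E'.chart_region c t'"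
      by (auto simp: E.chart_region_def E'.chart_region_def)
    show "linear (\<lambda>w. TK.coeff c (tensor_triv E E' t t') (coord c x) w u)"
      "linear (\<lambda>w. TK.coeff c (tensor_triv E E' t t') (coord c x) w v)"
      by (rule lin)+
    show "TK.coeff c (tensor_triv E E' t t') z (outer y y') u =
        outer (E.coeff c t z y u) y' + outer y (E'.coeff c t' z y' u)" if "z \<in> ?U" for z y y' u
      unfolding T[OF that] by (rule tensor_coeff_outer[OF ct]) (use that sub in auto)
  qed
qed

lemma tensor_curvature_identity:
  "tensor_curvature_identity A E E' K K' (curvature A T (tensor_connection A E E' K K'))"
  unfolding tensor_curvature_identity_def E.fib_dual_bundle E'.fib_dual_bundle
proof (intro ballI)
  fix x e e' \<alpha> \<beta>
  assume x: "x \<in> points A" and e: "e \<in> fib E x" and e': "e' \<in> fib E' x"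
    and \<alpha>: "\<alpha> \<in> dual_space (fib E x)" and \<beta>: "\<beta> \<in> dual_space (fib E' x)"
  obtain c t t' where ct: "c \<in> A" "t \<in> triv E" "t' \<in> triv E'" and xc: "x \<in> dom c" "x \<in> dom t" "x \<in> dom t'"
    using E.chart_at[OF x] E.triv_at[OF x] E'.triv_at[OF x] by blast
  let ?\<tau> = "tensor_triv E E' t t'" and ?\<kappa> = "cotensor_elem E E' x \<alpha> \<beta>"
  note \<tau> = tensor_triv_in[OF ct(2,3)]
  have x\<tau>: "x \<in> dom ?\<tau>" using xc by (simp add: dom_tensor_triv)
  note \<kappa> = T.linear_dual_fpoint[OF \<tau> x\<tau> cotensor_elem_in_dual[of x \<alpha> \<beta>]]
  note la = E.linear_dual_fpoint[OF ct(2) xc(2) \<alpha>] and lb = E'.linear_dual_fpoint[OF ct(3) xc(3) \<beta>]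
  have \<kappa>_outer: "?\<kappa> (fpoint T ?\<tau> x (outer y y')) = \<alpha> (fpoint E t x y) * \<beta> (fpoint E' t' x y')" for y y'
    using \<alpha> \<beta> by (simp add: fpoint_outer[OF ct(2,3) xc(2,3)] cotensor_elem_def tens_in_fib)
      (simp add: tensor_elem_def)
  show "curvature A T (tensor_connection A E E' K K') x (tens x e e') ?\<kappa> =
      \<beta> e' *\<^sub>R curvature A E K x e \<alpha> + \<alpha> e *\<^sub>R curvature A E' K' x e' \<beta>"
    unfolding TK.curvature_eq[OF ct(1) \<tau> xc(1) x\<tau> tens_in_fib] E.curvature_eq[OF ct(1,2) xc(1,2) e]
      E'.curvature_eq[OF ct(1,3) xc(1,3) e'] fcoord_tens[OF ct(2,3) xc(2,3) e e'] local_curvature_tensor[OF ct xc]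
    by (intro ext)
      (simp add: linear_scale[OF \<kappa>] linear_add[OF \<kappa>] \<kappa>_outer scaleR_fun_apply
        linear_scale[OF la] linear_scale[OF lb] E.fpoint_fcoord[OF ct(2) xc(2) e] E'.fpoint_fcoord[OF ct(3) xc(3) e']
        algebra_simps)
qed

end

theorem theorem2p6:
  fixes A :: "('m::{second_countable_topology, t2_space}, 'n::finite) chart set"
    and E :: "('m, 'e::real_vector, 'k::finite) vbundle"
    and E' :: "('m, 'f::real_vector, 'l::finite) vbundle"
    and K :: "('m, 'e) conn" and K' :: "('m, 'f) conn"
  assumes "smooth_manifold A"
    and "vector_bundle A E" and "vector_bundle A E'"
    and "linear_connection A E K" and "linear_connection A E' K'"
  shows "let T = tensor_bundle E E'; R = curvature A T (tensor_connection A E E' K K') in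
    bilinear_morphism A T (dual_bundle T) R
    \<and> tensor_curvature_identity A E E' K K' R
    \<and> (\<forall>B. bilinear_morphism A T (dual_bundle T) B \<and> tensor_curvature_identity A E E' K K' B
          \<longrightarrow> (\<forall>x\<in>points A. \<forall>w\<in>fib T x. \<forall>\<omega>\<in>fib (dual_bundle T) x. B x w \<omega> = R x w \<omega>))"
proof -
  interpret connection_pair A E E' K K'
    by unfold_locales (rule assms)+
  let ?R = "curvature A T (tensor_connection A E E' K K')"
  have unique: "B x w \<omega> = ?R x w \<omega>"
    if B: "bilinear_morphism A T (dual_bundle T) B" "tensor_curvature_identity A E E' K K' B"
      and x: "x \<in> points A" and w: "w \<in> fib T x" and \<omega>: "\<omega> \<in> fib (dual_bundle T) x" for B x w \<omega>
  proof (rule bilinear_on_tensor_unique[OF x _ _ _ w \<omega>[unfolded T.fib_dual_bundle]])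
    show "bilinear_on (fib T x) (dual_space (fib T x)) (B x)"
      using B(1) x unfolding bilinear_morphism_def T.fib_dual_bundle by blast
    show "bilinear_on (fib T x) (dual_space (fib T x)) (?R x)"
      by (rule TK.bilinear_curvature[OF x])
    show "B x (tens x e e') (cotensor_elem E E' x \<alpha> \<beta>) = ?R x (tens x e e') (cotensor_elem E E' x \<alpha> \<beta>)"
      if "e \<in> fib E x" "e' \<in> fib E' x" "\<alpha> \<in> dual_space (fib E x)" "\<beta> \<in> dual_space (fib E' x)" for e e' \<alpha> \<beta>
      using B(2) tensor_curvature_identity x that
      unfolding tensor_curvature_identity_def E.fib_dual_bundle E'.fib_dual_bundle by simp
  qed
  show ?thesis
    unfolding Let_def using TK.bilinear_morphism_curvature tensor_curvature_identity unique by blast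
qed

end
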